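(* Let a non-zero function $K(t)$ on the real line be given (that is, $K(t)\neq 0$ for all real $t$), such that $K(t)-1\in\{\!\{0\}\!\}$ and $\mathrm{ind}\,K(t)=0$. Consider the Riemann–Hilbert factorisation problem: it is required to find two functions $K^{\pm}(z)$, analytic in the upper and lower half-planes respectively, with boundary functions $K^{\pm}(t)$ on the real line belonging to the classes $\{\!\{0,\infty\}\!\}$ and $\{\!\{-\infty,0\}\!\}$ respectively, and satisfying $$K(t)=K^{+}(t)K^{-}(t)\qquad\text{on the real line.}$$ The solution of this problem can be expressed as $$K^{+}(z)=\exp\left(\frac{1}{\sqrt{2\pi}}\int_{0}^{\infty}\kappa(t)\,e^{izt}\,dt\right)\quad\text{and}\quad K^{-}(z)=\exp\left(-\frac{1}{\sqrt{2\pi}}\int_{-\infty}^{0}\kappa(t)\,e^{izt}\,dt\right),$$ where $\kappa(t)$ is the inverse Fourier transform of $\ln K(t)$.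
   Context: The Fourier transform of a function $f(t)$ is $F(x)=\frac{1}{\sqrt{2\pi}}\int_{-\infty}^{\infty} f(t)e^{ixt}\,dt$, $-\infty<x<\infty$; the same formula is used for complex $x$ whenever the integral is absolutely convergent. The inverse Fourier transform of $F$ is $f(t)=\frac{1}{\sqrt{2\pi}}\int_{-\infty}^{\infty}F(x)e^{-ixt}\,dx$. $\{\!\{0\}\!\}$ is the intersection of $L_2(\mathbb{R})$ with the Hölder continuous functions on $\mathbb{R}$. $\{0\}$ is the pre-image of $\{\!\{0\}\!\}$ under the Fourier transform. For a function $f$ on the real axis put $f_+(t)=f(t)$ for $t>0$, $f_+(t)=0$ for $t<0$; and $f_-(t)=0$ for $t>0$, $f_-(t)=-f(t)$ for $t<0$. The class $\{0,\infty\}$ consists of the functions $f_+$ with $f\in\{0\}$, and the class $\{-\infty,0\}$ consists of the functions $f_-$ with $f\in\{0\}$. The classes of Fourier transforms of functions in $\{0,\infty\}$ and $\{-\infty,0\}$ are denoted $\{\!\{0,\infty\}\!\}$ and $\{\!\{-\infty,0\}\!\}$; their members are analytic in $\mathrm{Im}\,z>0$ and $\mathrm{Im}\,z<0$ respectively. The index of a continuous non-zero function $K(t)$ on the real line is $\mathrm{ind}(K(t))=\frac{1}{2\pi}\big(\lim_{t\to+\infty}\arg K(t)-\lim_{t\to-\infty}\arg K(t)\big)$, i.e. the winding number of the curve $(\mathrm{Re}\,K(t),\mathrm{Im}\,K(t))$, $t\in\mathbb{R}$. The condition $\mathrm{ind}\,K(t)=0$ ensures that $\ln K(t)$ is sin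gle-valued.
   Formalization: As printed no solution exists: K± tend to 0 while K tends to 1, and the minus sign in K^- gives a wrong product. Corrected: K± − 1 lie in the classes, and K^- has a plus sign in its exponent. Uniqueness is stated among factors without zeros in the open half-planes, being false otherwise. *)

theory Defs
  imports "HOL-Complex_Analysis.Complex_Analysis"
begin

text \<open>Elements of $L_2$ are represented by Borel functions; passing to an a.e. equal function is
  left to the relations below.\<close>

definition square_integrable :: "(real \<Rightarrow> complex) \<Rightarrow> bool" where
  "square_integrable f \<longleftrightarrow>
     f \<in> borel_measurable borel \<and> integrable lborel (\<lambda>t. (cmod (f t))\<^sup>2)"

definition hoelder_continuous :: "(real \<Rightarrow> complex) \<Rightarrow> bool" where
  "hoelder_continuous f \<longleftrightarrow>
     (\<exists>C a. 0 < a \<and> a \<le> 1 \<and> (\<forall>x y. cmod (f x - f y) \<le> C * \<bar>x - y\<bar> powr a))"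

text \<open>The functions to be transformed are in $L_2$ but need not be in $L_1$, so the defining integral
  is the limit in quadratic mean of its truncations. This determines the transform up to a null set,
  which is why it is a relation. The mean square distance is a nonnegative integral
  with values in \<^typ>\<open>ennreal\<close>, so that it cannot vanish merely by failing to be finite.\<close>

definition has_fourier :: "(real \<Rightarrow> complex) \<Rightarrow> (real \<Rightarrow> complex) \<Rightarrow> bool" where
  "has_fourier f F \<longleftrightarrow> square_integrable f \<and> square_integrable F \<and>
     ((\<lambda>R::real. \<integral>\<^sup>+x. ennreal ((cmod (F x -
          (1 / complex_of_real (sqrt (2 * pi))) *
            (LINT t:{-R..R}|lborel. f t * exp (\<i> * of_real x * of_real t))))\<^sup>2) \<partial>lborel)
        \<longlongrightarrow> 0) at_top"

definition has_inverse_fourier :: "(real \<Rightarrow> complex) \<Rightarrow> (real \<Rightarrow> complex) \<Rightarrow> bool" where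
  "has_inverse_fourier F f \<longleftrightarrow> square_integrable F \<and> square_integrable f \<and>
     ((\<lambda>R::real. \<integral>\<^sup>+t. ennreal ((cmod (f t -
          (1 / complex_of_real (sqrt (2 * pi))) *
            (LINT x:{-R..R}|lborel. F x * exp (- (\<i> * of_real x * of_real t)))))\<^sup>2) \<partial>lborel)
        \<longlongrightarrow> 0) at_top"

text \<open>In the names below, \<open>hat\<close> marks the classes written with double braces, i.e. the classes of
  Fourier transforms.\<close>

definition hat_class0 :: "(real \<Rightarrow> complex) set" where
  "hat_class0 = {F. square_integrable F \<and> hoelder_continuous F}"

definition class0 :: "(real \<Rightarrow> complex) set" where
  "class0 = {f. \<exists>F\<in>hat_class0. has_fourier f F}"

definition plus_part :: "(real \<Rightarrow> complex) \<Rightarrow> real \<Rightarrow> complex" where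
  "plus_part f t = (if t > 0 then f t else 0)"

definition minus_part :: "(real \<Rightarrow> complex) \<Rightarrow> real \<Rightarrow> complex" where
  "minus_part f t = (if t < 0 then - f t else 0)"

definition class_plus :: "(real \<Rightarrow> complex) set" where
  "class_plus = plus_part ` class0"

definition class_minus :: "(real \<Rightarrow> complex) set" where
  "class_minus = minus_part ` class0"

definition hat_class_plus :: "(real \<Rightarrow> complex) set" where
  "hat_class_plus = {F. \<exists>f\<in>class_plus. has_fourier f F}"

definition hat_class_minus :: "(real \<Rightarrow> complex) set" where
  "hat_class_minus = {F. \<exists>f\<in>class_minus. has_fourier f F}"

text \<open>Here \<open>\<theta>\<close> is a continuous choice of the argument of \<open>K\<close>.\<close>

definition has_index :: "(real \<Rightarrow> complex) \<Rightarrow> real \<Rightarrow> bool" where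
  "has_index K r \<longleftrightarrow>
     (\<exists>\<theta> a b. continuous_on UNIV \<theta> \<and> (\<forall>t. K t = rcis (cmod (K t)) (\<theta> t)) \<and>
        (\<theta> \<longlongrightarrow> a) at_top \<and> (\<theta> \<longlongrightarrow> b) at_bot \<and> r = (a - b) / (2 * pi))"

text \<open>The logarithm along the line is the continuous branch, not the principal one. The branches
  differ by multiples of $2\pi i$; since \<open>K\<close> tends to 1, the one that can be square integrable is
  the one vanishing at $+\infty$. It also vanishes at $-\infty$ exactly when the index is 0.\<close>

definition ln_line :: "(real \<Rightarrow> complex) \<Rightarrow> real \<Rightarrow> complex" where
  "ln_line K = (THE L. continuous_on UNIV L \<and> (\<forall>t. exp (L t) = K t) \<and> (L \<longlongrightarrow> 0) at_top)"

text \<open>The boundary functions are denoted \<open>kp\<close> and \<open>km\<close>. Members of the transform classes are square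
  integrable, and their continuous representatives vanish at infinity, while
  \<open>K = kp km\<close> tends to 1. So it is \<open>kp - 1\<close> and \<open>km - 1\<close> that belong to the classes, just as
  \<open>K - 1\<close> does.\<close>

definition RH_factorisation ::
    "(real \<Rightarrow> complex) \<Rightarrow> (complex \<Rightarrow> complex) \<Rightarrow> (complex \<Rightarrow> complex) \<Rightarrow> bool" where
  "RH_factorisation K Kp Km \<longleftrightarrow>
     Kp holomorphic_on {z. Im z > 0} \<and> Km holomorphic_on {z. Im z < 0} \<and>
     (\<exists>kp km.
        (\<forall>t. (Kp \<longlongrightarrow> kp t) (at (complex_of_real t) within {z. Im z > 0})) \<and>
        (\<forall>t. (Km \<longlongrightarrow> km t) (at (complex_of_real t) within {z. Im z < 0})) \<and>
        (\<lambda>t. kp t - 1) \<in> hat_class_plus \<and>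
        (\<lambda>t. km t - 1) \<in> hat_class_minus \<and>
        (\<forall>t. K t = kp t * km t))"

definition factor_plus :: "(real \<Rightarrow> complex) \<Rightarrow> complex \<Rightarrow> complex" where
  "factor_plus \<kappa> z = exp ((1 / complex_of_real (sqrt (2 * pi))) *
     (LINT t:{0..}|lborel. \<kappa> t * exp (\<i> * z * of_real t)))"

text \<open>The sign in the exponent is positive because \<open>K\<close> is the product of the factors: the two
  half-line integrals must add up to the transform of \<open>\<kappa>\<close>, which is the logarithm of \<open>K\<close>. Written
  with \<open>minus_part \<kappa>\<close>, which is \<open>-\<kappa>\<close> on the negative half-line, the sign would be negative.\<close>

definition factor_minus :: "(real \<Rightarrow> complex) \<Rightarrow> complex \<Rightarrow> complex" where
  "factor_minus \<kappa> z = exp ((1 / complex_of_real (sqrt (2 * pi))) *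
     (LINT t:{..0}|lborel. \<kappa> t * exp (\<i> * z * of_real t)))"

end

theory Submission
  imports Defs "HOL-Real_Asymp.Real_Asymp"
begin

text \<open>The factorisation is obtained by taking logarithms. Since the index is zero, \<open>K\<close> has a continuous
  logarithm \<open>L\<close> that vanishes at both ends of the line, and \<open>L\<close> inherits square integrability and
  Hoelder continuity from \<open>K - 1\<close> (\<open>ln_line_in_hat_class0\<close>). So it is enough to split \<open>L\<close> additively into
  boundary values of functions analytic above and below the line, and to exponentiate.

  The splitting is done on the Fourier side. For \<open>L\<close> Hoelder continuous, its inverse transform \<open>\<kappa>\<close> in the
  quadratic mean transforms back to \<open>L\<close> (\<open>fourier_inversion\<close>), and the part of \<open>\<kappa>\<close> on the
  positive half-line has a transform \<open>E\<close> that makes sense for complex arguments in the upper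
  half-plane. The point is that \<open>E\<close>, like \<open>L\<close>, is Hoelder continuous, up to the real line. Its derivative is
  \<open>1/(2 \<pi> \<i>) \<integral> L(x)/(x - z)\<^sup>2 dx\<close>; as the kernel has integral 0, \<open>L(x)\<close> may be replaced by
  \<open>L(x) - L(Re z)\<close>, and a Hoelder exponent \<open>a < 1\<close> gives \<open>\<bar>E'(z)\<bar> \<le> M * Im z powr (a - 1)\<close>
  (\<open>upper_ext_derivative_bound\<close>). Integrating this bound along paths that first rise from the
  boundary shows that \<open>E\<close> is Hoelder continuous on the closed half-plane (\<open>closed_ext_hoelder\<close>).
  On the line, \<open>E\<close> is the transform of the half-line part of \<open>\<kappa>\<close>, and \<open>E\<close> tends to 0 at infinity (\<open>closed_ext_vanishes\<close>).

  The boundary value of \<open>exp E - 1\<close> is again square integrable and Hoelder continuous, but it must also be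
  the transform of a function carried by the positive half-line. By Cauchy's theorem in the upper
  half-plane its integral against \<open>1/(x - w)\<^sup>2\<close> vanishes for \<open>w\<close> below the line; hence the extension
  built from the negative half-line is constant, and it is zero because it vanishes at infinity
  (\<open>has_fourier_plus_part_if_upper_analytic\<close>). The lower half-plane is treated by the
  reflection \<open>z \<mapsto> - z\<close>.

  For uniqueness, a factor analytic in the upper half-plane is determined by its boundary values, so
  that every admissible factor minus 1 is such an extension \<open>E\<close>, and the factor tends to 1 at infinity
  (\<open>plus_factor_tendsto_1\<close>). The quotients of two factorisations in the two half-planes agree on the
  line and paste together to an entire function with limit 1 at infinity, which is constant by
  Liouville's theorem (\<open>RH_factorisation_unique\<close>).

  The Fourier theory in the quadratic mean rests on Bessel's inequality, derived from the Poisson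
  kernel (\<open>energy_fourier_le\<close>), and on completeness (\<open>energy_complete\<close>).\<close>

section \<open>Energy of square integrable functions\<close>

text \<open>The squared $L_2$ norm, as an extended nonnegative number. It is the quantity that tends to 0 in the
  definition of the transforms.\<close>

definition energy :: "(real \<Rightarrow> complex) \<Rightarrow> ennreal" where
  "energy f = (\<integral>\<^sup>+x. ennreal ((cmod (f x))\<^sup>2) \<partial>lborel)"

lemma square_integrable_iff_energy:
  "square_integrable f \<longleftrightarrow> f \<in> borel_measurable borel \<and> energy f < \<infinity>"
proof (cases "f \<in> borel_measurable borel")
  case True
  then have [measurable]: "f \<in> borel_measurable borel" .
  have "(\<lambda>t. (cmod (f t))\<^sup>2) \<in> borel_measurable lborel" by simp
  then show ?thesis
    by (simp add: square_integrable_def energy_def integrable_iff_bounded)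
qed (simp add: square_integrable_def)

lemma square_integrableD [measurable_dest]:
  "square_integrable f \<Longrightarrow> f \<in> borel_measurable borel"
  by (simp add: square_integrable_def)

lemma energy_finite: "square_integrable f \<Longrightarrow> energy f < \<infinity>"
  by (simp add: square_integrable_iff_energy)

lemma energy_mono:
  assumes "\<And>x. cmod (f x) \<le> cmod (g x)"
  shows "energy f \<le> energy g"
  unfolding energy_def by (intro nn_integral_mono ennreal_leI power_mono assms) auto

lemma energy_cong_AE: "(AE x in lborel. f x = g x) \<Longrightarrow> energy f = energy g"
  unfolding energy_def by (rule nn_integral_cong_AE) auto

lemma energy_add:
  assumes [measurable]: "f \<in> borel_measurable borel" "g \<in> borel_measurable borel"
  shows "energy (\<lambda>x. f x + g x) \<le> 2 * energy f + 2 * energy g"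
proof -
  have *: "(cmod (a + b))\<^sup>2 \<le> 2 * (cmod a)\<^sup>2 + 2 * (cmod b)\<^sup>2" for a b
  proof -
    have "(cmod (a + b))\<^sup>2 \<le> (cmod a + cmod b)\<^sup>2"
      by (intro power_mono norm_triangle_ineq) auto
    also have "\<dots> \<le> 2 * (cmod a)\<^sup>2 + 2 * (cmod b)\<^sup>2"
      using zero_le_power2[of "cmod a - cmod b"] by (simp add: power2_eq_square algebra_simps)
    finally show ?thesis .
  qed
  have "energy (\<lambda>x. f x + g x)
      \<le> (\<integral>\<^sup>+x. 2 * ennreal ((cmod (f x))\<^sup>2) + 2 * ennreal ((cmod (g x))\<^sup>2) \<partial>lborel)"
    unfolding energy_def
  proof (intro nn_integral_mono)
    fix x
    have "ennreal ((cmod (f x + g x))\<^sup>2) \<le> ennreal (2 * (cmod (f x))\<^sup>2 + 2 * (cmod (g x))\<^sup>2)"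
      by (intro ennreal_leI *)
    also have "\<dots> = 2 * ennreal ((cmod (f x))\<^sup>2) + 2 * ennreal ((cmod (g x))\<^sup>2)"
      by (simp add: ennreal_plus ennreal_mult)
    finally show "ennreal ((cmod (f x + g x))\<^sup>2) \<le> 2 * ennreal ((cmod (f x))\<^sup>2) + 2 * ennreal ((cmod (g x))\<^sup>2)" .
  qed
  also have "\<dots> = 2 * energy f + 2 * energy g"
    unfolding energy_def by (simp add: nn_integral_add nn_integral_cmult)
  finally show ?thesis .
qed



lemma energy_diff_commute: "energy (\<lambda>x. f x - g x) = energy (\<lambda>x. g x - f x)"
  by (simp add: energy_def norm_minus_commute)

text \<open>For squared norms the triangle inequality costs factors 2, which are harmless when both terms on the
  right tend to 0.\<close>

lemma energy_triangle:
  assumes [measurable]: "f \<in> borel_measurable borel" "g \<in> borel_measurable borel" "h \<in> borel_measurable borel"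
  shows "energy (\<lambda>x. f x - h x) \<le> 2 * energy (\<lambda>x. f x - g x) + 2 * energy (\<lambda>x. g x - h x)"
  using energy_add[of "\<lambda>x. f x - g x" "\<lambda>x. g x - h x"] by simp

lemma energy_scale: "energy (\<lambda>x. c * f x) = ennreal ((cmod c)\<^sup>2) * energy f"
  if [measurable]: "f \<in> borel_measurable borel"
  unfolding energy_def
  by (subst nn_integral_cmult[symmetric]) (auto simp: norm_mult power_mult_distrib ennreal_mult)

lemma energy_reflect:
  assumes [measurable]: "f \<in> borel_measurable borel"
  shows "energy (\<lambda>x. f (- x)) = energy f"
  unfolding energy_def
  using nn_integral_real_affine[of "\<lambda>x. ennreal ((cmod (f x))\<^sup>2)" "-1" 0] by simp

lemma energy_eq_0D:
  assumes "energy f = 0" and [measurable]: "f \<in> borel_measurable borel"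
  shows "AE x in lborel. f x = 0"
  using assms(1) unfolding energy_def by (subst (asm) nn_integral_0_iff_AE) auto

lemma square_integrable_add:
  assumes "square_integrable f" "square_integrable g"
  shows "square_integrable (\<lambda>x. f x + g x)"
proof -
  note [measurable] = assms[THEN square_integrableD]
  have "energy (\<lambda>x. f x + g x) \<le> 2 * energy f + 2 * energy g"
    by (rule energy_add) auto
  also have "\<dots> < \<infinity>"
    using assms[THEN energy_finite] by (auto simp: ennreal_mult_less_top)
  finally show ?thesis unfolding square_integrable_iff_energy by auto
qed

lemma square_integrable_scale: "square_integrable f \<Longrightarrow> square_integrable (\<lambda>x. c * f x)"
  unfolding square_integrable_iff_energy by (auto simp: energy_scale ennreal_mult_less_top)

lemma square_integrable_uminus: "square_integrable f \<Longrightarrow> square_integrable (\<lambda>x. - f x)"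
  using square_integrable_scale[of f "-1"] by simp

lemma square_integrable_diff:
  "square_integrable f \<Longrightarrow> square_integrable g \<Longrightarrow> square_integrable (\<lambda>x. f x - g x)"
  using square_integrable_add[of f "\<lambda>x. - g x"] square_integrable_uminus by simp

lemma square_integrable_reflect: "square_integrable f \<Longrightarrow> square_integrable (\<lambda>x. f (- x))"
  unfolding square_integrable_iff_energy by (auto simp: energy_reflect)

lemma square_integrable_bound:
  assumes "square_integrable g" "f \<in> borel_measurable borel" "\<And>x. cmod (f x) \<le> cmod (g x)"
  shows "square_integrable f"
  using assms energy_mono[of f g] unfolding square_integrable_iff_energy
  by (auto intro: order.strict_trans1)

lemma square_integrable_bound_scaled:
  assumes "square_integrable g" "f \<in> borel_measurable borel" "\<And>x. cmod (f x) \<le> C * cmod (g x)"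
  shows "square_integrable f"
proof (rule square_integrable_bound[OF square_integrable_scale[OF assms(1), of "of_real C"] assms(2)])
  fix x
  have "cmod (f x) \<le> C * cmod (g x)" by fact
  also have "\<dots> \<le> \<bar>C\<bar> * cmod (g x)" by (intro mult_right_mono) auto
  finally show "cmod (f x) \<le> cmod (of_real C * g x)" by (simp add: norm_mult)
qed

lemma square_integrable_mult_integrable:
  assumes "square_integrable f" "square_integrable g"
  shows "integrable lborel (\<lambda>x. f x * g x)"
proof (rule Bochner_Integration.integrable_bound)
  note [measurable] = assms[THEN square_integrableD]
  show "integrable lborel (\<lambda>x. (cmod (f x))\<^sup>2 + (cmod (g x))\<^sup>2)"
    using assms unfolding square_integrable_def by auto
  show "AE x in lborel. norm (f x * g x) \<le> norm ((cmod (f x))\<^sup>2 + (cmod (g x))\<^sup>2)"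
  proof (rule AE_I2)
    fix x
    have "2 * (cmod (f x) * cmod (g x)) \<le> (cmod (f x))\<^sup>2 + (cmod (g x))\<^sup>2"
      using zero_le_power2[of "cmod (f x) - cmod (g x)"] by (simp add: power2_eq_square algebra_simps)
    moreover have "0 \<le> cmod (f x) * cmod (g x)" by simp
    ultimately have "cmod (f x) * cmod (g x) \<le> (cmod (f x))\<^sup>2 + (cmod (g x))\<^sup>2" by linarith
    then show "norm (f x * g x) \<le> norm ((cmod (f x))\<^sup>2 + (cmod (g x))\<^sup>2)"
      by (simp add: norm_mult)
  qed
  show "(\<lambda>x. f x * g x) \<in> borel_measurable lborel" by measurable
qed

lemma Cauchy_Schwarz_energy:
  assumes "square_integrable f" "square_integrable g"
  shows "ennreal ((cmod (LINT x|lborel. f x * g x))\<^sup>2) \<le> energy f * energy g"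
proof -
  note [measurable] = assms[THEN square_integrableD]
  have "ennreal ((cmod (LINT x|lborel. f x * g x))\<^sup>2) = (ennreal (cmod (LINT x|lborel. f x * g x)))\<^sup>2"
    by (simp add: ennreal_power)
  also have "\<dots> \<le> (\<integral>\<^sup>+x. ennreal (cmod (f x * g x)) \<partial>lborel)\<^sup>2"
    by (intro power_mono integral_norm_bound_ennreal square_integrable_mult_integrable assms) auto
  also have "\<dots> = (\<integral>\<^sup>+x. ennreal (cmod (f x)) * ennreal (cmod (g x)) \<partial>lborel)\<^sup>2"
    by (simp add: norm_mult ennreal_mult)
  also have "\<dots> \<le> (\<integral>\<^sup>+x. ennreal (cmod (f x)) ^ 2 \<partial>lborel) * (\<integral>\<^sup>+x. ennreal (cmod (g x)) ^ 2 \<partial>lborel)"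
    by (rule Cauchy_Schwarz_nn_integral) auto
  also have "\<dots> = energy f * energy g"
    by (simp add: energy_def ennreal_power)
  finally show ?thesis .
qed

lemma energy_Fatou:
  fixes u :: "nat \<Rightarrow> real \<Rightarrow> complex"
  assumes [measurable]: "\<And>n. u n \<in> borel_measurable borel"
    and lim: "AE x in lborel. (\<lambda>n. u n x) \<longlonglongrightarrow> v x"
    and bound: "\<forall>\<^sub>F n in sequentially. energy (u n) \<le> B"
  shows "energy v \<le> B"
proof -
  have "energy v = (\<integral>\<^sup>+x. liminf (\<lambda>n. ennreal ((cmod (u n x))\<^sup>2)) \<partial>lborel)"
    unfolding energy_def
  proof (rule nn_integral_cong_AE)
    show "AE x in lborel. ennreal ((cmod (v x))\<^sup>2) = liminf (\<lambda>n. ennreal ((cmod (u n x))\<^sup>2))"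
      using lim
    proof eventually_elim
      case (elim x)
      then have "(\<lambda>n. ennreal ((cmod (u n x))\<^sup>2)) \<longlonglongrightarrow> ennreal ((cmod (v x))\<^sup>2)"
        by (intro tendsto_intros) auto
      then show ?case by (rule lim_imp_Liminf[OF sequentially_bot, symmetric])
    qed
  qed
  also have "\<dots> \<le> liminf (\<lambda>n. energy (u n))"
    unfolding energy_def by (rule nn_integral_liminf) auto
  also have "\<dots> \<le> B"
  proof -
    have "liminf (\<lambda>n. energy (u n)) \<le> liminf (\<lambda>n. B)"
      by (rule Liminf_mono) (use bound in auto)
    then show ?thesis by (simp add: Liminf_const)
  qed
  finally show ?thesis .
qed

lemma tendsto_0_if_le_ennreal:
  fixes u :: "'a \<Rightarrow> ennreal"
  assumes "\<And>e::real. e > 0 \<Longrightarrow> \<forall>\<^sub>F x in F. u x \<le> ennreal e"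
  shows "(u \<longlongrightarrow> 0) F"
proof (rule order_tendstoI)
  fix a :: ennreal assume "0 < a"
  obtain b where b: "0 < b" "b < a" using dense[OF \<open>0 < a\<close>] by blast
  then have "b \<noteq> \<infinity>" by auto
  with b(1) obtain e where e: "0 < e" "ennreal e < a"
    using b(2) by (cases b) (auto simp: ennreal_less_iff)
  show "\<forall>\<^sub>F x in F. u x < a"
    using assms[OF e(1)] by eventually_elim (use e in auto)
qed auto

text \<open>The Riesz--Fischer argument: a rapidly converging subsequence converges almost everywhere, and
  Fatou's lemma shows that the pointwise limit is the limit in the mean.\<close>

lemma energy_complete:
  fixes g :: "real \<Rightarrow> real \<Rightarrow> complex"
  assumes sq: "\<And>R. square_integrable (g R)"
    and cauchy: "\<And>e::real. e > 0 \<Longrightarrow> \<exists>R0. \<forall>R\<ge>R0. \<forall>S\<ge>R. energy (\<lambda>x. g S x - g R x) \<le> ennreal e"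
  shows "\<exists>f. square_integrable f \<and> ((\<lambda>R. energy (\<lambda>x. f x - g R x)) \<longlongrightarrow> 0) at_top"
proof -
  have [measurable]: "g R \<in> borel_measurable borel" for R using sq square_integrableD by blast
  \<comment> \<open>Steps of energy at most \<open>4\<^sup>-\<^sup>n\<close> leave room for the weights \<open>2\<^sup>n\<close> below, which make the
    increments decay geometrically at almost every point.\<close>
  have "\<forall>n::nat. \<exists>R0. \<forall>R\<ge>R0. \<forall>S\<ge>R. energy (\<lambda>x. g S x - g R x) \<le> ennreal ((1/4)^n)"
    by (intro allI cauchy) auto
  then obtain r0 where r0: "\<And>n R S. R \<ge> r0 n \<Longrightarrow> S \<ge> R \<Longrightarrow> energy (\<lambda>x. g S x - g R x) \<le> ennreal ((1/4)^n)"
    by metis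
  \<comment> \<open>a monotone sequence above \<open>r0\<close> that tends to infinity\<close>
  define r where "r n = (\<Sum>i\<le>n. \<bar>r0 i\<bar>) + real n" for n
  have r_ge: "r n \<ge> r0 n" for n
  proof -
    have "\<bar>r0 n\<bar> \<le> (\<Sum>i\<le>n. \<bar>r0 i\<bar>)" by (rule member_le_sum) auto
    then show ?thesis unfolding r_def by linarith
  qed
  have r_suc: "r n \<le> r (Suc n)" for n unfolding r_def by simp
  have r_n: "r n \<ge> real n" for n unfolding r_def by (simp add: sum_nonneg)
  define d where "d n x = g (r (Suc n)) x - g (r n) x" for n x
  have [measurable]: "d n \<in> borel_measurable borel" for n unfolding d_def by simp
  have d_en: "energy (d n) \<le> ennreal ((1/4)^n)" for n
    unfolding d_def using r0[OF r_ge r_suc] by simp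
  have "(\<integral>\<^sup>+x. (\<Sum>n. ennreal (2^n * (cmod (d n x))\<^sup>2)) \<partial>lborel) = (\<Sum>n. ennreal (2^n) * energy (d n))"
    unfolding energy_def
    by (subst nn_integral_suminf) (auto simp: ennreal_mult nn_integral_cmult)
  also have "\<dots> \<le> (\<Sum>n. ennreal ((1/2)^n))"
  proof (rule suminf_le)
    fix n
    have "ennreal (2^n) * energy (d n) \<le> ennreal (2^n) * ennreal ((1/4)^n)"
      by (intro mult_left_mono d_en) auto
    also have "\<dots> = ennreal ((1/2)^n)"
      by (simp add: ennreal_mult[symmetric] power_mult_distrib[symmetric])
    finally show "ennreal (2^n) * energy (d n) \<le> ennreal ((1/2)^n)" .
  qed auto
  also have "\<dots> = ennreal (\<Sum>n. (1/2)^n)"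
    by (rule suminf_ennreal2) (auto simp: summable_geometric)
  also have "\<dots> < \<infinity>" by simp
  finally have "(\<integral>\<^sup>+x. (\<Sum>n. ennreal (2^n * (cmod (d n x))\<^sup>2)) \<partial>lborel) < \<infinity>" .
  then have fin: "AE x in lborel. (\<Sum>n. ennreal (2^n * (cmod (d n x))\<^sup>2)) \<noteq> \<infinity>"
    by (intro nn_integral_PInf_AE) auto
  define f where "f x = lim (\<lambda>n. g (r n) x)" for x
  have [measurable]: "f \<in> borel_measurable borel"
    unfolding f_def by (rule borel_measurable_lim_metric) simp
  have conv: "AE x in lborel. (\<lambda>n. g (r n) x) \<longlonglongrightarrow> f x"
    using fin
  proof eventually_elim
    case (elim x)
    have "summable (\<lambda>n. 2^n * (cmod (d n x))\<^sup>2)"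
      by (rule summable_suminf_not_top) (use elim in auto)
    then have "Bseq (\<lambda>n. 2^n * (cmod (d n x))\<^sup>2)"
      using summable_LIMSEQ_zero convergent_imp_Bseq convergentI by blast
    then obtain B where B: "B > 0" "\<And>n. norm (2^n * (cmod (d n x))\<^sup>2) \<le> B"
      unfolding Bseq_def by blast
    have d_le: "cmod (d n x) \<le> sqrt B * (sqrt (1/2))^n" for n
    proof (rule power2_le_imp_le)
      have "2^n * (cmod (d n x))\<^sup>2 \<le> B" using B(2)[of n] by simp
      then have "(cmod (d n x))\<^sup>2 \<le> B * (1/2)^n"
        by (simp add: field_simps power_one_over)
      also have "\<dots> = (sqrt B * (sqrt (1/2))^n)\<^sup>2"
        using B(1) by (simp add: power_mult_distrib power_mult[symmetric] mult.commute[of n 2])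
          (simp add: power_mult)
      finally show "(cmod (d n x))\<^sup>2 \<le> (sqrt B * (sqrt (1/2))^n)\<^sup>2" .
      show "0 \<le> sqrt B * sqrt (1/2)^n" using B(1) by simp
    qed
    have "summable (\<lambda>n. d n x)"
    proof (rule summable_comparison_test)
      show "summable (\<lambda>n. sqrt B * (sqrt (1/2))^n)"
        by (intro summable_mult summable_geometric) (auto simp: real_sqrt_lt_1_iff)
      show "\<exists>N. \<forall>n\<ge>N. norm (d n x) \<le> sqrt B * (sqrt (1/2))^n" using d_le by auto
    qed
    then have "convergent (\<lambda>n. \<Sum>k<n. d k x)" by (simp add: summable_iff_convergent)
    moreover have "(\<Sum>k<n. d k x) = g (r n) x - g (r 0) x" for n
      unfolding d_def by (rule sum_lessThan_telescope)
    ultimately have "convergent (\<lambda>n. g (r n) x - g (r 0) x)" by simp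
    then have "convergent (\<lambda>n. g (r n) x)" by (simp add: convergent_diff_const_right_iff)
    then show ?case unfolding f_def by (simp add: convergent_LIMSEQ_iff)
  qed
  have close: "\<exists>R0. \<forall>R\<ge>R0. energy (\<lambda>x. f x - g R x) \<le> ennreal e" if e: "e > 0" for e
  proof -
    obtain R0 where R0: "\<And>R S. R \<ge> R0 \<Longrightarrow> S \<ge> R \<Longrightarrow> energy (\<lambda>x. g S x - g R x) \<le> ennreal e"
      using cauchy[OF e] by blast
    have "energy (\<lambda>x. f x - g R x) \<le> ennreal e" if R: "R \<ge> R0" for R
    proof (rule energy_Fatou[where u = "\<lambda>n x. g (r n) x - g R x"])
      show "AE x in lborel. (\<lambda>n. g (r n) x - g R x) \<longlonglongrightarrow> f x - g R x"
        using conv by eventually_elim (intro tendsto_intros)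
      show "\<forall>\<^sub>F n in sequentially. energy (\<lambda>x. g (r n) x - g R x) \<le> ennreal e"
        using eventually_ge_at_top[of "nat \<lceil>R\<rceil>"]
      proof eventually_elim
        case (elim n)
        then have "r n \<ge> R" using r_n[of n] by linarith
        then show ?case using R0[OF R] by auto
      qed
    qed auto
    then show ?thesis by blast
  qed
  have lim: "((\<lambda>R. energy (\<lambda>x. f x - g R x)) \<longlongrightarrow> 0) at_top"
  proof (rule tendsto_0_if_le_ennreal)
    fix e :: real assume "e > 0"
    from close[OF this] show "\<forall>\<^sub>F R in at_top. energy (\<lambda>x. f x - g R x) \<le> ennreal e"
      unfolding eventually_at_top_linorder .
  qed
  obtain R where "energy (\<lambda>x. f x - g R x) \<le> ennreal 1" using close[of 1] by auto
  also have "ennreal 1 < \<infinity>" by simp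
  finally have "square_integrable (\<lambda>x. f x - g R x)"
    unfolding square_integrable_iff_energy by simp
  from square_integrable_add[OF this sq[of R]] have "square_integrable f" by simp
  with lim show ?thesis by blast
qed

section \<open>The Fourier integral of an integrable function\<close>

definition fourier :: "(real \<Rightarrow> complex) \<Rightarrow> real \<Rightarrow> complex" where
  "fourier f x =
     (1 / complex_of_real (sqrt (2 * pi))) * (LINT t|lborel. f t * exp (\<i> * of_real x * of_real t))"

lemma borel_measurable_cnj [measurable]: "cnj \<in> borel_measurable borel"
  by (intro borel_measurable_continuous_onI continuous_intros)

lemma norm_exp_i_mult [simp]: "cmod (exp (\<i> * of_real x * of_real t)) = 1"
  by (simp add: norm_exp_eq_Re)

lemma norm_fourier_const: "cmod (1 / complex_of_real (sqrt (2 * pi))) = 1 / sqrt (2 * pi)"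
  by (simp add: norm_divide)

lemma integrable_mult_bounded:
  fixes f m :: "real \<Rightarrow> complex"
  assumes f: "integrable lborel f" and [measurable]: "m \<in> borel_measurable borel"
    and bound: "\<And>x. cmod (m x) \<le> B"
  shows "integrable lborel (\<lambda>x. f x * m x)"
proof (rule Bochner_Integration.integrable_bound)
  note [measurable] = borel_measurable_integrable[OF f]
  show "integrable lborel (\<lambda>x. B * norm (f x))" using f by simp
  have "norm (f x * m x) \<le> norm (B * norm (f x))" for x
  proof -
    have "norm (f x * m x) \<le> norm (f x) * B"
      by (simp add: norm_mult bound mult_left_mono)
    also have "\<dots> \<le> norm (B * norm (f x))" by (simp add: abs_mult mult.commute mult_right_mono)
    finally show ?thesis .
  qed
  then show "AE x in lborel. norm (f x * m x) \<le> norm (B * norm (f x))" by simp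
  show "(\<lambda>x. f x * m x) \<in> borel_measurable lborel" by measurable
qed

lemma integrable_mult_exp:
  "integrable lborel f \<Longrightarrow> integrable lborel (\<lambda>t. f t * exp (\<i> * of_real x * of_real t))"
  by (rule integrable_mult_bounded[where B = 1]) auto

lemma fourier_measurable [measurable]:
  assumes [measurable]: "f \<in> borel_measurable borel"
  shows "fourier f \<in> borel_measurable borel"
  unfolding fourier_def by measurable

lemma norm_fourier_le:
  assumes "integrable lborel f"
  shows "cmod (fourier f x) \<le> (LINT t|lborel. cmod (f t)) / sqrt (2 * pi)"
proof -
  have "cmod (LINT t|lborel. f t * exp (\<i> * of_real x * of_real t)) \<le> (LINT t|lborel. cmod (f t * exp (\<i> * of_real x * of_real t)))"
    by (rule integral_norm_bound)
  also have "\<dots> = (LINT t|lborel. cmod (f t))" by (simp add: norm_mult)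
  finally have "cmod (LINT t|lborel. f t * exp (\<i> * of_real x * of_real t)) \<le> (LINT t|lborel. cmod (f t))" .
  then show ?thesis
    unfolding fourier_def norm_mult norm_fourier_const
    by (simp add: divide_right_mono)
qed

text \<open>Fubini's theorem: both sides are the double integral of \<open>f t * g x\<close> against the kernel, which is
  symmetric in \<open>x\<close> and \<open>t\<close>.\<close>

lemma fourier_mult_swap:
  assumes f: "integrable lborel f" and g: "integrable lborel g"
  shows "(LINT x|lborel. fourier f x * g x) = (LINT t|lborel. f t * fourier g t)"
proof -
  note [measurable] = borel_measurable_integrable[OF f] borel_measurable_integrable[OF g]
  define c where "c = 1 / complex_of_real (sqrt (2 * pi))"
  define k where "k x t = f t * g x * exp (\<i> * of_real x * of_real t)" for x t
  have [measurable]: "(\<lambda>(x, t). k x t) \<in> borel_measurable (lborel \<Otimes>\<^sub>M lborel)"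
    unfolding k_def by measurable
  have int: "integrable (lborel \<Otimes>\<^sub>M lborel) (\<lambda>(x, t). k x t)"
  proof (rule lborel_pair.Fubini_integrable)
    have "(LINT t|lborel. norm (k x t)) = norm (g x) * (LINT t|lborel. norm (f t))" for x
      by (simp add: k_def norm_mult)
    then show "integrable lborel (\<lambda>x. LINT t|lborel. norm (case (x, t) of (x, t) \<Rightarrow> k x t))"
      using g by simp
    have "integrable lborel (\<lambda>t. g x * (f t * exp (\<i> * of_real x * of_real t)))" for x
      by (intro integrable_mult_right integrable_mult_exp f)
    moreover have "k x = (\<lambda>t. g x * (f t * exp (\<i> * of_real x * of_real t)))" for x
      by (simp add: k_def fun_eq_iff)
    ultimately have "integrable lborel (\<lambda>t. k x t)" for x by simp
    then show "AE x in lborel. integrable lborel (\<lambda>t. case (x, t) of (x, t) \<Rightarrow> k x t)" by simp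
  qed measurable
  have "(LINT x|lborel. fourier f x * g x) = (LINT x|lborel. c * (LINT t|lborel. k x t))"
  proof (rule Bochner_Integration.integral_cong[OF refl])
    fix x
    have "(LINT t|lborel. k x t) = g x * (LINT t|lborel. f t * exp (\<i> * of_real x * of_real t))"
      unfolding k_def by (subst integral_mult_right_zero[symmetric]) (simp add: mult_ac)
    then show "fourier f x * g x = c * (LINT t|lborel. k x t)"
      by (simp add: fourier_def c_def)
  qed
  also have "\<dots> = c * (LINT x|lborel. LINT t|lborel. k x t)" by simp
  also have "\<dots> = c * (LINT t|lborel. LINT x|lborel. k x t)"
    using lborel_pair.Fubini_integral[OF int] by simp
  also have "\<dots> = (LINT t|lborel. c * (LINT x|lborel. k x t))" by simp
  also have "\<dots> = (LINT t|lborel. f t * fourier g t)"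
  proof (rule Bochner_Integration.integral_cong[OF refl])
    fix t
    have "(LINT x|lborel. k x t) = f t * (LINT x|lborel. g x * exp (\<i> * of_real t * of_real x))"
      unfolding k_def by (subst integral_mult_right_zero[symmetric]) (simp add: mult_ac)
    then show "c * (LINT x|lborel. k x t) = f t * fourier g t"
      by (simp add: fourier_def c_def)
  qed
  finally show ?thesis .
qed

subsection \<open>Exponentials on a half-line\<close>

lemma integrable_exp_halfline:
  assumes "c > 0"
  shows "integrable lborel (\<lambda>t. indicator {0<..} t * exp (- (c * t)) :: real)"
proof -
  have "set_integrable lborel (einterval 0 \<infinity>) (\<lambda>t. exp (- (c * t)))"
  proof (rule interval_integral_FTC_nonneg(1)[where F = "\<lambda>t. - exp (- (c * t)) / c" and A = "-1/c" and B = 0])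
    show "((\<lambda>t. - exp (- (c * t)) / c) has_real_derivative exp (- (c * t))) (at t)" for t
      using assms by (auto intro!: derivative_eq_intros)
    show "(((\<lambda>t. - exp (- (c * t)) / c) \<circ> real_of_ereal) \<longlongrightarrow> - 1 / c) (at_right 0)"
      unfolding zero_ereal_def ereal_tendsto_simps
      by (rule tendsto_eq_intros refl | simp)+ (use assms in auto)
    have "LIM t at_top. (- c) * t :> at_bot"
      by (rule filterlim_tendsto_neg_mult_at_bot[OF tendsto_const _ filterlim_ident]) (use assms in auto)
    from filterlim_compose[OF exp_at_bot this] have "((\<lambda>t. - exp ((- c) * t) / c) \<longlongrightarrow> - 0 / c) at_top"
      using assms by (intro tendsto_intros) auto
    then have "((\<lambda>t. - exp (- (c * t)) / c) \<longlongrightarrow> 0) at_top" by simp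
    then show "(((\<lambda>t. - exp (- (c * t)) / c) \<circ> real_of_ereal) \<longlongrightarrow> 0) (at_left \<infinity>)"
      unfolding ereal_tendsto_simps by simp
  qed (auto intro!: continuous_intros)
  then show ?thesis
    by (simp add: set_integrable_def zero_ereal_def einterval_eq_Ici)
qed

lemma
  assumes w: "Re w < 0"
  shows integrable_cexp_halfline: "integrable lborel (\<lambda>t. indicator {0<..} t *\<^sub>R exp (w * of_real t))"
    and integral_cexp_halfline: "(LINT t|lborel. indicator {0<..} t *\<^sub>R exp (w * of_real t)) = - 1 / w"
proof -
  show int: "integrable lborel (\<lambda>t. indicator {0<..} t *\<^sub>R exp (w * of_real t))"
    by (rule Bochner_Integration.integrable_bound[OF integrable_exp_halfline[of "- Re w"]])
       (use w in \<open>auto simp: norm_exp_eq_Re split: split_indicator\<close>)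
  have w0: "w \<noteq> 0" using w by auto
  have "(LBINT t=0..\<infinity>. exp (w * of_real t)) = 0 - 1 / w"
  proof (rule interval_integral_FTC_integrable[where F = "\<lambda>t. exp (w * of_real t) / w"])
    show "((\<lambda>t. exp (w * of_real t) / w) has_vector_derivative exp (w * of_real t)) (at t)" for t
      using w0 by (auto intro!: derivative_eq_intros has_vector_derivative_real_field)
    show "set_integrable lborel (einterval 0 \<infinity>) (\<lambda>t. exp (w * of_real t))"
      using int by (simp add: set_integrable_def zero_ereal_def einterval_eq_Ici)
    show "(((\<lambda>t. exp (w * of_real t) / w) \<circ> real_of_ereal) \<longlongrightarrow> 1 / w) (at_right 0)"
      unfolding zero_ereal_def ereal_tendsto_simps
      by (rule tendsto_eq_intros refl | simp add: w0)+
    have "((\<lambda>t. exp (Re w * t)) \<longlongrightarrow> 0) at_top"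
      using w by (auto intro!: tendsto_eq_intros filterlim_compose[OF exp_at_bot]
          filterlim_tendsto_neg_mult_at_bot[OF tendsto_const _ filterlim_ident])
    then have "((\<lambda>t. exp (w * of_real t)) \<longlongrightarrow> 0) at_top"
      by (subst tendsto_norm_zero_iff[symmetric]) (simp add: norm_exp_eq_Re)
    then have "((\<lambda>t. exp (w * of_real t) / w) \<longlongrightarrow> 0 / w) at_top"
      by (intro tendsto_intros w0)
    then show "(((\<lambda>t. exp (w * of_real t) / w) \<circ> real_of_ereal) \<longlongrightarrow> 0) (at_left \<infinity>)"
      unfolding ereal_tendsto_simps by simp
  qed (auto intro!: continuous_intros)
  then show "(LINT t|lborel. indicator {0<..} t *\<^sub>R exp (w * of_real t)) = - 1 / w"
    by (simp add: interval_lebesgue_integral_def set_lebesgue_integral_def zero_ereal_def einterval_eq_Ici)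
qed

lemma AE_nonzero: "AE x in lborel. x \<noteq> (0::real)"
  by (rule AE_lborel_singleton)

lemma
  assumes e: "e > 0"
  shows integrable_exp_abs: "integrable lborel (\<lambda>x. complex_of_real (exp (- (e * \<bar>x\<bar>))))"
    and fourier_exp_abs:
      "fourier (\<lambda>x. of_real (exp (- (e * \<bar>x\<bar>)))) u
        = (1 / complex_of_real (sqrt (2 * pi))) * of_real (2 * e / (e\<^sup>2 + u\<^sup>2))"
proof -
  define h where "h u t = indicator {0<..} t *\<^sub>R exp ((- of_real e + \<i> * of_real u) * of_real t)" for u t :: real
  have hi: "integrable lborel (h u)" and hv: "(LINT t|lborel. h u t) = - 1 / (- of_real e + \<i> * of_real u)" for u
    unfolding h_def using e by (intro integrable_cexp_halfline integral_cexp_halfline; simp)+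
  have hi': "integrable lborel (\<lambda>t. h (- u) (- t))"
    using lborel_integrable_real_affine[OF hi[of "-u"], of "-1" 0] by simp
  have hv': "(LINT t|lborel. h (- u) (- t)) = - 1 / (- of_real e - \<i> * of_real u)"
    using lborel_integral_real_affine[of "-1" "h (-u)" 0] hv[of "-u"] by simp
  have ae: "AE t in lborel. of_real (exp (- (e * \<bar>t\<bar>))) * exp (\<i> * of_real u * of_real t) = h u t + h (- u) (- t)" for u
    using AE_nonzero
  proof eventually_elim
    case (elim t)
    show ?case
    proof (cases "t > 0")
      case True then show ?thesis by (simp add: h_def exp_of_real[symmetric] mult_exp_exp algebra_simps)
    next
      case False
      with elim have "t < 0" by simp
      then show ?thesis by (simp add: h_def exp_of_real[symmetric] mult_exp_exp algebra_simps)
    qed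
  qed
  show "integrable lborel (\<lambda>x. complex_of_real (exp (- (e * \<bar>x\<bar>))))"
  proof (rule iffD2[OF integrable_cong_AE Bochner_Integration.integrable_add])
    show "AE x in lborel. complex_of_real (exp (- (e * \<bar>x\<bar>))) = h 0 x + h (-0) (- x)"
      using ae[of 0] by simp
    show "integrable lborel (h 0)" by (rule hi)
    show "integrable lborel (\<lambda>x. h (-0) (- x))" using lborel_integrable_real_affine[OF hi[of "0"], of "-1" 0] by simp
  qed (auto simp: h_def)
  have "(LINT t|lborel. of_real (exp (- (e * \<bar>t\<bar>))) * exp (\<i> * of_real u * of_real t))
      = (LINT t|lborel. h u t + h (- u) (- t))"
    by (rule integral_cong_AE) (use ae in \<open>auto simp: h_def\<close>)
  also have "\<dots> = - 1 / (- of_real e + \<i> * of_real u) + - 1 / (- of_real e - \<i> * of_real u)"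
    by (subst Bochner_Integration.integral_add[OF hi hi']) (simp only: hv hv')
  also have "\<dots> = of_real (2 * e / (e\<^sup>2 + u\<^sup>2))"
  proof -
    have nz: "- complex_of_real e + \<i> * of_real u \<noteq> 0" "- complex_of_real e - \<i> * of_real u \<noteq> 0"
      using e by (auto simp: complex_eq_iff)
    have "complex_of_real (e\<^sup>2 + u\<^sup>2) = (- of_real e + \<i> * of_real u) * (- of_real e - \<i> * of_real u)"
      by (simp add: algebra_simps power2_eq_square)
    then show ?thesis using nz by (simp add: divide_simps)
  qed
  finally show "fourier (\<lambda>x. of_real (exp (- (e * \<bar>x\<bar>)))) u
        = (1 / complex_of_real (sqrt (2 * pi))) * of_real (2 * e / (e\<^sup>2 + u\<^sup>2))"
    by (simp only: fourier_def)
qed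

subsection \<open>The Poisson kernel\<close>

text \<open>The Poisson kernel of the upper half-plane at height \<open>e\<close>, an approximate identity as \<open>e\<close> tends to 0.\<close>

definition poisson :: "real \<Rightarrow> real \<Rightarrow> real" where
  "poisson e u = e / (pi * (e\<^sup>2 + u\<^sup>2))"

lemma poisson_measurable [measurable]: "poisson e \<in> borel_measurable borel"
  unfolding poisson_def by measurable

lemma poisson_nonneg: "e > 0 \<Longrightarrow> poisson e u \<ge> 0"
  by (simp add: poisson_def)

lemma nn_integral_poisson:
  assumes e: "e > 0"
  shows "(\<integral>\<^sup>+u. ennreal (poisson e (s + u)) \<partial>lborel) = 1"
proof -
  have "(\<integral>\<^sup>+u. ennreal (poisson 1 u) * indicator {0..} u \<partial>lborel) = ennreal (1/2 - arctan 0 / pi)"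
  proof (rule nn_integral_FTC_atLeast[where F = "\<lambda>u. arctan u / pi"])
    show "((\<lambda>u. arctan u / pi) \<longlongrightarrow> 1/2) at_top"
      by (rule tendsto_eq_intros tendsto_arctan_at_top refl | simp)+
    show "((\<lambda>u. arctan u / pi) has_real_derivative poisson 1 u) (at u)" for u
      by (auto intro!: derivative_eq_intros simp: poisson_def field_simps add_nonneg_eq_0_iff)
  qed (auto simp: poisson_nonneg)
  then have base: "(\<integral>\<^sup>+u. ennreal (poisson 1 u) * indicator {0..} u \<partial>lborel) = ennreal (1/2)"
    by simp
  have "(\<integral>\<^sup>+u. ennreal (poisson 1 u) \<partial>lborel) =
      (\<integral>\<^sup>+u. ennreal (poisson 1 u) * indicator {0..} u + ennreal (poisson 1 u) * indicator {..0} u \<partial>lborel)"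
    by (rule nn_integral_cong_AE) (use AE_nonzero in eventually_elim, auto split: split_indicator)
  also have "\<dots> = (\<integral>\<^sup>+u. ennreal (poisson 1 u) * indicator {0..} u \<partial>lborel) + (\<integral>\<^sup>+u. ennreal (poisson 1 u) * indicator {..0} u \<partial>lborel)"
    by (rule nn_integral_add) auto
  also have "(\<integral>\<^sup>+u. ennreal (poisson 1 u) * indicator {..0} u \<partial>lborel) = (\<integral>\<^sup>+u. ennreal (poisson 1 u) * indicator {0..} u \<partial>lborel)"
    by (subst nn_integral_real_affine[of _ "-1" 0]) (auto simp: poisson_def indicator_def)
  also have "(\<integral>\<^sup>+u. ennreal (poisson 1 u) * indicator {0..} u \<partial>lborel)
      + (\<integral>\<^sup>+u. ennreal (poisson 1 u) * indicator {0..} u \<partial>lborel) = ennreal (1/2 + 1/2)"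
    unfolding base by (rule ennreal_plus[symmetric]) auto
  finally have one: "(\<integral>\<^sup>+u. ennreal (poisson 1 u) \<partial>lborel) = 1" by simp
  have "(\<integral>\<^sup>+u. ennreal (poisson 1 u) \<partial>lborel) = ennreal \<bar>1 / e\<bar> * (\<integral>\<^sup>+u. ennreal (poisson 1 (s / e + 1 / e * u)) \<partial>lborel)"
    by (rule nn_integral_real_affine) (use e in auto)
  also have "\<dots> = (\<integral>\<^sup>+u. ennreal (\<bar>1 / e\<bar> * poisson 1 (s / e + 1 / e * u)) \<partial>lborel)"
    by (subst nn_integral_cmult[symmetric]) (auto simp: ennreal_mult[symmetric] poisson_nonneg)
  also have "(\<lambda>u. \<bar>1 / e\<bar> * poisson 1 (s / e + 1 / e * u)) = (\<lambda>u. poisson e (s + u))"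
  proof
    fix u
    have "s / e + 1 / e * u = (s + u) / e" by (simp add: add_divide_distrib)
    then show "\<bar>1 / e\<bar> * poisson 1 (s / e + 1 / e * u) = poisson e (s + u)"
      using e by (simp add: poisson_def power_divide field_simps power2_eq_square)
  qed
  finally show ?thesis using one by simp
qed

text \<open>The Poisson kernel enters as the transform of \<open>exp (- e \<bar>x\<bar>)\<close>: damping on one side of the transform
  is averaging on the other.\<close>

lemma fourier_exp_abs_poisson:
  assumes "e > 0"
  shows "fourier (\<lambda>x. of_real (exp (- (e * \<bar>x\<bar>)))) u
    = of_real (sqrt (2 * pi) * poisson e u)"
proof -
  have "2 * e / (e\<^sup>2 + u\<^sup>2) / sqrt (2 * pi) = sqrt (2 * pi) * poisson e u"
    using assms by (simp add: poisson_def divide_simps real_sqrt_mult[symmetric])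
  then show ?thesis
    unfolding fourier_exp_abs[OF assms] of_real_divide[symmetric] of_real_mult[symmetric] 
    by (simp flip: of_real_divide of_real_mult)
qed

subsection \<open>Bessel's inequality\<close>

lemma cnj_fourier:
  assumes "integrable lborel f"
  shows "cnj (fourier f x) = fourier (\<lambda>s. cnj (f (- s))) x"
proof -
  have "cnj (LINT t|lborel. f t * exp (\<i> * of_real x * of_real t)) = (LINT t|lborel. cnj (f t * exp (\<i> * of_real x * of_real t)))"
    by (rule Bochner_Integration.integral_cnj[symmetric])
  also have "\<dots> = (LINT t|lborel. cnj (f (-t)) * exp (\<i> * of_real x * of_real t))"
    by (subst lborel_integral_real_affine[of "-1" _ 0]) (auto simp: exp_cnj)
  finally show ?thesis by (simp add: fourier_def)
qed

lemma fourier_modulate: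
  "fourier (\<lambda>x. f x * exp (\<i> * of_real t * of_real x)) s = fourier f (s + t)"
  unfolding fourier_def by (simp add: mult.assoc mult_exp_exp algebra_simps)

text \<open>Schur's test: \<open>\<bar>f t\<bar> \<bar>k s\<bar>\<close> is at most the mean of the squares, and in each of the two resulting
  integrals the Poisson kernel integrates to 1 in the other variable.\<close>

lemma poisson_schur:
  assumes e: "e > 0" and [measurable]: "f \<in> borel_measurable borel" "k \<in> borel_measurable borel"
  shows "(\<integral>\<^sup>+t. (\<integral>\<^sup>+s. ennreal (cmod (f t)) * ennreal (cmod (k s) * poisson e (s + t)) \<partial>lborel) \<partial>lborel)
    \<le> ennreal (1/2) * energy f + ennreal (1/2) * energy k"
proof -
  let ?A = "\<lambda>t s. ennreal (1/2) * (ennreal ((cmod (f t))\<^sup>2) * ennreal (poisson e (t + s)))"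
  let ?B = "\<lambda>t s. ennreal (1/2) * (ennreal ((cmod (k s))\<^sup>2) * ennreal (poisson e (s + t)))"
  have "ennreal (cmod (f t)) * ennreal (cmod (k s) * poisson e (s + t)) \<le> ?A t s + ?B t s" for t s
  proof -
    have "cmod (f t) * cmod (k s) \<le> 1/2 * ((cmod (f t))\<^sup>2 + (cmod (k s))\<^sup>2)"
      using zero_le_power2[of "cmod (f t) - cmod (k s)"] by (simp add: power2_eq_square algebra_simps)
    then have "cmod (f t) * cmod (k s) * poisson e (s + t) \<le> 1/2 * ((cmod (f t))\<^sup>2 + (cmod (k s))\<^sup>2) * poisson e (s + t)"
      by (rule mult_right_mono) (rule poisson_nonneg[OF e])
    then have "cmod (f t) * (cmod (k s) * poisson e (s + t))
       \<le> 1/2 * ((cmod (f t))\<^sup>2 * poisson e (t + s)) + 1/2 * ((cmod (k s))\<^sup>2 * poisson e (s + t))"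
      by (simp add: algebra_simps)
    note le = ennreal_leI[OF this]
    have half: "ennreal (1/2) * (ennreal A * ennreal B) = ennreal (1/2 * (A * B))" if "A \<ge> 0" "B \<ge> 0" for A B
      using that by (subst ennreal_mult[symmetric], simp, simp, subst ennreal_mult[symmetric]) auto
    show ?thesis
      unfolding half[OF zero_le_power2 poisson_nonneg[OF e]]
      by (subst ennreal_plus[symmetric], simp add: poisson_nonneg[OF e], simp add: poisson_nonneg[OF e],
          subst ennreal_mult[symmetric]) (use le in \<open>auto simp: poisson_nonneg[OF e]\<close>)
  qed
  then have "(\<integral>\<^sup>+t. (\<integral>\<^sup>+s. ennreal (cmod (f t)) * ennreal (cmod (k s) * poisson e (s + t)) \<partial>lborel) \<partial>lborel)
      \<le> (\<integral>\<^sup>+t. \<integral>\<^sup>+s. ?A t s + ?B t s \<partial>lborel \<partial>lborel)"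
    by (intro nn_integral_mono)
  also have "\<dots> = (\<integral>\<^sup>+t. \<integral>\<^sup>+s. ?A t s \<partial>lborel \<partial>lborel) + (\<integral>\<^sup>+t. \<integral>\<^sup>+s. ?B t s \<partial>lborel \<partial>lborel)"
    by (subst nn_integral_add[symmetric]) (auto intro!: nn_integral_cong nn_integral_add)
  also have "(\<integral>\<^sup>+t. \<integral>\<^sup>+s. ?B t s \<partial>lborel \<partial>lborel) = (\<integral>\<^sup>+s. \<integral>\<^sup>+t. ?B t s \<partial>lborel \<partial>lborel)"
    by (rule lborel_pair.Fubini') measurable
  also have "\<dots> = ennreal (1/2) * energy k"
    by (simp add: nn_integral_cmult nn_integral_poisson[OF e] energy_def)
  also have "(\<integral>\<^sup>+t. \<integral>\<^sup>+s. ?A t s \<partial>lborel \<partial>lborel) = ennreal (1/2) * energy f"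
    by (simp add: nn_integral_cmult nn_integral_poisson[OF e] energy_def)
  finally show ?thesis .
qed

text \<open>With the weight \<open>exp (- e \<bar>x\<bar>)\<close> the energy of the transform \<open>F\<close> is \<open>\<integral> F h\<close>, where \<open>h\<close> is the
  weighted conjugate of \<open>F\<close>. Moving the transform from \<open>f\<close> to \<open>h\<close>, and then inside \<open>h\<close> to the weight,
  leaves a double integral of \<open>f\<close> against its conjugate with the Poisson kernel, to which Schur's test
  applies.\<close>

lemma energy_fourier_damped:
  assumes f: "integrable lborel f" "square_integrable f" and e: "e > 0"
  shows "energy (\<lambda>x. fourier f x * of_real (exp (- (e * \<bar>x\<bar>) / 2))) \<le> energy f"
proof -
  note [measurable] = square_integrableD[OF f(2)]
  define F where "F = fourier f"
  define w where "w x = complex_of_real (exp (- (e * \<bar>x\<bar>)))" for x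
  define k where "k s = cnj (f (- s))" for s
  have [measurable]: "k \<in> borel_measurable borel" unfolding k_def by measurable
  have wi: "integrable lborel w" unfolding w_def by (rule integrable_exp_abs[OF e])
  have ki: "integrable lborel k"
    using lborel_integrable_real_affine[OF f(1), of "-1" 0] unfolding k_def by simp
  have Fb: "cmod (F x) \<le> (LINT t|lborel. cmod (f t)) / sqrt (2 * pi)" for x
    unfolding F_def by (rule norm_fourier_le[OF f(1)])
  have [measurable]: "F \<in> borel_measurable borel" unfolding F_def by measurable
  define h where "h x = w x * cnj (F x)" for x
  have hi: "integrable lborel h"
    unfolding h_def by (rule integrable_mult_bounded[OF wi _ ]) (use Fb in auto)
  have h_int: "F x * h x = of_real ((cmod (F x))\<^sup>2 * exp (- (e * \<bar>x\<bar>)))" for x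
    unfolding h_def w_def by (simp only: of_real_mult complex_norm_square mult_ac)
  have Fhi: "integrable lborel (\<lambda>x. F x * h x)"
    using integrable_mult_bounded[OF hi _ Fb, of "\<lambda>x. x"] by (simp add: mult.commute)
  from integrable_norm[OF this] have ri: "integrable lborel (\<lambda>x. (cmod (F x))\<^sup>2 * exp (- (e * \<bar>x\<bar>)))"
    unfolding h_int norm_of_real by (simp add: abs_mult)
  have fh: "fourier h t = (LINT s|lborel. k s * of_real (poisson e (s + t)))" for t
  proof -
    have "fourier h t = (1 / complex_of_real (sqrt (2 * pi))) *
        (LINT x|lborel. fourier k x * (w x * exp (\<i> * of_real t * of_real x)))"
      unfolding fourier_def[of h] h_def F_def cnj_fourier[OF f(1)] k_def
      by (simp add: mult_ac)
    also have "(LINT x|lborel. fourier k x * (w x * exp (\<i> * of_real t * of_real x)))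
        = (LINT s|lborel. k s * fourier (\<lambda>x. w x * exp (\<i> * of_real t * of_real x)) s)"
      by (rule fourier_mult_swap[OF ki integrable_mult_exp[OF wi]])
    also have "\<dots> = (LINT s|lborel. of_real (sqrt (2 * pi)) * (k s * of_real (poisson e (s + t))))"
      unfolding fourier_modulate unfolding w_def fourier_exp_abs_poisson[OF e]
      by (simp add: mult_ac)
    also have "\<dots> = of_real (sqrt (2 * pi)) * (LINT s|lborel. k s * of_real (poisson e (s + t)))"
      by (rule integral_mult_right_zero)
    finally show ?thesis by simp
  qed
  have fh_le: "ennreal (cmod (fourier h t)) \<le> (\<integral>\<^sup>+s. ennreal (cmod (k s) * poisson e (s + t)) \<partial>lborel)" for t
  proof -
    have b: "cmod (complex_of_real (poisson e (s + t))) \<le> 1 / (pi * e)" for s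
    proof -
      have "pi * e\<^sup>2 \<le> pi * (e\<^sup>2 + (s + t)\<^sup>2)"
        by (intro mult_left_mono) auto
      moreover have "e * (pi * e) = pi * e\<^sup>2" by (simp add: power2_eq_square)
      ultimately have "e * (pi * e) \<le> pi * (e\<^sup>2 + (s + t)\<^sup>2)" by simp
      then have "e / (pi * (e\<^sup>2 + (s + t)\<^sup>2)) \<le> e / (e * (pi * e))"
        by (rule divide_left_mono) (use e in \<open>auto intro!: mult_pos_pos add_pos_nonneg\<close>)
      also have "\<dots> = 1 / (pi * e)" using e by simp
      finally show ?thesis
        unfolding norm_of_real poisson_def[symmetric] using poisson_nonneg[OF e, of "s + t"] by simp
    qed
    have "integrable lborel (\<lambda>s. k s * of_real (poisson e (s + t)))"
      by (rule integrable_mult_bounded[OF ki _ b]) measurable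
    from integral_norm_bound_ennreal[OF this] show ?thesis
      unfolding fh by (simp add: norm_mult poisson_nonneg[OF e])
  qed
  have "energy (\<lambda>x. F x * of_real (exp (- (e * \<bar>x\<bar>) / 2))) = (\<integral>\<^sup>+x. ennreal ((cmod (F x))\<^sup>2 * exp (- (e * \<bar>x\<bar>))) \<partial>lborel)"
    unfolding energy_def
    by (rule nn_integral_cong) (simp add: norm_mult power_mult_distrib exp_double[symmetric])
  also have "\<dots> = ennreal (LINT x|lborel. (cmod (F x))\<^sup>2 * exp (- (e * \<bar>x\<bar>)))"
    by (rule nn_integral_eq_integral[OF ri]) auto
  also have "(LINT x|lborel. (cmod (F x))\<^sup>2 * exp (- (e * \<bar>x\<bar>))) = cmod (LINT x|lborel. F x * h x)"
    unfolding h_int by (simp only: integral_complex_of_real norm_of_real) (simp add: Bochner_Integration.integral_nonneg)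
  also have "(LINT x|lborel. F x * h x) = (LINT t|lborel. f t * fourier h t)"
    unfolding F_def by (rule fourier_mult_swap[OF f(1) hi])
  also have "ennreal (cmod (LINT t|lborel. f t * fourier h t)) \<le> (\<integral>\<^sup>+t. ennreal (cmod (f t * fourier h t)) \<partial>lborel)"
    using borel_measurable_integrable[OF hi]
    by (intro integral_norm_bound_ennreal integrable_mult_bounded[OF f(1) _ norm_fourier_le[OF hi]]) auto
  also have "\<dots> \<le> (\<integral>\<^sup>+t. (\<integral>\<^sup>+s. ennreal (cmod (f t)) * ennreal (cmod (k s) * poisson e (s + t)) \<partial>lborel) \<partial>lborel)"
  proof (rule nn_integral_mono)
    fix t
    have "ennreal (cmod (f t * fourier h t)) = ennreal (cmod (f t)) * ennreal (cmod (fourier h t))"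
      by (simp add: norm_mult ennreal_mult)
    also have "\<dots> \<le> ennreal (cmod (f t)) * (\<integral>\<^sup>+s. ennreal (cmod (k s) * poisson e (s + t)) \<partial>lborel)"
      by (intro mult_left_mono fh_le) auto
    also have "\<dots> = (\<integral>\<^sup>+s. ennreal (cmod (f t)) * ennreal (cmod (k s) * poisson e (s + t)) \<partial>lborel)"
      by (rule nn_integral_cmult[symmetric]) measurable
    finally show "ennreal (cmod (f t * fourier h t)) \<le> \<dots>" .
  qed
  also have "\<dots> \<le> ennreal (1/2) * energy f + ennreal (1/2) * energy k"
    by (rule poisson_schur[OF e]) measurable
  also have "\<dots> = energy f"
  proof -
    have "energy k = energy f" using energy_reflect[of f] by (simp add: energy_def k_def)
    moreover have "ennreal (1/2) + ennreal (1/2) = ennreal (1/2 + 1/2)" by (rule ennreal_plus[symmetric]) auto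
    ultimately show ?thesis by (simp only: distrib_right[symmetric]) simp
  qed
  finally show ?thesis unfolding F_def .
qed

subsection \<open>Abel damping\<close>

text \<open>The weights of Abel summation. They decrease the modulus, tend to 1 pointwise, and turn a square integrable
  function into an integrable one.\<close>

definition abel :: "nat \<Rightarrow> real \<Rightarrow> complex" where
  "abel n t = of_real (exp (- (1 / real (Suc n) * \<bar>t\<bar>)))"

lemma abel_measurable [measurable]: "abel n \<in> borel_measurable borel"
  unfolding abel_def by measurable

lemma integrable_abel: "integrable lborel (abel n)"
  unfolding abel_def[abs_def] by (rule integrable_exp_abs) simp

lemma norm_abel_le: "cmod (abel n t) \<le> 1"
  by (simp add: abel_def)

lemma norm_1_minus_abel_le: "cmod (1 - abel n t) \<le> 1"
proof -
  have "1 - abel n t = of_real (1 - exp (- (1 / real (Suc n) * \<bar>t\<bar>)))" by (simp add: abel_def)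
  then show ?thesis by (simp del: of_real_diff)
qed

lemma square_integrable_abel: "square_integrable (abel n)"
  unfolding square_integrable_def
proof (intro conjI Bochner_Integration.integrable_bound[OF integrable_norm[OF integrable_abel[of n]]])
  show "AE t in lborel. norm ((cmod (abel n t))\<^sup>2) \<le> norm (norm (abel n t))"
    by (simp add: power2_eq_square mult_left_le norm_abel_le)
qed simp_all

lemma abel_tendsto: "(\<lambda>n. abel n t) \<longlonglongrightarrow> 1"
proof -
  have "(\<lambda>n. 1 / real (Suc n)) \<longlonglongrightarrow> 0" using LIMSEQ_inverse_real_of_nat by (simp add: inverse_eq_divide)
  then have "(\<lambda>n. abel n t) \<longlonglongrightarrow> of_real (exp (- (0 * \<bar>t\<bar>)))"
    unfolding abel_def by (intro tendsto_intros)
  then show ?thesis by simp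
qed

lemma fourier_abel: "fourier (abel n) u = of_real (sqrt (2 * pi) * poisson (1 / real (Suc n)) u)"
  unfolding abel_def[abs_def] by (rule fourier_exp_abs_poisson) simp

text \<open>Bessel's inequality: by Fatou's lemma the bound survives the removal of the damping.\<close>

lemma energy_fourier_le:
  assumes f: "integrable lborel f" "square_integrable f"
  shows "energy (fourier f) \<le> energy f"
proof (rule energy_Fatou[where u = "\<lambda>n x. fourier f x * abel n x"])
  note [measurable] = square_integrableD[OF f(2)]
  show "(\<lambda>x. fourier f x * abel n x) \<in> borel_measurable borel" for n by measurable
  show "AE x in lborel. (\<lambda>n. fourier f x * abel n x) \<longlonglongrightarrow> fourier f x"
    using tendsto_mult[OF tendsto_const abel_tendsto] by (intro AE_I2) simp
  have half: "- (2 / r * y) / 2 = - (1 / r * y)" for r y :: real by simp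
  have "energy (\<lambda>x. fourier f x * abel n x) \<le> energy f" for n
    using energy_fourier_damped[OF f, of "2 / real (Suc n)"] unfolding half abel_def by simp
  then show "\<forall>\<^sub>F n in sequentially. energy (\<lambda>x. fourier f x * abel n x) \<le> energy f"
    by (intro always_eventually allI)
qed

section \<open>The Fourier transform in the mean\<close>

text \<open>The truncation in the definition of the transform; a truncated square integrable function is integrable, so
  that its transform is an honest integral.\<close>

definition cut :: "real \<Rightarrow> (real \<Rightarrow> complex) \<Rightarrow> real \<Rightarrow> complex" where
  "cut R f t = indicator {-R..R} t *\<^sub>R f t"

lemma cut_measurable [measurable]: "f \<in> borel_measurable borel \<Longrightarrow> cut R f \<in> borel_measurable borel"
  unfolding cut_def by measurable

lemma cut_reflect: "cut R (\<lambda>t. f (- t)) t = cut R f (- t)"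
  by (auto simp: cut_def indicator_def)

lemma square_integrable_cut:
  assumes f: "square_integrable f" shows "square_integrable (cut R f)"
  by (rule square_integrable_bound[OF f])
     (use square_integrableD[OF f] in \<open>auto simp: cut_def indicator_def\<close>)

lemma square_integrable_indicator: "square_integrable (indicator {-R..R})"
proof -
  have "(\<lambda>t. (cmod (indicator {-R..R} t))\<^sup>2) = (indicator {-R..R} :: real \<Rightarrow> real)"
    by (auto simp: indicator_def)
  moreover have "integrable lborel (indicator {-R..R} :: real \<Rightarrow> real)"
    by (auto intro!: integrable_real_indicator simp: emeasure_lborel_Icc_eq)
  ultimately show ?thesis unfolding square_integrable_def by simp
qed

lemma integrable_cut:
  assumes f: "square_integrable f" shows "integrable lborel (cut R f)"
proof -
  from square_integrable_mult_integrable[OF square_integrable_indicator f] show ?thesis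
    by (simp add: cut_def[abs_def] indicator_scaleR_eq_if indicator_times_eq_if)
qed

lemma fourier_diff:
  assumes "integrable lborel f" "integrable lborel g"
  shows "fourier (\<lambda>t. f t - g t) x = fourier f x - fourier g x"
  unfolding fourier_def using assms[THEN integrable_mult_exp, of x]
  by (simp add: left_diff_distrib Bochner_Integration.integral_diff right_diff_distrib)

lemma fourier_reflect: "fourier (\<lambda>t. f (- t)) x = fourier f (- x)"
  unfolding fourier_def by (subst lborel_integral_real_affine[of "-1" _ 0]) auto

lemma square_integrable_fourier:
  assumes "integrable lborel f" "square_integrable f"
  shows "square_integrable (fourier f)"
  using energy_fourier_le[OF assms] assms square_integrableD[OF assms(2)]
  unfolding square_integrable_iff_energy by (auto intro: order.strict_trans1)

lemma energy_fourier_diff_le: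
  assumes "integrable lborel f" "square_integrable f" "integrable lborel g" "square_integrable g"
  shows "energy (\<lambda>x. fourier f x - fourier g x) \<le> energy (\<lambda>x. f x - g x)"
proof -
  have "fourier (\<lambda>x. f x - g x) = (\<lambda>x. fourier f x - fourier g x)"
    using assms by (intro ext fourier_diff) auto
  then show ?thesis
    using energy_fourier_le[of "\<lambda>x. f x - g x"] assms by (simp add: square_integrable_diff)
qed

lemma has_fourier_iff:
  "has_fourier f F \<longleftrightarrow> square_integrable f \<and> square_integrable F \<and>
     ((\<lambda>R. energy (\<lambda>x. F x - fourier (cut R f) x)) \<longlongrightarrow> 0) at_top"
  unfolding has_fourier_def energy_def fourier_def cut_def set_lebesgue_integral_def
  by simp

lemma energy_tail_tendsto_0:
  assumes f: "square_integrable f"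
  shows "((\<lambda>R. energy (\<lambda>x. f x - cut R f x)) \<longlongrightarrow> 0) at_top"
proof (rule tendsto_0_if_le_ennreal)
  fix e :: real assume e: "e > 0"
  note [measurable] = square_integrableD[OF f]
  have "(\<lambda>n. \<integral>\<^sup>+x. ennreal ((cmod (f x - cut (real n) f x))\<^sup>2) \<partial>lborel) \<longlonglongrightarrow> (\<integral>\<^sup>+x. 0 \<partial>(lborel::real measure))"
  proof (rule nn_integral_dominated_convergence[where w = "\<lambda>x. ennreal ((cmod (f x))\<^sup>2)"])
    show "(\<integral>\<^sup>+x. ennreal ((cmod (f x))\<^sup>2) \<partial>lborel) < \<infinity>"
      using energy_finite[OF f] unfolding energy_def .
    show "AE x in lborel. (\<lambda>n. ennreal ((cmod (f x - cut (real n) f x))\<^sup>2)) \<longlonglongrightarrow> 0"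
    proof (rule AE_I2)
      fix x
      show "(\<lambda>n. ennreal ((cmod (f x - cut (real n) f x))\<^sup>2)) \<longlonglongrightarrow> 0"
      proof (rule tendsto_eventually)
        show "\<forall>\<^sub>F n in sequentially. ennreal ((cmod (f x - cut (real n) f x))\<^sup>2) = 0"
          using eventually_ge_at_top[of "nat \<lceil>\<bar>x\<bar>\<rceil>"]
        proof eventually_elim
          case (elim n)
          then have "\<bar>x\<bar> \<le> real n" by linarith
          then have "x \<in> {- real n..real n}" by auto
          then show ?case by (simp add: cut_def)
        qed
      qed
    qed
  qed (auto simp: cut_def indicator_def intro!: ennreal_leI)
  then have "(\<lambda>n. energy (\<lambda>x. f x - cut (real n) f x)) \<longlonglongrightarrow> 0" by (simp add: energy_def)
  from order_tendstoD(2)[OF this, of "ennreal e"] e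
  obtain n where n: "energy (\<lambda>x. f x - cut (real n) f x) < ennreal e"
    by (auto simp: eventually_sequentially)
  show "\<forall>\<^sub>F R in at_top. energy (\<lambda>x. f x - cut R f x) \<le> ennreal e"
    using eventually_ge_at_top[of "real n"]
  proof eventually_elim
    case (elim R)
    have "energy (\<lambda>x. f x - cut R f x) \<le> energy (\<lambda>x. f x - cut (real n) f x)"
      by (rule energy_mono) (use elim in \<open>auto simp: cut_def indicator_def\<close>)
    then show ?case using n by simp
  qed
qed

text \<open>By Bessel's inequality the transforms of the truncations form a Cauchy family.\<close>

theorem has_fourier_exists:
  assumes f: "square_integrable f"
  shows "\<exists>F. has_fourier f F"
proof -
  note fi = integrable_cut[OF f] square_integrable_cut[OF f]
  have "\<exists>F. square_integrable F \<and> ((\<lambda>R. energy (\<lambda>x. F x - fourier (cut R f) x)) \<longlongrightarrow> 0) at_top"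
  proof (rule energy_complete)
    show "square_integrable (fourier (cut R f))" for R
      by (rule square_integrable_fourier) (rule fi)+
    fix e :: real assume "e > 0"
    with energy_tail_tendsto_0[OF f] have "\<forall>\<^sub>F R in at_top. energy (\<lambda>x. f x - cut R f x) < ennreal e"
      by (intro order_tendstoD(2)) auto
    then obtain R0 where R0: "\<And>R. R \<ge> R0 \<Longrightarrow> energy (\<lambda>x. f x - cut R f x) < ennreal e"
      by (auto simp: eventually_at_top_linorder)
    have "energy (\<lambda>x. fourier (cut S f) x - fourier (cut R f) x) \<le> ennreal e"
      if "R \<ge> R0" "S \<ge> R" for R S
    proof -
      have "energy (\<lambda>x. fourier (cut S f) x - fourier (cut R f) x) \<le> energy (\<lambda>x. cut S f x - cut R f x)"
        by (intro energy_fourier_diff_le fi)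
      also have "\<dots> \<le> energy (\<lambda>x. f x - cut R f x)"
        by (rule energy_mono) (use that in \<open>auto simp: cut_def indicator_def\<close>)
      finally show ?thesis using R0[OF that(1)] by simp
    qed
    then show "\<exists>R0. \<forall>R\<ge>R0. \<forall>S\<ge>R. energy (\<lambda>x. fourier (cut S f) x - fourier (cut R f) x) \<le> ennreal e"
      by blast
  qed
  then show ?thesis using f by (auto simp: has_fourier_iff)
qed

lemma ennreal_tendsto_0_combine:
  fixes u v :: "'a \<Rightarrow> ennreal"
  assumes "(u \<longlongrightarrow> 0) F" "(v \<longlongrightarrow> 0) F"
  shows "((\<lambda>x. 2 * u x + 2 * v x) \<longlongrightarrow> 0) F"
proof -
  have "((\<lambda>x. 2 * u x + 2 * v x) \<longlongrightarrow> 2 * 0 + 2 * 0) F"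
    by (intro tendsto_add ennreal_tendsto_cmult assms) auto
  then show ?thesis by simp
qed

lemma has_fourier_unique:
  assumes F: "has_fourier f F" and G: "has_fourier f G"
  shows "AE x in lborel. F x = G x"
proof -
  note FD = F[unfolded has_fourier_iff] and GD = G[unfolded has_fourier_iff]
  have [measurable]: "F \<in> borel_measurable borel" "G \<in> borel_measurable borel" "f \<in> borel_measurable borel"
    using FD GD by (auto dest: square_integrableD)
  have "energy (\<lambda>x. F x - G x) \<le> 0"
  proof (rule tendsto_lowerbound)
    show "((\<lambda>R. 2 * energy (\<lambda>x. F x - fourier (cut R f) x) + 2 * energy (\<lambda>x. G x - fourier (cut R f) x)) \<longlongrightarrow> 0) at_top"
      using FD GD by (intro ennreal_tendsto_0_combine) auto
    show "\<forall>\<^sub>F R in at_top. energy (\<lambda>x. F x - G x) \<le> 2 * energy (\<lambda>x. F x - fourier (cut R f) x) + 2 * energy (\<lambda>x. G x - fourier (cut R f) x)"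
      using energy_triangle[of F "fourier (cut R f)" G for R]
      by (intro always_eventually allI) (simp add: energy_diff_commute[of G])
  qed simp
  then have "AE x in lborel. F x - G x = 0" by (intro energy_eq_0D) auto
  then show ?thesis by simp
qed

lemma has_fourier_cong_AE:
  assumes F: "has_fourier f F" and ae: "AE x in lborel. F x = G x" and [measurable]: "G \<in> borel_measurable borel"
  shows "has_fourier f G"
proof -
  have "energy (\<lambda>x. F x - h x) = energy (\<lambda>x. G x - h x)" for h
    by (rule energy_cong_AE) (use ae in auto)
  moreover have "energy F = energy G" by (rule energy_cong_AE[OF ae])
  ultimately show ?thesis using F by (auto simp: has_fourier_iff square_integrable_iff_energy)
qed

lemma has_fourier_cong_AE_left:
  assumes F: "has_fourier f F" and ae: "AE x in lborel. f x = g x" and [measurable]: "g \<in> borel_measurable borel"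
  shows "has_fourier g F"
proof -
  have [measurable]: "f \<in> borel_measurable borel" using F by (auto simp: has_fourier_iff square_integrable_iff_energy)
  have "fourier (cut R f) x = fourier (cut R g) x" for R x
    unfolding fourier_def
    by (intro arg_cong2[of _ _ _ _ "(*)"] refl integral_cong_AE) (use ae in \<open>auto simp: cut_def\<close>)
  moreover have "energy f = energy g" by (rule energy_cong_AE[OF ae])
  ultimately show ?thesis using F by (auto simp: has_fourier_iff square_integrable_iff_energy)
qed

lemma has_fourier_add:
  assumes F: "has_fourier f F" and G: "has_fourier g G"
  shows "has_fourier (\<lambda>t. f t + g t) (\<lambda>x. F x + G x)"
proof -
  note FD = F[unfolded has_fourier_iff] and GD = G[unfolded has_fourier_iff]
  have [measurable]: "F \<in> borel_measurable borel" "G \<in> borel_measurable borel" "f \<in> borel_measurable borel" "g \<in> borel_measurable borel"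
    using FD GD by (auto dest: square_integrableD)
  have eq: "fourier (cut R (\<lambda>t. f t + g t)) x = fourier (cut R f) x + fourier (cut R g) x" for R x
  proof -
    have i: "integrable lborel (\<lambda>t. cut R f t * exp (\<i> * of_real x * of_real t))"
       "integrable lborel (\<lambda>t. cut R g t * exp (\<i> * of_real x * of_real t))"
      using FD GD by (auto intro!: integrable_mult_exp integrable_cut)
    have "cut R (\<lambda>t. f t + g t) t * exp (\<i> * of_real x * of_real t)
        = cut R f t * exp (\<i> * of_real x * of_real t) + cut R g t * exp (\<i> * of_real x * of_real t)" for t
      by (simp add: cut_def scaleR_add_right distrib_right)
    then show ?thesis
      unfolding fourier_def by (simp only: Bochner_Integration.integral_add[OF i] distrib_left)
  qed
  have "((\<lambda>R. energy (\<lambda>x. (F x + G x) - fourier (cut R (\<lambda>t. f t + g t)) x)) \<longlongrightarrow> 0) at_top"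
  proof (rule tendsto_sandwich[OF _ _ tendsto_const])
    show "((\<lambda>R. 2 * energy (\<lambda>x. F x - fourier (cut R f) x) + 2 * energy (\<lambda>x. G x - fourier (cut R g) x)) \<longlongrightarrow> 0) at_top"
      using FD GD by (intro ennreal_tendsto_0_combine) auto
    show "\<forall>\<^sub>F R in at_top. energy (\<lambda>x. (F x + G x) - fourier (cut R (\<lambda>t. f t + g t)) x) \<le> 2 * energy (\<lambda>x. F x - fourier (cut R f) x) + 2 * energy (\<lambda>x. G x - fourier (cut R g) x)"
    proof (intro always_eventually allI)
      fix R
      show "energy (\<lambda>x. (F x + G x) - fourier (cut R (\<lambda>t. f t + g t)) x) \<le> 2 * energy (\<lambda>x. F x - fourier (cut R f) x) + 2 * energy (\<lambda>x. G x - fourier (cut R g) x)"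
        using energy_add[of "\<lambda>x. F x - fourier (cut R f) x" "\<lambda>x. G x - fourier (cut R g) x"]
        by (simp add: eq algebra_simps)
    qed
  qed simp
  then show ?thesis using FD GD by (auto simp: has_fourier_iff intro: square_integrable_add)
qed

lemma has_fourier_uminus: "has_fourier f F \<Longrightarrow> has_fourier (\<lambda>t. - f t) (\<lambda>x. - F x)"
proof -
  assume F: "has_fourier f F"
  have "fourier (cut R (\<lambda>t. - f t)) x = - fourier (cut R f) x" for R x
    by (simp add: fourier_def cut_def)
  then have "energy (\<lambda>x. - F x - fourier (cut R (\<lambda>t. - f t)) x) = energy (\<lambda>x. F x - fourier (cut R f) x)" for R
    by (simp add: energy_def norm_minus_commute)
  then show ?thesis using F by (auto simp: has_fourier_iff intro: square_integrable_uminus)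
qed

lemma has_fourier_reflect:
  assumes F: "has_fourier f F"
  shows "has_fourier (\<lambda>t. f (- t)) (\<lambda>x. F (- x))"
proof -
  note FD = F[unfolded has_fourier_iff]
  have [measurable]: "F \<in> borel_measurable borel" "f \<in> borel_measurable borel"
    using FD by (auto dest: square_integrableD)
  have "fourier (cut R (\<lambda>t. f (- t))) x = fourier (cut R f) (- x)" for R x
    using fourier_reflect[of "cut R f" x] by (simp add: cut_reflect[abs_def])
  then have "energy (\<lambda>x. F (- x) - fourier (cut R (\<lambda>t. f (- t))) x) = energy (\<lambda>x. F x - fourier (cut R f) x)" for R
    using energy_reflect[of "\<lambda>x. F x - fourier (cut R f) x"] by simp
  then show ?thesis using FD by (auto simp: has_fourier_iff intro: square_integrable_reflect)
qed

text \<open>The inverse transform is the transform followed by a reflection, so that only one of the two needs a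
  theory.\<close>

lemma has_inverse_fourier_iff: "has_inverse_fourier F f \<longleftrightarrow> has_fourier F (\<lambda>x. f (- x))"
proof -
  have eq: "(1 / complex_of_real (sqrt (2 * pi))) * (LINT x:{-R..R}|lborel. F x * exp (- (\<i> * of_real x * of_real t)))
      = fourier (cut R F) (- t)" for R t
    unfolding fourier_def cut_def set_lebesgue_integral_def by (simp add: mult_ac)
  have sq: "square_integrable (\<lambda>x. f (- x)) \<longleftrightarrow> square_integrable f"
    using square_integrable_reflect[of f] square_integrable_reflect[of "\<lambda>x. f (- x)"] by auto
  have "energy (\<lambda>t. f t - fourier (cut R F) (- t)) = energy (\<lambda>x. f (- x) - fourier (cut R F) x)"
    if "square_integrable f" "square_integrable F" for R
    using energy_reflect[of "\<lambda>t. f t - fourier (cut R F) (- t)"] that[THEN square_integrableD] by simp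
  then show ?thesis
    unfolding has_inverse_fourier_def has_fourier_iff eq sq energy_def[symmetric] by auto
qed

lemma has_fourier_energy_diff_le:
  assumes F: "has_fourier f F" and g: "integrable lborel g" "square_integrable g"
  shows "energy (\<lambda>x. F x - fourier g x) \<le> 4 * energy (\<lambda>t. f t - g t)"
proof -
  note FD = F[unfolded has_fourier_iff]
  have f: "square_integrable f" using FD by simp
  have [measurable]: "F \<in> borel_measurable borel" "f \<in> borel_measurable borel" "g \<in> borel_measurable borel"
    using FD g by (auto dest: square_integrableD)
  let ?u = "\<lambda>R. energy (\<lambda>x. F x - fourier (cut R f) x)"
  let ?v = "\<lambda>R. energy (\<lambda>x. f x - cut R f x)"
  have le: "energy (\<lambda>x. F x - fourier g x) \<le> 2 * ?u R + 2 * (2 * ?v R + 2 * energy (\<lambda>t. f t - g t))" for R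
  proof -
    have "energy (\<lambda>x. F x - fourier g x)
       \<le> 2 * ?u R + 2 * energy (\<lambda>x. fourier (cut R f) x - fourier g x)"
      by (rule energy_triangle) auto
    also have "energy (\<lambda>x. fourier (cut R f) x - fourier g x) \<le> energy (\<lambda>x. cut R f x - g x)"
      by (intro energy_fourier_diff_le integrable_cut square_integrable_cut f g)
    also have "\<dots> \<le> 2 * energy (\<lambda>x. cut R f x - f x) + 2 * energy (\<lambda>x. f x - g x)"
      by (rule energy_triangle) auto
    also have "energy (\<lambda>x. cut R f x - f x) = ?v R" by (rule energy_diff_commute)
    finally show ?thesis by (simp add: mult_left_mono add_left_mono)
  qed
  have "energy (\<lambda>x. F x - fourier g x) \<le> 2 * 0 + 2 * (2 * 0 + 2 * energy (\<lambda>t. f t - g t))"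
  proof (rule tendsto_lowerbound)
    show "((\<lambda>R. 2 * ?u R + 2 * (2 * ?v R + 2 * energy (\<lambda>t. f t - g t))) \<longlongrightarrow> 2 * 0 + 2 * (2 * 0 + 2 * energy (\<lambda>t. f t - g t))) at_top"
      using FD energy_tail_tendsto_0[OF f] by (intro tendsto_add ennreal_tendsto_cmult tendsto_const) auto
    show "\<forall>\<^sub>F R in at_top. energy (\<lambda>x. F x - fourier g x) \<le> 2 * ?u R + 2 * (2 * ?v R + 2 * energy (\<lambda>t. f t - g t))"
      using le by (intro always_eventually) auto
  qed simp
  then show ?thesis by (simp add: mult.assoc[symmetric])
qed

text \<open>The transform may be computed with Abel's weights in place of truncations. The damped
  functions converge to \<open>f\<close> in the mean, hence so do their transforms, and a limit in the mean agrees almost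
  everywhere with a pointwise limit.\<close>

lemma has_fourier_abel_limit:
  assumes f: "square_integrable f"
    and lim: "\<And>x. (\<lambda>n. fourier (\<lambda>t. abel n t * f t) x) \<longlonglongrightarrow> e x"
  shows "has_fourier f e"
proof -
  note [measurable] = square_integrableD[OF f]
  obtain F where F: "has_fourier f F" using has_fourier_exists[OF f] by blast
  then have [measurable]: "F \<in> borel_measurable borel" by (auto simp: has_fourier_iff dest: square_integrableD)
  have [measurable]: "e \<in> borel_measurable borel"
    by (rule borel_measurable_LIMSEQ_metric[OF _ lim]) measurable
  have int: "integrable lborel (\<lambda>t. abel n t * f t)" for n
    by (rule square_integrable_mult_integrable[OF square_integrable_abel f])
  have sq: "square_integrable (\<lambda>t. abel n t * f t)" for n
    by (rule square_integrable_bound[OF f]) (auto simp: norm_mult norm_abel_le mult_left_le_one_le)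
  have "(\<lambda>n. \<integral>\<^sup>+x. ennreal ((cmod (f x - abel n x * f x))\<^sup>2) \<partial>lborel) \<longlonglongrightarrow> (\<integral>\<^sup>+x. 0 \<partial>(lborel::real measure))"
  proof (rule nn_integral_dominated_convergence[where w = "\<lambda>x. ennreal ((cmod (f x))\<^sup>2)"])
    show "(\<integral>\<^sup>+x. ennreal ((cmod (f x))\<^sup>2) \<partial>lborel) < \<infinity>"
      using energy_finite[OF f] unfolding energy_def .
    show "AE x in lborel. (\<lambda>n. ennreal ((cmod (f x - abel n x * f x))\<^sup>2)) \<longlonglongrightarrow> 0"
    proof (rule AE_I2)
      fix x
      have "(\<lambda>n. ennreal ((cmod (f x - abel n x * f x))\<^sup>2)) \<longlonglongrightarrow> ennreal ((cmod (f x - 1 * f x))\<^sup>2)"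
        by (intro tendsto_intros abel_tendsto)
      then show "(\<lambda>n. ennreal ((cmod (f x - abel n x * f x))\<^sup>2)) \<longlonglongrightarrow> 0" by simp
    qed
    have "cmod (f x - abel n x * f x) \<le> cmod (f x)" for n x
    proof -
      have "f x - abel n x * f x = (1 - abel n x) * f x" by (simp add: algebra_simps)
      then show ?thesis by (simp add: norm_mult mult_left_le_one_le norm_1_minus_abel_le)
    qed
    then show "AE x in lborel. ennreal ((cmod (f x - abel n x * f x))\<^sup>2) \<le> ennreal ((cmod (f x))\<^sup>2)" for n
      by (intro AE_I2 ennreal_leI power_mono) auto
  qed auto
  then have "(\<lambda>n. energy (\<lambda>t. f t - abel n t * f t)) \<longlonglongrightarrow> 0" by (simp add: energy_def)
  from ennreal_tendsto_cmult[OF _ this, of 4]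
  have z: "(\<lambda>n. 4 * energy (\<lambda>t. f t - abel n t * f t)) \<longlonglongrightarrow> 0" by simp
  have small: "energy (\<lambda>x. F x - e x) \<le> ennreal d" if "d > 0" for d
  proof (rule energy_Fatou[where u = "\<lambda>n x. F x - fourier (\<lambda>t. abel n t * f t) x"])
    show "AE x in lborel. (\<lambda>n. F x - fourier (\<lambda>t. abel n t * f t) x) \<longlonglongrightarrow> F x - e x"
      by (intro AE_I2 tendsto_intros lim)
    have "\<forall>\<^sub>F n in sequentially. 4 * energy (\<lambda>t. f t - abel n t * f t) < ennreal d"
      using order_tendstoD(2)[OF z] that by simp
    then show "\<forall>\<^sub>F n in sequentially. energy (\<lambda>x. F x - fourier (\<lambda>t. abel n t * f t) x) \<le> ennreal d"
      by eventually_elim (use has_fourier_energy_diff_le[OF F int sq] in \<open>auto intro: order_trans less_imp_le\<close>)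
  qed measurable
  have "energy (\<lambda>x. F x - e x) \<le> 0"
    by (rule ennreal_le_epsilon) (use small in auto)
  then have "AE x in lborel. F x - e x = 0" by (intro energy_eq_0D) auto
  then have "AE x in lborel. F x = e x" by simp
  then show ?thesis by (rule has_fourier_cong_AE[OF F]) simp
qed

lemma integral_mult_tendsto_energy:
  assumes "square_integrable F" "\<And>R. square_integrable (G R)" "square_integrable h"
    and lim: "((\<lambda>R. energy (\<lambda>x. F x - G R x)) \<longlongrightarrow> 0) at_top"
  shows "((\<lambda>R::real. LINT x|lborel. G R x * h x) \<longlongrightarrow> (LINT x|lborel. F x * h x)) at_top"
proof -
  let ?I = "LINT x|lborel. F x * h x" and ?J = "\<lambda>R. LINT x|lborel. G R x * h x"
  have le: "ennreal ((cmod (?I - ?J R))\<^sup>2) \<le> energy (\<lambda>x. F x - G R x) * energy h" for R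
  proof -
    have "?I - ?J R = (LINT x|lborel. (F x - G R x) * h x)"
      using assms square_integrable_mult_integrable
      by (subst Bochner_Integration.integral_diff[symmetric]) (auto simp: left_diff_distrib)
    then show ?thesis
      using Cauchy_Schwarz_energy[OF square_integrable_diff[OF assms(1,2)] assms(3)] by simp
  qed
  have "((\<lambda>R. energy (\<lambda>x. F x - G R x) * energy h) \<longlongrightarrow> 0 * energy h) at_top"
    using energy_finite[OF assms(3)] lim by (intro tendsto_mult_ennreal) auto
  then have lim0: "((\<lambda>R. energy (\<lambda>x. F x - G R x) * energy h) \<longlongrightarrow> 0) at_top"
    by (simp only: mult_zero_left)
  have "((\<lambda>R. ennreal ((cmod (?I - ?J R))\<^sup>2)) \<longlongrightarrow> ennreal 0) at_top"
    unfolding ennreal_0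
  proof (rule tendsto_sandwich[OF _ _ tendsto_const lim0])
    show "\<forall>\<^sub>F R in at_top. ennreal ((cmod (?I - ?J R))\<^sup>2) \<le> energy (\<lambda>x. F x - G R x) * energy h"
      by (intro always_eventually allI le)
  qed simp
  then have "((\<lambda>R. (cmod (?I - ?J R))\<^sup>2) \<longlongrightarrow> 0) at_top"
    by (subst (asm) tendsto_ennreal_iff) auto
  then have "((\<lambda>R. sqrt ((cmod (?I - ?J R))\<^sup>2)) \<longlongrightarrow> sqrt 0) at_top"
    by (rule tendsto_real_sqrt)
  then have "((\<lambda>R. ?I - ?J R) \<longlongrightarrow> 0) at_top"
    by (simp add: tendsto_norm_zero_iff)
  from tendsto_diff[OF tendsto_const[of "LINT x|lborel. F x * h x"] this] show ?thesis by simp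
qed

text \<open>The Fubini identity survives the limit in the mean on both sides, since integration against a square
  integrable function is continuous by the Cauchy--Schwarz inequality.\<close>

lemma has_fourier_mult_swap:
  assumes F: "has_fourier f F" and h: "integrable lborel h" "square_integrable h"
  shows "(LINT x|lborel. F x * h x) = (LINT t|lborel. f t * fourier h t)"
proof -
  note FD = F[unfolded has_fourier_iff]
  have f: "square_integrable f" using FD by simp
  note sqh = square_integrable_fourier[OF h]
  have 1: "((\<lambda>R. LINT x|lborel. fourier (cut R f) x * h x) \<longlongrightarrow> (LINT x|lborel. F x * h x)) at_top"
    using FD h by (intro integral_mult_tendsto_energy square_integrable_fourier integrable_cut square_integrable_cut) auto
  have 2: "(LINT x|lborel. fourier (cut R f) x * h x) = (LINT t|lborel. cut R f t * fourier h t)" for R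
    by (intro fourier_mult_swap integrable_cut f h)
  have 3: "((\<lambda>R. LINT t|lborel. cut R f t * fourier h t) \<longlongrightarrow> (LINT t|lborel. f t * fourier h t)) at_top"
    by (intro integral_mult_tendsto_energy f square_integrable_cut sqh energy_tail_tendsto_0)
  show ?thesis
    by (rule tendsto_unique[OF trivial_limit_at_top_linorder 1[unfolded 2] 3])
qed

section \<open>Square integrable Hoelder continuous functions\<close>

lemma uniformly_continuous_on_if_hoelder:
  fixes F :: "'a::metric_space \<Rightarrow> 'b::metric_space"
  assumes h: "\<And>x y. x \<in> S \<Longrightarrow> y \<in> S \<Longrightarrow> dist (F x) (F y) \<le> C * dist x y powr a" and a: "0 < a"
  shows "uniformly_continuous_on S F"
  unfolding uniformly_continuous_on_def
proof (intro allI impI)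
  fix e :: real assume e: "e > 0"
  let ?d = "(e / (\<bar>C\<bar> + 1)) powr (1 / a)"
  have "dist (F y) (F x) < e" if "x \<in> S" "y \<in> S" "dist y x < ?d" for x y
  proof -
    have "dist (F y) (F x) \<le> C * dist y x powr a" by (rule h) fact+
    also have "\<dots> \<le> \<bar>C\<bar> * dist y x powr a" by (intro mult_right_mono) auto
    also have "\<dots> \<le> \<bar>C\<bar> * ?d powr a" using that a by (intro mult_left_mono powr_mono2) auto
    also have "?d powr a = e / (\<bar>C\<bar> + 1)" using a e by (simp add: powr_powr)
    also have "\<bar>C\<bar> * (e / (\<bar>C\<bar> + 1)) < e" using e by (simp add: pos_divide_less_eq algebra_simps)
    finally show ?thesis .
  qed
  moreover have "?d > 0" using e by simp
  ultimately show "\<exists>d>0. \<forall>x\<in>S. \<forall>y\<in>S. dist y x < d \<longrightarrow> dist (F y) (F x) < e" by blast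
qed

lemma hoelder_continuousD:
  assumes "hoelder_continuous F"
  shows "\<exists>C a. C \<ge> 0 \<and> 0 < a \<and> a \<le> 1 \<and> (\<forall>x y. cmod (F x - F y) \<le> C * \<bar>x - y\<bar> powr a)"
proof -
  obtain C a where C: "0 < a" "a \<le> 1" "\<And>x y. cmod (F x - F y) \<le> C * \<bar>x - y\<bar> powr a"
    using assms unfolding hoelder_continuous_def by blast
  have "cmod (F 0 - F 1) \<le> C" using C(3)[of 0 1] by simp
  then have "C \<ge> 0" using norm_ge_zero[of "F 0 - F 1"] by linarith
  with C show ?thesis by blast
qed

lemma hoelder_uniformly_continuous:
  assumes "hoelder_continuous F" shows "uniformly_continuous_on UNIV F"
proof -
  obtain C a where C: "0 < a" "\<forall>x y. cmod (F x - F y) \<le> C * \<bar>x - y\<bar> powr a"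
    using assms unfolding hoelder_continuous_def by blast
  show ?thesis
    by (rule uniformly_continuous_on_if_hoelder[of UNIV F C a]) (use C in \<open>auto simp: dist_norm\<close>)
qed

lemma hoelder_continuous_on: "hoelder_continuous F \<Longrightarrow> continuous_on S F"
  using uniformly_continuous_imp_continuous[OF hoelder_uniformly_continuous]
  by (rule continuous_on_subset) auto

text \<open>If \<open>\<bar>F\<bar> \<ge> e\<close> at a point then \<open>\<bar>F\<bar> \<ge> e/2\<close> on an interval of fixed length around it, which is too much
  energy for the tail of a square integrable function.\<close>

lemma hat_class0_vanishes:
  assumes F: "F \<in> hat_class0" and e: "e > 0"
  shows "\<exists>X. \<forall>x. \<bar>x\<bar> \<ge> X \<longrightarrow> cmod (F x) < e"
proof -
  have h: "hoelder_continuous F" and sq: "square_integrable F" using F by (auto simp: hat_class0_def)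
  note [measurable] = square_integrableD[OF sq]
  obtain d' where d': "d' > 0" "\<And>x y. dist y x < d' \<Longrightarrow> dist (F y) (F x) < e / 2"
    using hoelder_uniformly_continuous[OF h, unfolded uniformly_continuous_on_def, rule_format, of "e/2"] e by auto
  define d where "d = d' / 2"
  have d: "d > 0" "\<And>x y. \<bar>x - y\<bar> \<le> d \<Longrightarrow> cmod (F x - F y) < e / 2"
    using d' by (auto simp: d_def dist_norm)
  have "ennreal (2 * d * (e/2)\<^sup>2) > 0" using d e by simp
  from order_tendstoD(2)[OF energy_tail_tendsto_0[OF sq] this]
  obtain R where R: "energy (\<lambda>x. F x - cut R F x) < ennreal (2 * d * (e/2)\<^sup>2)"
    by (auto simp: eventually_at_top_linorder)
  have "cmod (F x) < e" if x: "\<bar>x\<bar> \<ge> \<bar>R\<bar> + d + 1" for x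
  proof (rule ccontr)
    assume "\<not> cmod (F x) < e"
    then have ge: "cmod (F y) \<ge> e / 2" if "\<bar>x - y\<bar> \<le> d" for y
      using d(2)[OF that] norm_triangle_ineq3[of "F x" "F y"] norm_triangle_ineq2[of "F x" "F y"] by auto
    have "ennreal (2 * d * (e/2)\<^sup>2) = (\<integral>\<^sup>+y. ennreal ((e/2)\<^sup>2) * indicator {x - d..x + d} y \<partial>lborel)"
      using d(1) by (subst nn_integral_cmult_indicator) (auto simp: ennreal_mult[symmetric] mult_ac)
    also have "\<dots> \<le> energy (\<lambda>x. F x - cut R F x)"
      unfolding energy_def
    proof (rule nn_integral_mono)
      fix y
      show "ennreal ((e/2)\<^sup>2) * indicator {x - d..x + d} y \<le> ennreal ((cmod (F y - cut R F y))\<^sup>2)"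
      proof (cases "y \<in> {x - d..x + d}")
        case True
        then have xy: "\<bar>x - y\<bar> \<le> d" by auto
        then have "y \<notin> {-R..R}" using x by auto
        then have "F y - cut R F y = F y" by (simp add: cut_def)
        then show ?thesis using True ge[OF xy] e by (auto intro!: ennreal_leI power_mono)
      qed simp
    qed
    finally show False using R by simp
  qed
  then show ?thesis by blast
qed

lemma hat_class0_tendsto_0:
  assumes "F \<in> hat_class0"
  shows "(F \<longlongrightarrow> 0) at_top" "(F \<longlongrightarrow> 0) at_bot"
proof -
  show "(F \<longlongrightarrow> 0) at_top"
  proof (rule tendstoI)
    fix e :: real assume "e > 0"
    from hat_class0_vanishes[OF assms this] obtain X where X: "\<And>x. \<bar>x\<bar> \<ge> X \<Longrightarrow> cmod (F x) < e" by blast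
    show "\<forall>\<^sub>F x in at_top. dist (F x) 0 < e"
      using eventually_ge_at_top[of X] by eventually_elim (use X in auto)
  qed
  show "(F \<longlongrightarrow> 0) at_bot"
  proof (rule tendstoI)
    fix e :: real assume "e > 0"
    from hat_class0_vanishes[OF assms this] obtain X where X: "\<And>x. \<bar>x\<bar> \<ge> X \<Longrightarrow> cmod (F x) < e" by blast
    show "\<forall>\<^sub>F x in at_bot. dist (F x) 0 < e"
      using eventually_le_at_bot[of "-X"] by eventually_elim (use X in auto)
  qed
qed

lemma bounded_if_tendsto_at_infinity:
  fixes F :: "real \<Rightarrow> complex"
  assumes c: "continuous_on UNIV F" and e: "\<And>x. \<bar>x\<bar> \<ge> X \<Longrightarrow> cmod (F x) \<le> B"
  shows "\<exists>M>0. \<forall>x. cmod (F x) \<le> M"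
proof -
  have "compact (F ` {-X..X})"
    by (intro compact_continuous_image continuous_on_subset[OF c]) auto
  from compact_imp_bounded[OF this] obtain B' where "\<forall>y\<in>F ` {-X..X}. norm y \<le> B'"
    unfolding bounded_iff by blast
  then have B': "cmod (F x) \<le> B'" if "x \<in> {-X..X}" for x using that by blast
  have "cmod (F x) \<le> \<bar>B\<bar> + \<bar>B'\<bar> + 1" for x
  proof (cases "\<bar>x\<bar> \<ge> X")
    case True then show ?thesis using e[OF True] by linarith
  next
    case False
    then have "x \<in> {-X..X}" by auto
    from B'[OF this] show ?thesis by linarith
  qed
  then show ?thesis by (intro exI[of _ "\<bar>B\<bar> + \<bar>B'\<bar> + 1"]) auto
qed

lemma hat_class0_bounded:
  assumes "F \<in> hat_class0"
  obtains M where "M > 0" "\<And>x. cmod (F x) \<le> M"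
proof -
  obtain X where "\<And>x. \<bar>x\<bar> \<ge> X \<Longrightarrow> cmod (F x) < 1" using hat_class0_vanishes[OF assms, of 1] by auto
  then have "\<exists>M>0. \<forall>x. cmod (F x) \<le> M"
    using assms by (intro bounded_if_tendsto_at_infinity[of F X 1] hoelder_continuous_on)
      (auto simp: hat_class0_def less_imp_le)
  with that show ?thesis by blast
qed

lemma hat_class0_reflect:
  assumes "F \<in> hat_class0" shows "(\<lambda>x. F (- x)) \<in> hat_class0"
proof -
  have "hoelder_continuous F" and sq: "square_integrable F" using assms by (auto simp: hat_class0_def)
  then obtain C a where C: "0 < a" "a \<le> 1" "\<And>x y. cmod (F x - F y) \<le> C * \<bar>x - y\<bar> powr a"
    unfolding hoelder_continuous_def by blast
  have "cmod (F (- x) - F (- y)) \<le> C * \<bar>x - y\<bar> powr a" for x y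
    using C(3)[of "-x" "-y"] by (simp add: abs_minus_commute)
  then show ?thesis using C sq square_integrable_reflect
    unfolding hat_class0_def hoelder_continuous_def by blast
qed

lemma hat_class0_uminus:
  assumes "F \<in> hat_class0" shows "(\<lambda>x. - F x) \<in> hat_class0"
proof -
  have "cmod (- F x - - F y) = cmod (F x - F y)" for x y
    using norm_minus_cancel[of "F x - F y"] by (simp add: algebra_simps)
  then show ?thesis
    using assms square_integrable_uminus[of F] by (simp add: hat_class0_def hoelder_continuous_def)
qed

text \<open>For a bounded function a smaller exponent is always possible. The kernel
  \<open>\<bar>u\<bar> powr a / (1 + u\<^sup>2)\<close> of the derivative bound is integrable only for \<open>a < 1\<close>.\<close>

lemma hat_class0_exponentE:
  assumes "F \<in> hat_class0"
  obtains C a where "C \<ge> 0" "0 < a" "a < 1" "\<And>x y. cmod (F x - F y) \<le> C * \<bar>x - y\<bar> powr a"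
proof -
  have h: "hoelder_continuous F" using assms by (auto simp: hat_class0_def)
  obtain C a where C: "C \<ge> 0" "0 < a" "a \<le> 1" "\<And>x y. cmod (F x - F y) \<le> C * \<bar>x - y\<bar> powr a"
    using hoelder_continuousD[OF h] by blast
  obtain M where M: "M > 0" "\<And>x. cmod (F x) \<le> M" using hat_class0_bounded[OF assms] by blast
  have "cmod (F x - F y) \<le> (C + 2 * M) * \<bar>x - y\<bar> powr (a / 2)" for x y
  proof (cases "\<bar>x - y\<bar> \<le> 1")
    case True
    have "cmod (F x - F y) \<le> C * \<bar>x - y\<bar> powr a" by (rule C)
    also have "\<dots> \<le> C * \<bar>x - y\<bar> powr (a / 2)"
    proof (cases "x = y")
      case False then show ?thesis
        using True C(1,2) powr_mono'[of "a/2" a "\<bar>x - y\<bar>"] by (intro mult_left_mono) auto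
    qed simp
    also have "\<dots> \<le> (C + 2 * M) * \<bar>x - y\<bar> powr (a / 2)" using M by (intro mult_right_mono) auto
    finally show ?thesis .
  next
    case False
    have "cmod (F x - F y) \<le> 2 * M" using M(2)[of x] M(2)[of y] norm_triangle_ineq4[of "F x" "F y"] by linarith
    also have "\<dots> \<le> (C + 2 * M) * 1" using C by simp
    also have "\<dots> \<le> (C + 2 * M) * \<bar>x - y\<bar> powr (a / 2)"
      using False C M by (intro mult_left_mono ge_one_powr_ge_zero) auto
    finally show ?thesis .
  qed
  then show ?thesis by (rule that[rotated 3]) (use C M in auto)
qed

section \<open>Fourier inversion\<close>

lemma integrable_poisson:
  assumes "e > 0" shows "integrable lborel (\<lambda>u. complex_of_real (poisson e u))"
proof (rule integrableI_bounded)
  show "(\<integral>\<^sup>+u. ennreal (norm (complex_of_real (poisson e u))) \<partial>lborel) < \<infinity>"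
    using nn_integral_poisson[OF assms, of 0] by (simp add: poisson_nonneg[OF assms])
qed measurable

lemma integral_poisson: "e > 0 \<Longrightarrow> (LINT u|lborel. complex_of_real (poisson e u)) = 1"
proof -
  assume e: "e > 0"
  have "(LINT u|lborel. poisson e u) = enn2real (\<integral>\<^sup>+u. ennreal (poisson e u) \<partial>lborel)"
    by (rule integral_eq_nn_integral) (auto simp: poisson_nonneg[OF e])
  also have "\<dots> = 1" using nn_integral_poisson[OF e, of 0] by simp
  finally show ?thesis by (simp only: integral_complex_of_real of_real_1)
qed

lemma poisson_integral_tendsto:
  assumes c: "continuous_on UNIV F" and M: "\<And>x. cmod (F x) \<le> M"
    and s: "s \<longlonglongrightarrow> 0"
  shows "(\<lambda>n. LINT u|lborel. F (x + s n * u) * of_real (poisson 1 u)) \<longlonglongrightarrow> F x"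
proof -
  have [measurable]: "F \<in> borel_measurable borel" using c by (rule borel_measurable_continuous_onI)
  have "(\<lambda>n. LINT u|lborel. F (x + s n * u) * of_real (poisson 1 u))
      \<longlonglongrightarrow> (LINT u|lborel. F x * of_real (poisson 1 u))"
  proof (rule integral_dominated_convergence[where w = "\<lambda>u. M * cmod (of_real (poisson 1 u))"])
    show "integrable lborel (\<lambda>u. M * cmod (of_real (poisson 1 u)))"
      by (intro integrable_mult_right integrable_norm integrable_poisson) simp
    show "AE u in lborel. (\<lambda>n. F (x + s n * u) * of_real (poisson 1 u)) \<longlonglongrightarrow> F x * of_real (poisson 1 u)"
    proof (intro AE_I2 tendsto_intros)
      fix u
      have "(\<lambda>n. x + s n * u) \<longlonglongrightarrow> x + 0 * u" by (intro tendsto_intros s)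
      then have "(\<lambda>n. x + s n * u) \<longlonglongrightarrow> x" by simp
      then show "(\<lambda>n. F (x + s n * u)) \<longlonglongrightarrow> F x"
        using c by (intro isCont_tendsto_compose[of x F]) (auto simp: continuous_on_eq_continuous_at)
    qed
    show "AE u in lborel. norm (F (x + s n * u) * of_real (poisson 1 u)) \<le> M * cmod (of_real (poisson 1 u))" for n
      by (intro AE_I2) (simp add: norm_mult mult_right_mono M)
  qed measurable
  also have "(LINT u|lborel. F x * of_real (poisson 1 u)) = F x"
    using integral_poisson[of 1] by simp
  finally show ?thesis .
qed

text \<open>For the reflected transform \<open>f\<close> of \<open>F\<close>, the Abel means of the Fourier integral of \<open>f\<close> are
  Poisson integrals of \<open>F\<close>, because the Abel weight can be transformed in place of \<open>f\<close>. They converge to \<open>F\<close>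
  pointwise, as \<open>F\<close> is bounded and continuous.\<close>

theorem fourier_inversion:
  assumes F: "F \<in> hat_class0" and g: "has_fourier F g"
  shows "has_fourier (\<lambda>t. g (- t)) F"
proof -
  have c: "continuous_on UNIV F"
    using F by (auto simp: hat_class0_def hoelder_continuous_on)
  obtain M where M: "\<And>x. cmod (F x) \<le> M" using hat_class0_bounded[OF F] by blast
  define f where "f t = g (- t)" for t
  have f: "has_fourier (\<lambda>x. F (- x)) f" unfolding f_def by (rule has_fourier_reflect[OF g])
  have "has_fourier f F"
  proof (rule has_fourier_abel_limit)
    show "square_integrable f" using f by (simp add: has_fourier_iff)
    fix x
    define s where "s n = 1 / real (Suc n)" for n
    have s_pos: "s n > 0" for n by (simp add: s_def)
    have "fourier (\<lambda>t. abel n t * f t) x = (LINT u|lborel. F (x + - s n * u) * of_real (poisson 1 u))" for n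
    proof -
      let ?h = "\<lambda>t. abel n t * exp (\<i> * of_real x * of_real t)"
      let ?g = "\<lambda>t. F (- t) * of_real (poisson (s n) (t + x))"
      have hsq: "square_integrable ?h"
        by (rule square_integrable_bound[OF square_integrable_abel[of n]]) (auto simp: norm_mult)
      have "fourier (\<lambda>t. abel n t * f t) x = (1 / complex_of_real (sqrt (2 * pi))) * (LINT t|lborel. f t * ?h t)"
        unfolding fourier_def by (simp add: mult_ac)
      also have "(LINT t|lborel. f t * ?h t) = (LINT t|lborel. F (- t) * fourier ?h t)"
        by (rule has_fourier_mult_swap[OF f integrable_mult_exp[OF integrable_abel] hsq])
      also have "\<dots> = (LINT t|lborel. of_real (sqrt (2 * pi)) * ?g t)"
        unfolding fourier_modulate fourier_abel by (simp add: s_def mult_ac)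
      also have "\<dots> = of_real (sqrt (2 * pi)) * (LINT t|lborel. ?g t)"
        by (rule integral_mult_right_zero)
      also have "(LINT t|lborel. ?g t) = \<bar>s n\<bar> *\<^sub>R (LINT u|lborel. ?g (- x + s n * u))"
        by (rule lborel_integral_real_affine) (use s_pos[of n] in auto)
      also have "\<dots> = (LINT u|lborel. \<bar>s n\<bar> *\<^sub>R ?g (- x + s n * u))"
        by (rule integral_scaleR_right[symmetric])
      also have "\<dots> = (LINT u|lborel. F (x + - s n * u) * of_real (poisson 1 u))"
      proof (rule Bochner_Integration.integral_cong[OF refl])
        fix u
        have "poisson (s n) (- x + s n * u + x) = s n / (pi * ((s n)\<^sup>2 * (1 + u\<^sup>2)))"
          by (simp add: poisson_def power_mult_distrib algebra_simps)
        then have "\<bar>s n\<bar> * poisson (s n) (- x + s n * u + x) = poisson 1 u"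
          using s_pos[of n] by (simp add: poisson_def power2_eq_square)
        then have *: "complex_of_real \<bar>s n\<bar> * of_real (poisson (s n) (- x + s n * u + x)) = of_real (poisson 1 u)"
          by (metis of_real_mult)
        have "\<bar>s n\<bar> *\<^sub>R ?g (- x + s n * u)
           = F (- (- x + s n * u)) * (complex_of_real \<bar>s n\<bar> * of_real (poisson (s n) (- x + s n * u + x)))"
          by (simp only: scaleR_conv_of_real mult.left_commute)
        then show "\<bar>s n\<bar> *\<^sub>R ?g (- x + s n * u) = F (x + - s n * u) * of_real (poisson 1 u)"
          unfolding * by simp
      qed
      finally show ?thesis by simp
    qed
    moreover have "(\<lambda>n. - s n) \<longlonglongrightarrow> 0"
      unfolding s_def using tendsto_minus[OF LIMSEQ_inverse_real_of_nat] by (simp add: inverse_eq_divide)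
    then have "(\<lambda>n. LINT u|lborel. F (x + - s n * u) * of_real (poisson 1 u)) \<longlonglongrightarrow> F x"
      by (rule poisson_integral_tendsto[OF c M])
    ultimately show "(\<lambda>n. fourier (\<lambda>t. abel n t * f t) x) \<longlonglongrightarrow> F x"
      by (simp only:)
  qed
  then show ?thesis unfolding f_def .
qed

section \<open>Analytic extension to the upper half-plane\<close>

subsection \<open>Kernels on the half-line\<close>

lemma square_le_exp:
  assumes "c > 0" "t \<ge> (0::real)"
  shows "1 + t\<^sup>2 \<le> (1 + 8 / c\<^sup>2) * exp (c * t / 2)"
proof -
  \<comment> \<open>The quadratic Taylor polynomial absorbs the factor \<open>1 + t\<^sup>2\<close> at the cost of half of the exponent.\<close>
  have q: "1 + c * t / 2 + (c * t / 2)\<^sup>2 / 2 \<le> exp (c * t / 2)"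
    by (rule exp_lower_Taylor_quadratic) (use assms in auto)
  moreover have "0 \<le> c * t" using assms by simp
  moreover have "0 \<le> (c * t / 2)\<^sup>2 / 2" by simp
  ultimately have 1: "1 \<le> exp (c * t / 2)" and 2: "(c * t / 2)\<^sup>2 / 2 \<le> exp (c * t / 2)" by linarith+
  have "t\<^sup>2 = 8 / c\<^sup>2 * ((c * t / 2)\<^sup>2 / 2)" using assms(1) by (simp add: power2_eq_square field_simps)
  also have "\<dots> \<le> 8 / c\<^sup>2 * exp (c * t / 2)" by (rule mult_left_mono[OF 2]) simp
  finally have "1 + t\<^sup>2 \<le> exp (c * t / 2) + 8 / c\<^sup>2 * exp (c * t / 2)" using 1 by linarith
  then show ?thesis by (simp add: algebra_simps)
qed

lemma
  fixes k :: "real \<Rightarrow> complex"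
  assumes c: "c > 0" and [measurable]: "k \<in> borel_measurable borel"
    and bound: "\<And>t. t > 0 \<Longrightarrow> cmod (k t) \<le> B * (1 + t\<^sup>2) * exp (- (c * t))"
    and zero: "\<And>t. t \<le> 0 \<Longrightarrow> k t = 0"
  shows integrable_halfline_kernel: "integrable lborel k"
    and square_integrable_halfline_kernel: "square_integrable k"
proof -
  define A where "A = \<bar>B\<bar> * (1 + 8 / c\<^sup>2)"
  have le: "cmod (k t) \<le> A * (indicator {0<..} t * exp (- (c / 2 * t)))" for t
  proof (cases "t > 0")
    case True
    have "cmod (k t) \<le> B * (1 + t\<^sup>2) * exp (- (c * t))" by (rule bound[OF True])
    also have "\<dots> \<le> \<bar>B\<bar> * (1 + t\<^sup>2) * exp (- (c * t))" by (intro mult_right_mono) auto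
    also have "\<dots> \<le> \<bar>B\<bar> * ((1 + 8 / c\<^sup>2) * exp (c * t / 2)) * exp (- (c * t))"
      using True by (intro mult_right_mono mult_left_mono square_le_exp[OF c]) auto
    also have "\<dots> = A * (exp (c * t / 2) * exp (- (c * t)))" by (simp add: A_def)
    also have "exp (c * t / 2) * exp (- (c * t)) = exp (- (c / 2 * t))" by (simp add: mult_exp_exp)
    finally show ?thesis using True by simp
  qed (simp add: zero)
  have A: "A \<ge> 0" unfolding A_def by simp
  show "integrable lborel k"
    by (rule Bochner_Integration.integrable_bound[OF integrable_mult_right[OF integrable_exp_halfline[of "c / 2"], of A]])
       (use c le A in \<open>auto simp: abs_mult\<close>)
  have "integrable lborel (\<lambda>t. (cmod (k t))\<^sup>2)"
  proof (rule Bochner_Integration.integrable_bound[OF integrable_mult_right[OF integrable_exp_halfline[of c], of "A\<^sup>2"]])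
    have "(cmod (k t))\<^sup>2 \<le> A\<^sup>2 * (indicator {0<..} t * exp (- (c * t)))" for t
    proof -
      have "(cmod (k t))\<^sup>2 \<le> (A * (indicator {0<..} t * exp (- (c / 2 * t))))\<^sup>2"
        by (rule power_mono[OF le]) auto
      also have "\<dots> = A\<^sup>2 * (indicator {0<..} t * exp (- (c * t)))"
        by (auto simp: power_mult_distrib exp_double[symmetric] indicator_def)
      finally show ?thesis .
    qed
    then show "AE t in lborel. norm ((cmod (k t))\<^sup>2) \<le> norm (A\<^sup>2 * (indicator {0<..} t * exp (- (c * t))))"
      by (auto simp: abs_mult)
  qed (use c in auto)
  then show "square_integrable k" by (simp add: square_integrable_def)
qed

lemma norm_exp_i_upper: "cmod (exp (\<i> * z * of_real t)) = exp (- (Im z * t))"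
  by (simp add: norm_exp_eq_Re)

text \<open>The kernels of the transform over the positive half-line and, up to the factor \<open>\<i>\<close>, of its derivative
  in \<open>z\<close>.\<close>

definition expk :: "complex \<Rightarrow> real \<Rightarrow> complex" where
  "expk z t = indicator {0<..} t *\<^sub>R exp (\<i> * z * of_real t)"

definition texpk :: "complex \<Rightarrow> real \<Rightarrow> complex" where
  "texpk z t = indicator {0<..} t *\<^sub>R (of_real t * exp (\<i> * z * of_real t))"

lemma expk_measurable [measurable]: "expk z \<in> borel_measurable borel"
  unfolding expk_def by measurable

lemma texpk_measurable [measurable]: "texpk z \<in> borel_measurable borel"
  unfolding texpk_def by measurable

lemma square_integrable_expk:
  assumes "Im z > 0" shows "square_integrable (expk z)"
proof -
  have *: "cmod (expk z t) \<le> 1 * (1 + t\<^sup>2) * exp (- (Im z * t))" if "t > 0" for t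
    using that by (simp add: expk_def norm_exp_i_upper)
  show ?thesis
    by (rule square_integrable_halfline_kernel[OF assms _ *]) (simp_all add: expk_def)
qed

lemma
  assumes "Im z > 0"
  shows integrable_texpk: "integrable lborel (texpk z)" and square_integrable_texpk: "square_integrable (texpk z)"
proof -
  have *: "cmod (texpk z t) \<le> 1 * (1 + t\<^sup>2) * exp (- (Im z * t))" if "t > 0" for t
  proof -
    have "t \<le> 1 + t\<^sup>2" using zero_le_power2[of "t - 1/2"] by (simp add: power2_eq_square algebra_simps)
    then show ?thesis using that by (simp add: texpk_def norm_mult norm_exp_i_upper)
  qed
  show "integrable lborel (texpk z)" "square_integrable (texpk z)"
    by (rule integrable_halfline_kernel[OF assms _ *] square_integrable_halfline_kernel[OF assms _ *]; simp add: texpk_def)+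
qed

lemma energy_expk:
  assumes z: "Im z > 0"
  shows "energy (expk z) = ennreal (1 / (2 * Im z))"
proof -
  have c: "2 * Im z > 0" using z by simp
  have "energy (expk z) = (\<integral>\<^sup>+t. ennreal (indicator {0<..} t * exp (- (2 * Im z * t))) \<partial>lborel)"
    unfolding energy_def
    by (intro nn_integral_cong arg_cong[where f = ennreal])
       (auto simp: expk_def norm_exp_i_upper exp_double[symmetric] mult.assoc indicator_def)
  also have "\<dots> = ennreal (LINT t|lborel. indicator {0<..} t * exp (- (2 * Im z * t)))"
    by (rule nn_integral_eq_integral[OF integrable_exp_halfline[OF c]]) auto
  also have "(LINT t|lborel. indicator {0<..} t * exp (- (2 * Im z * t))) = 1 / (2 * Im z)"
  proof -
    have "complex_of_real (LINT t|lborel. indicator {0<..} t * exp (- (2 * Im z * t)))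
        = (LINT t|lborel. indicator {0<..} t *\<^sub>R exp (of_real (- (2 * Im z)) * of_real t))"
      by (subst integral_complex_of_real[symmetric])
         (intro Bochner_Integration.integral_cong refl, auto simp: exp_of_real[symmetric] indicator_def)
    also have "\<dots> = - 1 / of_real (- (2 * Im z))"
      by (rule integral_cexp_halfline) (use z in simp)
    also have "\<dots> = of_real (1 / (2 * Im z))" by simp
    finally show ?thesis by (simp only: of_real_eq_iff)
  qed
  finally show ?thesis .
qed



subsection \<open>The extension and its derivative\<close>

definition upper_ext :: "(real \<Rightarrow> complex) \<Rightarrow> complex \<Rightarrow> complex" where
  "upper_ext f z = (1 / complex_of_real (sqrt (2 * pi))) * (LINT t|lborel. f t * expk z t)"

lemma factor_plus_eq:
  assumes [measurable]: "f \<in> borel_measurable borel"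
  shows "factor_plus f z = exp (upper_ext f z)"
proof -
  have "(LINT t:{0..}|lborel. f t * exp (\<i> * z * of_real t)) = (LINT t:{0<..}|lborel. f t * exp (\<i> * z * of_real t))"
    unfolding set_lebesgue_integral_def
    by (rule integral_cong_AE, measurable) (use AE_nonzero in \<open>auto simp: indicator_def elim!: eventually_mono\<close>)
  then show ?thesis
    by (simp add: factor_plus_def upper_ext_def expk_def set_lebesgue_integral_def)
qed



text \<open>The Cauchy--Schwarz inequality, with the energy \<open>1 / (2 Im z)\<close> of the kernel.\<close>

lemma norm_upper_ext_le:
  assumes f: "square_integrable f"
  shows "\<exists>C\<ge>0. \<forall>z. Im z > 0 \<longrightarrow> cmod (upper_ext f z) \<le> C / sqrt (Im z)"
proof (intro exI conjI allI impI)
  let ?C = "sqrt (enn2real (energy f) / (4 * pi))"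
  show "?C \<ge> 0" by simp
  fix z assume z: "Im z > 0"
  have "ennreal ((cmod (LINT t|lborel. f t * expk z t))\<^sup>2) \<le> energy f * energy (expk z)"
    by (intro Cauchy_Schwarz_energy f square_integrable_expk z)
  also have "\<dots> = ennreal (enn2real (energy f) * (1 / (2 * Im z)))"
  proof -
    have "energy f = ennreal (enn2real (energy f))" using energy_finite[OF f] by simp
    then show ?thesis using z by (subst ennreal_mult) (auto simp: energy_expk)
  qed
  finally have "(cmod (LINT t|lborel. f t * expk z t))\<^sup>2 \<le> enn2real (energy f) * (1 / (2 * Im z))"
    using z by (subst (asm) ennreal_le_iff) auto
  from divide_right_mono[OF this, of "2 * pi"]
  have "(cmod (upper_ext f z))\<^sup>2 \<le> enn2real (energy f) * (1 / (2 * Im z)) / (2 * pi)"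
    unfolding upper_ext_def norm_mult norm_fourier_const
    by (simp only: power_mult_distrib power_divide) simp
  then have "cmod (upper_ext f z) \<le> sqrt (enn2real (energy f) * (1 / (2 * Im z)) / (2 * pi))"
    by (rule real_le_rsqrt)
  also have "\<dots> = ?C / sqrt (Im z)"
    by (simp add: real_sqrt_divide[symmetric] mult.commute)
  finally show "cmod (upper_ext f z) \<le> ?C / sqrt (Im z)" .
qed

lemma norm_exp_remainder: "cmod (exp w - 1 - w) \<le> exp (cmod w) * (cmod w)\<^sup>2"
proof -
  have "cmod (exp w - (\<Sum>k\<le>1. w ^ k / fact k)) \<le> exp \<bar>Re w\<bar> * cmod w ^ Suc 1 / fact 1"
    by (rule Taylor_exp)
  also have "\<dots> \<le> exp (cmod w) * (cmod w)\<^sup>2"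
    using abs_Re_le_cmod[of w] by (simp add: numeral_2_eq_2 mult_right_mono)
  finally show ?thesis by (simp add: algebra_simps)
qed

text \<open>Differentiation under the integral sign. The Taylor remainder of the kernel is at most \<open>\<bar>h\<bar>\<^sup>2\<close> times
  \<open>t\<^sup>2 exp (- Im z t / 2)\<close>, as long as \<open>\<bar>h\<bar> < Im z / 2\<close>.\<close>

lemma upper_ext_has_derivative:
  assumes f: "square_integrable f" and z: "Im z > 0"
  shows "(upper_ext f has_field_derivative
     (1 / complex_of_real (sqrt (2 * pi))) * (LINT t|lborel. f t * (\<i> * texpk z t))) (at z)"
proof -
  define c where "c = 1 / complex_of_real (sqrt (2 * pi))"
  define D where "D = c * (LINT t|lborel. f t * (\<i> * texpk z t))"
  define k where "k t = complex_of_real (indicator {0<..} t * (t\<^sup>2 * exp (- (Im z / 2 * t))))" for t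
  have [measurable]: "k \<in> borel_measurable borel" unfolding k_def by measurable
  have k: "square_integrable k"
    by (rule square_integrable_halfline_kernel[where c = "Im z / 2" and B = 1])
       (use z in \<open>auto simp: k_def norm_mult norm_power\<close>)
  note ik = square_integrable_mult_integrable[OF f k]
  have i1: "integrable lborel (\<lambda>t. f t * (\<i> * texpk z t))"
    by (intro square_integrable_mult_integrable f square_integrable_scale square_integrable_texpk z)
  have i0: "integrable lborel (\<lambda>t. f t * expk w t)" if "Im w > 0" for w
    by (intro square_integrable_mult_integrable f square_integrable_expk that)
  define M where "M = cmod c * (LINT t|lborel. cmod (f t * k t))"
  have bound: "cmod ((upper_ext f (z + h) - upper_ext f z) / h - D) \<le> M * cmod h"
    if h: "h \<noteq> 0" "cmod h < Im z / 2" for h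
  proof -
    have "\<bar>Im h\<bar> < Im z / 2" using h abs_Im_le_cmod[of h] by linarith
    then have zh: "Im (z + h) > 0" using z by auto
    let ?r = "\<lambda>t. expk (z + h) t - expk z t - h * (\<i> * texpk z t)"
    have pw: "cmod (?r t) \<le> (cmod h)\<^sup>2 * cmod (k t)" for t
    proof (cases "t > 0")
      case True
      let ?w = "\<i> * h * of_real t"
      have "?r t = exp (\<i> * z * of_real t) * (exp ?w - 1 - ?w)"
        using True by (simp add: expk_def texpk_def algebra_simps exp_add)
      then have "cmod (?r t) = exp (- (Im z * t)) * cmod (exp ?w - 1 - ?w)"
        by (simp add: norm_mult norm_exp_i_upper)
      also have "\<dots> \<le> exp (- (Im z * t)) * (exp (cmod ?w) * (cmod ?w)\<^sup>2)"
        by (intro mult_left_mono norm_exp_remainder) auto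
      also have "cmod ?w = cmod h * t" using True by (simp add: norm_mult)
      also have "exp (- (Im z * t)) * (exp (cmod h * t) * (cmod h * t)\<^sup>2)
          = (cmod h)\<^sup>2 * (t\<^sup>2 * (exp (- (Im z * t)) * exp (cmod h * t)))"
        by (simp only: power_mult_distrib mult_ac)
      also have "\<dots> \<le> (cmod h)\<^sup>2 * (t\<^sup>2 * exp (- (Im z / 2 * t)))"
      proof (intro mult_left_mono)
        have "cmod h * t \<le> Im z / 2 * t" using h True by (intro mult_right_mono) auto
        then show "exp (- (Im z * t)) * exp (cmod h * t) \<le> exp (- (Im z / 2 * t))"
          by (simp add: mult_exp_exp)
      qed auto
      also have "\<dots> = (cmod h)\<^sup>2 * cmod (k t)" using True by (simp add: k_def norm_mult norm_power)
      finally show ?thesis .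
    qed (simp add: expk_def texpk_def k_def)
    have "upper_ext f (z + h) - upper_ext f z - h * D = c * (LINT t|lborel. f t * (?r t))"
    proof -
      have "(LINT t|lborel. f t * (?r t))
         = (LINT t|lborel. f t * expk (z + h) t - f t * expk z t - h * (f t * (\<i> * texpk z t)))"
        by (rule arg_cong[where f = "integral\<^sup>L lborel"]) (simp add: fun_eq_iff algebra_simps)
      also have "\<dots> = (LINT t|lborel. f t * expk (z + h) t) - (LINT t|lborel. f t * expk z t) - h * (LINT t|lborel. f t * (\<i> * texpk z t))"
        using i0[OF zh] i0[OF z] i1
        by (subst Bochner_Integration.integral_diff, auto)+
      finally have e: "(LINT t|lborel. f t * (?r t))
        = (LINT t|lborel. f t * expk (z + h) t) - (LINT t|lborel. f t * expk z t) - h * (LINT t|lborel. f t * (\<i> * texpk z t))" .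
      show ?thesis unfolding D_def upper_ext_def c_def[symmetric] e by (simp add: algebra_simps)
    qed
    also have "cmod \<dots> \<le> cmod c * (LINT t|lborel. (cmod h)\<^sup>2 * cmod (f t * k t))"
      unfolding norm_mult[of c]
    proof (intro mult_left_mono)
      have "cmod (LINT t|lborel. f t * (?r t))
        \<le> (LINT t|lborel. cmod (f t * (?r t)))"
        by (rule integral_norm_bound)
      also have "\<dots> \<le> (LINT t|lborel. (cmod h)\<^sup>2 * cmod (f t * k t))"
      proof (rule Bochner_Integration.integral_mono)
        show "integrable lborel (\<lambda>t. cmod (f t * (?r t)))"
          by (intro integrable_norm square_integrable_mult_integrable f square_integrable_diff
              square_integrable_scale square_integrable_texpk square_integrable_expk z zh)
        show "integrable lborel (\<lambda>t. (cmod h)\<^sup>2 * cmod (f t * k t))"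
          by (intro integrable_mult_right integrable_norm ik)
        show "cmod (f t * (?r t)) \<le> (cmod h)\<^sup>2 * cmod (f t * k t)" for t
          using mult_left_mono[OF pw[of t], of "cmod (f t)"] by (simp add: norm_mult mult_ac)
      qed
      finally show "cmod (LINT t|lborel. f t * (?r t))
        \<le> (LINT t|lborel. (cmod h)\<^sup>2 * cmod (f t * k t))" .
    qed simp
    also have "\<dots> = M * (cmod h)\<^sup>2" unfolding M_def by simp
    finally have *: "cmod (upper_ext f (z + h) - upper_ext f z - h * D) \<le> M * (cmod h)\<^sup>2" .
    have "(upper_ext f (z + h) - upper_ext f z) / h - D = (upper_ext f (z + h) - upper_ext f z - h * D) / h"
      using h by (simp add: field_simps)
    then have "cmod ((upper_ext f (z + h) - upper_ext f z) / h - D) \<le> M * (cmod h)\<^sup>2 / cmod h"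
      using * h by (simp add: norm_divide divide_right_mono)
    then show ?thesis using h by (simp add: power2_eq_square)
  qed
  have "((\<lambda>h. (upper_ext f (z + h) - upper_ext f z) / h - D) \<longlongrightarrow> 0) (at 0)"
  proof (rule Lim_null_comparison)
    show "\<forall>\<^sub>F h in at 0. norm ((upper_ext f (z + h) - upper_ext f z) / h - D) \<le> M * cmod h"
      unfolding eventually_at using z bound by (intro exI[of _ "Im z / 2"]) auto
    show "((\<lambda>h. M * cmod h) \<longlongrightarrow> 0) (at (0::complex))"
      by (rule tendsto_eq_intros refl | simp)+
  qed
  then have "((\<lambda>h. (upper_ext f (z + h) - upper_ext f z) / h) \<longlongrightarrow> D) (at 0)" by (rule LIM_zero_cancel)
  then show ?thesis unfolding D_def c_def DERIV_def .
qed

text \<open>Instead of integrating by parts, \<open>z\<close> is split into two points of the upper half-plane: \<open>texpk z\<close> is then the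
  derivative kernel at \<open>z - w\<close> applied to \<open>expk w\<close>, whose extension is an explicit rational function.\<close>

lemma integral_texpk:
  assumes z: "Im z > 0"
  shows "(LINT t|lborel. texpk z t) = - 1 / z\<^sup>2"
proof -
  define c where "c = 1 / complex_of_real (sqrt (2 * pi))"
  define w where "w = \<i> * of_real (Im z / 2)"
  have w: "Im w > 0" and zw: "Im (z - w) > 0" using z by (auto simp: w_def)
  have ue: "upper_ext (expk w) u = c * (\<i> / (w + u))" if "Im u > 0" for u
  proof -
    have ek: "expk w t * expk u t = indicator {0<..} t *\<^sub>R exp ((\<i> * (w + u)) * of_real t)" for t
      by (simp add: expk_def mult_exp_exp indicator_def algebra_simps)
    have i: "- 1 / (\<i> * v) = \<i> / v" for v by (cases "v = 0") (simp_all add: field_simps)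
    have "(LINT t|lborel. expk w t * expk u t) = - 1 / (\<i> * (w + u))"
      unfolding ek by (rule integral_cexp_halfline) (use w that in simp)
    then show ?thesis unfolding upper_ext_def c_def i by (rule arg_cong)
  qed
  have "((\<lambda>u. c * (\<i> / (w + u))) has_field_derivative c * (- \<i> / z\<^sup>2)) (at (z - w))"
    using z by (auto intro!: derivative_eq_intros simp: power2_eq_square)
  then have "(upper_ext (expk w) has_field_derivative c * (- \<i> / z\<^sup>2)) (at (z - w))"
  proof (rule has_field_derivative_transform_within_open[OF _ open_halfspace_Im_gt[of 0]])
    show "c * (\<i> / (w + u)) = upper_ext (expk w) u" if "u \<in> {u. Im u > 0}" for u
      using ue[of u] that by simp
  qed (use zw in simp)
  from DERIV_unique[OF this upper_ext_has_derivative[OF square_integrable_expk[OF w] zw, folded c_def]]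
  have "- \<i> / z\<^sup>2 = (LINT t|lborel. expk w t * (\<i> * texpk (z - w) t))"
    by (rule mult_left_cancel[THEN iffD1, rotated]) (simp add: c_def)
  also have "\<dots> = (LINT t|lborel. \<i> * texpk z t)"
  proof (rule Bochner_Integration.integral_cong[OF refl])
    fix t
    have "exp (\<i> * w * of_real t) * exp (\<i> * (z - w) * of_real t) = exp (\<i> * z * of_real t)"
      by (simp add: mult_exp_exp algebra_simps)
    then show "expk w t * (\<i> * texpk (z - w) t) = \<i> * texpk z t"
      by (simp add: expk_def texpk_def indicator_def mult.left_commute)
  qed
  also have "\<dots> = \<i> * (LINT t|lborel. texpk z t)" by (rule integral_mult_right_zero)
  finally have "\<i> * (LINT t|lborel. texpk z t) = \<i> * (- 1 / z\<^sup>2)" by simp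
  then show ?thesis by (rule mult_left_cancel[THEN iffD1, rotated]) simp
qed

lemma upper_ext_holomorphic:
  assumes "square_integrable f" shows "upper_ext f holomorphic_on {z. Im z > 0}"
  unfolding holomorphic_on_def field_differentiable_def
  using upper_ext_has_derivative[OF assms] by (blast intro: has_field_derivative_at_within)

subsection \<open>The derivative as a Cauchy integral of the boundary values\<close>

lemma continuous_eq_if_AE_eq:
  fixes f g :: "real \<Rightarrow> complex"
  assumes f: "continuous_on UNIV f" and g: "continuous_on UNIV g" and ae: "AE x in lborel. f x = g x"
  shows "f x = g x"
proof -
  let ?S = "{x. f x \<noteq> g x}"
  have op: "open ?S" using f g by (rule open_Collect_neq)
  then have "?S \<in> sets lborel" by simp
  from AE_iff_null_sets[OF this] ae have "?S \<in> null_sets lborel" by simp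
  then have "negligible ?S"
    by (auto simp: negligible_iff_null_sets intro: null_sets_completionI)
  with op have "?S = {}" using open_not_negligible by blast
  then show ?thesis by blast
qed

lemma continuous_fourier:
  assumes f: "integrable lborel f" shows "continuous_on UNIV (fourier f)"
proof (rule continuous_at_imp_continuous_on, intro ballI)
  fix x
  show "isCont (fourier f) x"
    unfolding continuous_at_sequentially comp_def
  proof (intro allI impI)
    fix s assume s: "s \<longlonglongrightarrow> x"
    note [measurable] = borel_measurable_integrable[OF f]
    have "(\<lambda>n. LINT t|lborel. f t * exp (\<i> * of_real (s n) * of_real t)) \<longlonglongrightarrow> (LINT t|lborel. f t * exp (\<i> * of_real x * of_real t))"
    proof (rule integral_dominated_convergence[where w = "\<lambda>t. cmod (f t)"])
      show "AE t in lborel. (\<lambda>n. f t * exp (\<i> * of_real (s n) * of_real t)) \<longlonglongrightarrow> f t * exp (\<i> * of_real x * of_real t)"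
        by (intro AE_I2 tendsto_intros s)
    qed (use f in \<open>auto simp: norm_mult\<close>)
    then show "(\<lambda>n. fourier f (s n)) \<longlonglongrightarrow> fourier f x"
      unfolding fourier_def by (intro tendsto_intros)
  qed
qed

lemma has_fourier_fourier:
  assumes f: "integrable lborel f" "square_integrable f"
  shows "has_fourier f (fourier f)"
proof -
  have "((\<lambda>R. energy (\<lambda>x. fourier f x - fourier (cut R f) x)) \<longlongrightarrow> 0) at_top"
  proof (rule tendsto_sandwich[OF _ _ tendsto_const energy_tail_tendsto_0[OF f(2)]])
    show "\<forall>\<^sub>F R in at_top. energy (\<lambda>x. fourier f x - fourier (cut R f) x) \<le> energy (\<lambda>x. f x - cut R f x)"
      by (intro always_eventually allI energy_fourier_diff_le f integrable_cut square_integrable_cut)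
  qed simp
  then show ?thesis using f square_integrable_fourier[OF f] by (simp add: has_fourier_iff)
qed

text \<open>The kernel is Lipschitz continuous: it vanishes continuously at 0, and its derivative
  \<open>(1 + \<i> z t) exp (\<i> z t)\<close> is bounded on the positive half-line.\<close>

lemma norm_texpk_diff_le:
  assumes z: "Im z > 0"
  shows "cmod (texpk z s - texpk z t) \<le> (1 + cmod z / Im z) * \<bar>s - t\<bar>"
proof -
  define p where "p t = complex_of_real t * exp (\<i> * z * of_real t)" for t
  define B where "B = 1 + cmod z / Im z"
  have step: "cmod (p t - p s) \<le> B * (t - s)" if st: "0 \<le> s" "s \<le> t" for s t
  proof (cases "s = t")
    case False
    have "norm (p t - p s) \<le> B * t - B * s"
    proof (rule differentiable_bound_general[where f' = "\<lambda>x. exp (\<i> * z * of_real x) * (1 + \<i> * z * of_real x)" and \<phi>' = "\<lambda>x. B"])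
      show "s < t" using st False by simp
      show "continuous_on {s..t} p" unfolding p_def by (intro continuous_intros)
      show "continuous_on {s..t} (\<lambda>x. B * x)" by (intro continuous_intros)
      fix x assume x: "s < x" "x < t"
      then have x0: "x > 0" using st by simp
      show "((\<lambda>x. B * x) has_vector_derivative B) (at x)"
        by (auto intro!: derivative_eq_intros simp: has_real_derivative_iff_has_vector_derivative[symmetric])
      show "(p has_vector_derivative exp (\<i> * z * of_real x) * (1 + \<i> * z * of_real x)) (at x)"
        unfolding p_def
      proof (rule has_vector_derivative_real_field)
        show "((\<lambda>x. x * exp (\<i> * z * x)) has_field_derivative exp (\<i> * z * of_real x) * (1 + \<i> * z * of_real x)) (at (of_real x))"
          by (auto intro!: derivative_eq_intros simp: algebra_simps)
      qed
      have "Im z * x \<le> exp (Im z * x)" using exp_ge_add_one_self[of "Im z * x"] by linarith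
      then have "x * exp (- (Im z * x)) \<le> 1 / Im z"
        using z by (simp add: exp_minus field_simps)
      then have b: "cmod z * (x * exp (- (Im z * x))) \<le> cmod z * (1 / Im z)" by (rule mult_left_mono) simp
      have "norm (exp (\<i> * z * of_real x) * (1 + \<i> * z * of_real x)) \<le> exp (- (Im z * x)) * (1 + cmod z * x)"
        using norm_triangle_ineq[of 1 "\<i> * z * of_real x"] x0
        by (simp add: norm_mult norm_exp_i_upper)
      also have "\<dots> = exp (- (Im z * x)) + cmod z * (x * exp (- (Im z * x)))" by (simp add: algebra_simps)
      also have "\<dots> \<le> 1 + cmod z * (1 / Im z)" using z x0 by (intro add_mono b) auto
      finally show "norm (exp (\<i> * z * of_real x) * (1 + \<i> * z * of_real x)) \<le> B" by (simp add: B_def)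
    qed
    then show ?thesis by (simp add: algebra_simps)
  qed simp
  have B0: "B \<ge> 0" using z by (simp add: B_def)
  have le: "cmod (texpk z t - texpk z s) \<le> B * (t - s)" if "s \<le> t" for s t
  proof -
    have tp: "texpk z t = p (max t 0)" for t by (simp add: texpk_def p_def max_def indicator_def)
    have "cmod (p (max t 0) - p (max s 0)) \<le> B * (max t 0 - max s 0)" using that by (intro step) auto
    also have "\<dots> \<le> B * (t - s)" using that B0 by (intro mult_left_mono) auto
    finally show ?thesis by (simp add: tp)
  qed
  show ?thesis
    using le[of s t] le[of t s] unfolding B_def[symmetric]
    by (cases "s \<le> t") (auto simp: norm_minus_commute)
qed

lemma texpk_hat_class0:
  assumes z: "Im z > 0" shows "texpk z \<in> hat_class0"
  unfolding hat_class0_def hoelder_continuous_def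
proof (intro CollectI conjI)
  show "square_integrable (texpk z)" by (rule square_integrable_texpk[OF z])
  show "\<exists>C a. 0 < a \<and> a \<le> 1 \<and> (\<forall>x y. cmod (texpk z x - texpk z y) \<le> C * \<bar>x - y\<bar> powr a)"
    by (intro exI[of _ "1 + cmod z / Im z"] exI[of _ 1]) (use norm_texpk_diff_le[OF z] in auto)
qed

lemma norm_square_upper:
  "(cmod (of_real x - z))\<^sup>2 = (Im z)\<^sup>2 + (x - Re z)\<^sup>2"
  by (simp add: cmod_power2)

text \<open>The function \<open>1 / (x - z)\<^sup>2\<close> is a multiple of the reflected transform of \<open>texpk z\<close>. As \<open>texpk z\<close> is Hoelder
  continuous, inversion gives the transform of \<open>1 / (x - z)\<^sup>2\<close> without a residue computation.\<close>

lemma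
  assumes z: "Im z > 0"
  shows integrable_cauchy2: "integrable lborel (\<lambda>x. 1 / (of_real x - z)\<^sup>2)"
    and square_integrable_cauchy2: "square_integrable (\<lambda>x. 1 / (of_real x - z)\<^sup>2)"
    and fourier_cauchy2:
      "fourier (\<lambda>x. 1 / (of_real x - z)\<^sup>2) t = - of_real (sqrt (2 * pi)) * texpk z t"
proof -
  define c where "c = 1 / complex_of_real (sqrt (2 * pi))"
  have c0: "c \<noteq> 0" by (simp add: c_def)
  define h where "h x = fourier (texpk z) (- x)" for x
  have h: "h x = - c * (1 / (of_real x - z)\<^sup>2)" for x
  proof -
    have "texpk z t * exp (\<i> * of_real (- x) * of_real t) = texpk (z - of_real x) t" for t
      by (auto simp: texpk_def mult_exp_exp indicator_def algebra_simps)
    then have "h x = c * (LINT t|lborel. texpk (z - of_real x) t)"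
      by (simp add: h_def fourier_def c_def)
    also have "\<dots> = c * (- 1 / (z - of_real x)\<^sup>2)"
      by (subst integral_texpk) (use z in auto)
    finally show ?thesis by (simp add: power2_commute)
  qed
  have h': "1 / (of_real x - z)\<^sup>2 = - (1 / c) * h x" for x using c0 by (simp add: h)
  have hf: "has_fourier h (texpk z)"
    unfolding h_def
    by (intro fourier_inversion texpk_hat_class0 z has_fourier_fourier integrable_texpk square_integrable_texpk)
  then have hsq: "square_integrable h" by (simp add: has_fourier_iff)
  show sq: "square_integrable (\<lambda>x. 1 / (of_real x - z)\<^sup>2)"
    unfolding h' by (rule square_integrable_scale[OF hsq])
  show int: "integrable lborel (\<lambda>x. 1 / (of_real x - z)\<^sup>2)"
  proof (rule Bochner_Integration.integrable_bound)
    have "integrable lborel (\<lambda>x. cmod (of_real (poisson (Im z) (- Re z + 1 * x))))"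
      by (intro integrable_norm lborel_integrable_real_affine[where f = "\<lambda>u. of_real (poisson (Im z) u)"] integrable_poisson z) simp
    then show "integrable lborel (\<lambda>x. pi / Im z * cmod (of_real (poisson (Im z) (- Re z + 1 * x))))"
      by (rule integrable_mult_right)
    have "norm (1 / (of_real x - z)\<^sup>2) = pi / Im z * poisson (Im z) (x - Re z)" for x
      unfolding norm_divide norm_power norm_square_upper using z by (simp add: poisson_def)
    then show "AE x in lborel. norm (1 / (of_real x - z)\<^sup>2) \<le> norm (pi / Im z * cmod (of_real (poisson (Im z) (- Re z + 1 * x))))"
      using z poisson_nonneg[OF z] by (intro AE_I2) (simp add: abs_mult)
    show "(\<lambda>x. 1 / (of_real x - z)\<^sup>2) \<in> borel_measurable lborel"
      using square_integrableD[OF sq] by simp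
  qed
  have hi: "integrable lborel h"
    using integrable_mult_right[OF int, of "- c"] unfolding h[abs_def] by simp
  have "fourier h t = texpk z t"
  proof (rule continuous_eq_if_AE_eq)
    show "continuous_on UNIV (fourier h)" by (rule continuous_fourier[OF hi])
    show "continuous_on UNIV (texpk z)"
      using texpk_hat_class0[OF z] by (intro hoelder_continuous_on) (simp add: hat_class0_def)
    show "AE x in lborel. fourier h x = texpk z x"
      by (rule has_fourier_unique[OF has_fourier_fourier[OF hi hsq] hf])
  qed
  moreover have "fourier (\<lambda>x. 1 / (of_real x - z)\<^sup>2) t = - (1 / c) * fourier h t"
    unfolding h' fourier_def by (simp add: mult.assoc)
  ultimately show "fourier (\<lambda>x. 1 / (of_real x - z)\<^sup>2) t = - of_real (sqrt (2 * pi)) * texpk z t"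
    by (simp add: c_def)
qed

text \<open>The integral is the transform at the point 0, where \<open>texpk z\<close> vanishes.\<close>

lemma integral_cauchy2:
  assumes z: "Im z > 0" shows "(LINT x|lborel. 1 / (of_real x - z)\<^sup>2) = 0"
  using fourier_cauchy2[OF z, of 0] by (simp add: fourier_def texpk_def)

lemma upper_ext_has_cauchy_derivative:
  assumes f: "has_fourier f G" and z: "Im z > 0"
  shows "(upper_ext f has_field_derivative
     (1 / (2 * of_real pi * \<i>)) * (LINT x|lborel. G x * (1 / (of_real x - z)\<^sup>2))) (at z)"
proof -
  have sq: "square_integrable f" using f by (simp add: has_fourier_iff)
  have "(LINT x|lborel. G x * (1 / (of_real x - z)\<^sup>2)) = (LINT t|lborel. f t * fourier (\<lambda>x. 1 / (of_real x - z)\<^sup>2) t)"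
    by (rule has_fourier_mult_swap[OF f integrable_cauchy2[OF z] square_integrable_cauchy2[OF z]])
  also have "\<dots> = (LINT t|lborel. - of_real (sqrt (2 * pi)) * (f t * texpk z t))"
    unfolding fourier_cauchy2[OF z] by (simp add: mult_ac)
  also have "\<dots> = - of_real (sqrt (2 * pi)) * (LINT t|lborel. f t * texpk z t)"
    by (rule integral_mult_right_zero)
  finally have e: "(LINT x|lborel. G x * (1 / (of_real x - z)\<^sup>2)) = - of_real (sqrt (2 * pi)) * (LINT t|lborel. f t * texpk z t)" .
  have "(LINT t|lborel. f t * (\<i> * texpk z t)) = \<i> * (LINT t|lborel. f t * texpk z t)"
    by (subst integral_mult_right_zero[symmetric]) (simp add: mult_ac)
  moreover have "1 / complex_of_real (sqrt (2 * pi)) * (\<i> * I) = (1 / (2 * of_real pi * \<i>)) * (- of_real (sqrt (2 * pi)) * I)" for I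
  proof -
    have "complex_of_real (sqrt (2 * pi)) * of_real (sqrt (2 * pi)) = 2 * of_real pi"
      by (simp only: of_real_mult[symmetric] real_sqrt_mult_self) simp
    then show ?thesis by (simp add: field_simps)
  qed
  ultimately show ?thesis using upper_ext_has_derivative[OF sq z] unfolding e by simp
qed

lemma nn_integral_power_kernel_finite:
  assumes a: "0 < a" "a < 1"
  shows "(\<integral>\<^sup>+u. ennreal (\<bar>u\<bar> powr a / (1 + u\<^sup>2)) \<partial>lborel) < \<infinity>"
proof -
  let ?p = "\<lambda>u::real. ennreal ((1 + \<bar>u\<bar>) powr (a - 2))"
  have half: "(\<integral>\<^sup>+u. ?p u * indicator {0..} u \<partial>lborel) < \<infinity>"
  proof -
    have "(\<integral>\<^sup>+u. ?p u * indicator {0..} u \<partial>lborel)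
      = ennreal (0 - (- ((1 + 0) powr (a - 1) / (1 - a))))"
    proof (rule nn_integral_FTC_atLeast[where F = "\<lambda>u. - ((1 + u) powr (a - 1) / (1 - a))"])
      fix u :: real assume u: "0 \<le> u"
      show "((\<lambda>u. - ((1 + u) powr (a - 1) / (1 - a))) has_real_derivative (1 + \<bar>u\<bar>) powr (a - 2)) (at u)"
      proof -
        have d: "((\<lambda>u. (1 + u) powr (a - 1)) has_real_derivative (a - 1) * (1 + u) powr (a - 2)) (at u)"
          using u by (auto intro!: derivative_eq_intros)
        have "(a - 1) / (1 - a) = - 1" using a by (simp add: divide_eq_eq)
        then have "- ((a - 1) * p / (1 - a)) = p" for p by (metis minus_minus mult_minus1 times_divide_eq_left)
        with DERIV_minus[OF DERIV_cdivide[OF d, of "1 - a"]] show ?thesis using u by simp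
      qed
    next
      have "((\<lambda>u. (1 + u) powr (a - 1)) \<longlongrightarrow> 0) at_top"
        by (rule tendsto_neg_powr) (use a in \<open>auto intro!: filterlim_tendsto_add_at_top[OF tendsto_const] filterlim_ident\<close>)
      from tendsto_minus[OF tendsto_divide[OF this tendsto_const, of "1 - a"]] a
      show "((\<lambda>u. - ((1 + u) powr (a - 1) / (1 - a))) \<longlongrightarrow> 0) at_top" by simp
    qed auto
    then show ?thesis by simp
  qed
  have "(\<integral>\<^sup>+u. ennreal (\<bar>u\<bar> powr a / (1 + u\<^sup>2)) \<partial>lborel) \<le> (\<integral>\<^sup>+u. 2 * (?p u * indicator {0..} u + ?p u * indicator {..0} u) \<partial>lborel)"
  proof (rule nn_integral_mono)
    fix u :: real
    have "\<bar>u\<bar> powr a / (1 + u\<^sup>2) \<le> (1 + \<bar>u\<bar>) powr a / ((1 + \<bar>u\<bar>)\<^sup>2 / 2)"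
    proof (rule frac_le)
      show "\<bar>u\<bar> powr a \<le> (1 + \<bar>u\<bar>) powr a" using a by (intro powr_mono2) auto
      show "(1 + \<bar>u\<bar>)\<^sup>2 / 2 \<le> 1 + u\<^sup>2"
        using zero_le_power2[of "1 - \<bar>u\<bar>"] by (simp add: power2_eq_square algebra_simps)
    qed auto
    also have "\<dots> = 2 * (1 + \<bar>u\<bar>) powr (a - 2)"
      by (simp add: powr_diff)
    finally have "ennreal (\<bar>u\<bar> powr a / (1 + u\<^sup>2)) \<le> 2 * ?p u"
      by (metis ennreal_leI ennreal_mult' ennreal_numeral zero_le_numeral)
    then show "ennreal (\<bar>u\<bar> powr a / (1 + u\<^sup>2)) \<le> 2 * (?p u * indicator {0..} u + ?p u * indicator {..0} u)"
      by (rule order_trans) (intro mult_left_mono, auto simp: indicator_def intro: add_increasing)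
  qed
  also have "\<dots> = 2 * ((\<integral>\<^sup>+u. ?p u * indicator {0..} u \<partial>lborel) + (\<integral>\<^sup>+u. ?p u * indicator {..0} u \<partial>lborel))"
    by (subst nn_integral_cmult, measurable) (subst nn_integral_add, auto)
  also have "(\<integral>\<^sup>+u. ?p u * indicator {..0} u \<partial>lborel) = (\<integral>\<^sup>+u. ?p u * indicator {0..} u \<partial>lborel)"
    by (subst nn_integral_real_affine[of _ "-1" 0]) (auto simp: indicator_def)
  also have "2 * (\<dots> + \<dots>) < \<infinity>" using half by (simp add: ennreal_mult_less_top)
  finally show ?thesis .
qed

text \<open>As the kernel has integral 0, the value of \<open>G\<close> at \<open>Re z\<close> may be subtracted under the
  integral. The substitution \<open>x = Re z + u Im z\<close> then extracts the power of \<open>Im z\<close>.\<close>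

lemma upper_ext_derivative_bound:
  assumes f: "has_fourier f G" and a: "0 < a" "a < 1" and C: "C \<ge> 0"
    and G: "\<And>x y. cmod (G x - G y) \<le> C * \<bar>x - y\<bar> powr a"
  shows "\<exists>M\<ge>0. \<forall>z. Im z > 0 \<longrightarrow> cmod (deriv (upper_ext f) z) \<le> M * Im z powr (a - 1)"
proof -
  define J where "J = enn2real (\<integral>\<^sup>+u. ennreal (\<bar>u\<bar> powr a / (1 + u\<^sup>2)) \<partial>lborel)"
  have J: "(\<integral>\<^sup>+u. ennreal (\<bar>u\<bar> powr a / (1 + u\<^sup>2)) \<partial>lborel) = ennreal J" and J0: "J \<ge> 0"
    unfolding J_def using nn_integral_power_kernel_finite[OF a] by auto
  have sqG: "square_integrable G" using f by (simp add: has_fourier_iff)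
  note [measurable] = square_integrableD[OF sqG]
  have "cmod (deriv (upper_ext f) z) \<le> (C * J / (2 * pi)) * Im z powr (a - 1)" if z: "Im z > 0" for z
  proof -
    let ?k = "\<lambda>x. 1 / (complex_of_real x - z)\<^sup>2"
    have i1: "integrable lborel (\<lambda>x. G x * ?k x)"
      by (rule square_integrable_mult_integrable[OF sqG square_integrable_cauchy2[OF z]])
    have i2: "integrable lborel (\<lambda>x. G (Re z) * ?k x)"
      by (intro integrable_mult_right integrable_cauchy2 z)
    have i3: "integrable lborel (\<lambda>x. (G x - G (Re z)) * ?k x)"
      using Bochner_Integration.integrable_diff[OF i1 i2] by (simp add: algebra_simps diff_divide_distrib)
    have "(LINT x|lborel. G x * ?k x) = (LINT x|lborel. G x * ?k x) - (LINT x|lborel. G (Re z) * ?k x)"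
      by (subst integral_mult_right_zero) (simp only: integral_cauchy2[OF z], simp)
    also have "\<dots> = (LINT x|lborel. (G x - G (Re z)) * ?k x)"
      by (subst Bochner_Integration.integral_diff[OF i1 i2, symmetric]) (simp add: diff_divide_distrib)
    finally have eq: "(LINT x|lborel. G x * ?k x) = (LINT x|lborel. (G x - G (Re z)) * ?k x)" .
    have "ennreal (cmod (LINT x|lborel. G x * ?k x)) \<le> (\<integral>\<^sup>+x. ennreal (cmod ((G x - G (Re z)) * ?k x)) \<partial>lborel)"
      unfolding eq by (rule integral_norm_bound_ennreal[OF i3])
    also have "\<dots> \<le> (\<integral>\<^sup>+x. ennreal (C * \<bar>x - Re z\<bar> powr a / ((Im z)\<^sup>2 + (x - Re z)\<^sup>2)) \<partial>lborel)"
    proof (intro nn_integral_mono ennreal_leI)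
      fix x
      show "cmod ((G x - G (Re z)) * ?k x) \<le> C * \<bar>x - Re z\<bar> powr a / ((Im z)\<^sup>2 + (x - Re z)\<^sup>2)"
        using G[of x "Re z"] by (simp add: norm_mult norm_divide norm_power norm_square_upper divide_right_mono)
    qed
    also have "\<dots> = ennreal \<bar>Im z\<bar> * (\<integral>\<^sup>+u. ennreal (C * \<bar>Re z + Im z * u - Re z\<bar> powr a / ((Im z)\<^sup>2 + (Re z + Im z * u - Re z)\<^sup>2)) \<partial>lborel)"
      by (rule nn_integral_real_affine) (use z in auto)
    also have "\<dots> = ennreal \<bar>Im z\<bar> * (\<integral>\<^sup>+u. ennreal (C * Im z powr a / (Im z)\<^sup>2) * ennreal (\<bar>u\<bar> powr a / (1 + u\<^sup>2)) \<partial>lborel)"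
    proof (intro arg_cong[where f = "\<lambda>x. ennreal \<bar>Im z\<bar> * x"] nn_integral_cong)
      fix u
      have "(Im z)\<^sup>2 + (Im z * u)\<^sup>2 = (Im z)\<^sup>2 * (1 + u\<^sup>2)" by (simp add: power_mult_distrib algebra_simps)
      moreover have "\<bar>Im z * u\<bar> powr a = Im z powr a * \<bar>u\<bar> powr a" using z by (simp add: abs_mult powr_mult)
      ultimately have "C * \<bar>Re z + Im z * u - Re z\<bar> powr a / ((Im z)\<^sup>2 + (Re z + Im z * u - Re z)\<^sup>2)
        = (C * Im z powr a / (Im z)\<^sup>2) * (\<bar>u\<bar> powr a / (1 + u\<^sup>2))" by simp
      then show "ennreal (C * \<bar>Re z + Im z * u - Re z\<bar> powr a / ((Im z)\<^sup>2 + (Re z + Im z * u - Re z)\<^sup>2))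
         = ennreal (C * Im z powr a / (Im z)\<^sup>2) * ennreal (\<bar>u\<bar> powr a / (1 + u\<^sup>2))"
        using C by (simp only: ennreal_mult')  (subst ennreal_mult'[symmetric], auto)
    qed
    also have "\<dots> = ennreal \<bar>Im z\<bar> * (ennreal (C * Im z powr a / (Im z)\<^sup>2) * ennreal J)"
      by (subst nn_integral_cmult) (auto simp: J)
    also have "\<dots> = ennreal (\<bar>Im z\<bar> * (C * Im z powr a / (Im z)\<^sup>2 * J))"
      using C J0 by (subst ennreal_mult, simp, simp, subst ennreal_mult) auto
    also have "\<bar>Im z\<bar> * (C * Im z powr a / (Im z)\<^sup>2 * J) = C * J * Im z powr (a - 1)"
      using z by (simp add: powr_diff power2_eq_square)
    finally have "cmod (LINT x|lborel. G x * ?k x) \<le> C * J * Im z powr (a - 1)"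
      using C J0 by (subst (asm) ennreal_le_iff) auto
    moreover have "deriv (upper_ext f) z = (1 / (2 * of_real pi * \<i>)) * (LINT x|lborel. G x * ?k x)"
      by (rule DERIV_imp_deriv[OF upper_ext_has_cauchy_derivative[OF f z]])
    ultimately show ?thesis
      by (simp add: norm_mult norm_divide divide_right_mono)
  qed
  moreover have "C * J / (2 * pi) \<ge> 0" using C J0 by simp
  ultimately show ?thesis by blast
qed

subsection \<open>Hoelder continuous extension to the closed half-plane\<close>

text \<open>Two points at distance \<open>d\<close> are joined by rising by \<open>d\<close>, crossing at height at least \<open>d\<close> and descending. The
  bound for the derivative is integrable along the vertical pieces, because \<open>a > 0\<close>, and is at most
  \<open>M * d powr (a - 1)\<close> along the crossing.\<close>

lemma dist_le_powr_if_deriv_bound: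
  assumes hol: "F holomorphic_on {z. Im z > 0}" and a: "0 < a" "a < 1" and M: "M \<ge> 0"
    and bound: "\<And>z. Im z > 0 \<Longrightarrow> cmod (deriv F z) \<le> M * Im z powr (a - 1)"
    and z: "Im z > 0" and w: "Im w > 0"
  shows "dist (F z) (F w) \<le> (2 * M / a + M) * dist z w powr a"
proof (cases "z = w")
  case False
  define d where "d = dist z w"
  have d: "d > 0" using False by (simp add: d_def)
  have der: "(F has_field_derivative deriv F u) (at u)" if "Im u > 0" for u
    using holomorphic_derivI[OF hol open_halfspace_Im_gt] that by simp
  have mono: "u powr (a - 1) \<le> v powr (a - 1)" if "0 < v" "v \<le> u" for u v :: real
    using that a by (intro powr_mono2') auto
  have up: "cmod (F (u + \<i> * of_real d) - F u) \<le> M / a * d powr a" if u: "Im u > 0" for u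
  proof -
    have "norm (F (u + \<i> * of_real d) - F (u + \<i> * of_real 0)) \<le> M / a * d powr a - M / a * 0 powr a"
    proof (rule differentiable_bound_general[where f = "\<lambda>s. F (u + \<i> * of_real s)" and \<phi> = "\<lambda>s. M / a * s powr a"
          and f' = "\<lambda>s. deriv F (u + \<i> * of_real s) * \<i>" and \<phi>' = "\<lambda>s. M * s powr (a - 1)"])
      show "0 < d" by (rule d)
      have chain: "((\<lambda>s. F (u + \<i> * of_real s)) has_vector_derivative deriv F (u + \<i> * of_real s) * \<i>) (at s)"
        if "s \<ge> 0" for s :: real
      proof (rule has_vector_derivative_real_field)
        have im: "Im (u + \<i> * of_real s) > 0" using u that by simp
        have g: "((\<lambda>s. u + \<i> * s) has_field_derivative \<i>) (at (complex_of_real s))"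
          by (auto intro!: derivative_eq_intros)
        show "((\<lambda>s. F (u + \<i> * s)) has_field_derivative deriv F (u + \<i> * of_real s) * \<i>) (at (of_real s))"
          by (rule DERIV_chain2[where f = F and g = "\<lambda>s. u + \<i> * s", OF der[OF im] g])
      qed
      show "continuous_on {0..d} (\<lambda>s. F (u + \<i> * of_real s))"
        by (intro continuous_at_imp_continuous_on ballI has_vector_derivative_continuous[OF chain]) auto
      show "continuous_on {0..d} (\<lambda>s. M / a * s powr a)"
        using a by (intro continuous_intros continuous_on_powr') auto
      fix s assume s: "0 < s" "s < d"
      show "((\<lambda>s. F (u + \<i> * of_real s)) has_vector_derivative deriv F (u + \<i> * of_real s) * \<i>) (at s)"
        using s by (intro chain) auto
      show "((\<lambda>s. M / a * s powr a) has_vector_derivative M * s powr (a - 1)) (at s)"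
        unfolding has_real_derivative_iff_has_vector_derivative[symmetric]
        using s a by (auto intro!: derivative_eq_intros)
      have "norm (deriv F (u + \<i> * of_real s) * \<i>) \<le> M * (Im u + s) powr (a - 1)"
        using bound[of "u + \<i> * of_real s"] u s by (simp add: norm_mult)
      also have "\<dots> \<le> M * s powr (a - 1)" using u s M by (intro mult_left_mono mono) auto
      finally show "norm (deriv F (u + \<i> * of_real s) * \<i>) \<le> M * s powr (a - 1)" .
    qed
    then show ?thesis using a by simp
  qed
  have across: "cmod (F (z + \<i> * of_real d) - F (w + \<i> * of_real d)) \<le> M * d powr (a - 1) * cmod ((z + \<i> * of_real d) - (w + \<i> * of_real d))"
  proof (rule field_differentiable_bound[where S = "{u. Im u \<ge> d}" and f' = "deriv F"])
    show "convex {u. Im u \<ge> d}" by (rule convex_halfspace_Im_ge)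
    show "(F has_field_derivative deriv F u) (at u within {u. Im u \<ge> d})" if "u \<in> {u. Im u \<ge> d}" for u
      using der[of u] that d by (auto intro: has_field_derivative_at_within)
    show "cmod (deriv F u) \<le> M * d powr (a - 1)" if "u \<in> {u. Im u \<ge> d}" for u
    proof -
      have "cmod (deriv F u) \<le> M * Im u powr (a - 1)" using that d by (intro bound) auto
      also have "\<dots> \<le> M * d powr (a - 1)" using that d M by (intro mult_left_mono mono) auto
      finally show ?thesis .
    qed
  qed (use z w in auto)
  have "d powr (a - 1) * d = d powr a" using d by (simp add: powr_diff)
  with across have across': "cmod (F (z + \<i> * of_real d) - F (w + \<i> * of_real d)) \<le> M * d powr a"
    by (simp add: d_def dist_norm mult.assoc)
  have "dist (F z) (F w) \<le> cmod (F z - F (z + \<i> * of_real d)) + (cmod (F (z + \<i> * of_real d) - F (w + \<i> * of_real d)) + cmod (F (w + \<i> * of_real d) - F w))"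
    unfolding dist_norm using norm_triangle_ineq[of "F z - F (z + \<i> * of_real d)" "F (z + \<i> * of_real d) - F w"]
      norm_triangle_ineq[of "F (z + \<i> * of_real d) - F (w + \<i> * of_real d)" "F (w + \<i> * of_real d) - F w"] by simp
  also have "\<dots> \<le> M / a * d powr a + (M * d powr a + M / a * d powr a)"
    using up[OF z] up[OF w] across' by (intro add_mono) (auto simp: norm_minus_commute)
  also have "\<dots> = (2 * M / a + M) * dist z w powr a" unfolding d_def[symmetric] by (simp add: algebra_simps)
  finally show ?thesis .
qed simp

lemma tendsto_add_imaginary: "(\<lambda>n. z + \<i> * of_real (1 / real (Suc n))) \<longlonglongrightarrow> z"
proof -
  have "(\<lambda>n. 1 / real (Suc n)) \<longlonglongrightarrow> 0" using LIMSEQ_inverse_real_of_nat by (simp add: inverse_eq_divide)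
  then have "(\<lambda>n. z + \<i> * of_real (1 / real (Suc n))) \<longlonglongrightarrow> z + \<i> * of_real 0" by (intro tendsto_intros)
  then show ?thesis by simp
qed

text \<open>The values on the real line are the limits from above.\<close>

definition closed_ext :: "(real \<Rightarrow> complex) \<Rightarrow> complex \<Rightarrow> complex" where
  "closed_ext f z = (if Im z > 0 then upper_ext f z else Lim (at z within {w. Im w > 0}) (upper_ext f))"

lemma closed_ext_upper: "Im z > 0 \<Longrightarrow> closed_ext f z = upper_ext f z"
  by (simp add: closed_ext_def)

lemma at_within_upper_nontrivial:
  assumes "Im z \<ge> 0" shows "at z within {w. Im w > 0} \<noteq> bot"
proof -
  define s where "s n = z + \<i> * of_real (1 / real (Suc n))" for n
  have "s \<longlonglongrightarrow> z" unfolding s_def by (rule tendsto_add_imaginary)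
  moreover have "s n \<in> {w. Im w > 0} - {z}" for n
    using assms by (auto simp: s_def complex_eq_iff intro: add_nonneg_pos)
  ultimately show ?thesis
    unfolding trivial_limit_within islimpt_sequential by blast
qed

text \<open>The Hoelder estimate makes \<open>upper_ext f\<close> uniformly continuous, so that it extends to the closure, and the
  estimate passes to the limit because both points can be moved up by the same amount.\<close>

lemma closed_ext_hoelder:
  assumes f: "has_fourier f G" and G: "G \<in> hat_class0"
  shows "\<exists>C a. C \<ge> 0 \<and> 0 < a \<and> a < 1 \<and>
    (\<forall>z w. Im z \<ge> 0 \<longrightarrow> Im w \<ge> 0 \<longrightarrow> dist (closed_ext f z) (closed_ext f w) \<le> C * dist z w powr a)"
proof -
  have sq: "square_integrable f" using f by (simp add: has_fourier_iff)
  obtain C0 a where C0: "C0 \<ge> 0" and a: "0 < a" "a < 1" and G: "\<And>x y. cmod (G x - G y) \<le> C0 * \<bar>x - y\<bar> powr a"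
    by (rule hat_class0_exponentE[OF G]) blast
  obtain M where M: "M \<ge> 0" "\<And>z. Im z > 0 \<Longrightarrow> cmod (deriv (upper_ext f) z) \<le> M * Im z powr (a - 1)"
    using upper_ext_derivative_bound[OF f a C0 G] by blast
  define C where "C = 2 * M / a + M"
  have C: "C \<ge> 0" using M a by (simp add: C_def)
  let ?U = "{z. Im z > 0}"
  have h: "dist (upper_ext f z) (upper_ext f w) \<le> C * dist z w powr a" if "Im z > 0" "Im w > 0" for z w
    unfolding C_def by (rule dist_le_powr_if_deriv_bound[OF upper_ext_holomorphic[OF sq] a M that])
  have "uniformly_continuous_on ?U (upper_ext f)"
    by (rule uniformly_continuous_on_if_hoelder[OF h a(1)]) auto
  then obtain B where B: "uniformly_continuous_on (closure ?U) B" "\<And>z. z \<in> ?U \<Longrightarrow> upper_ext f z = B z"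
    by (rule uniformly_continuous_on_extension_on_closure) blast
  have Bc: "continuous_on (closure ?U) B" by (rule uniformly_continuous_imp_continuous[OF B(1)])
  have cl: "z \<in> closure ?U" if "Im z \<ge> 0" for z
    using at_within_upper_nontrivial[OF that] by (simp add: trivial_limit_within closure_def)
  have eq: "closed_ext f z = B z" if z: "Im z \<ge> 0" for z
  proof (cases "Im z > 0")
    case False
    have "(B \<longlongrightarrow> B z) (at z within closure ?U)" using Bc cl[OF z] by (simp add: continuous_on_def)
    then have "(B \<longlongrightarrow> B z) (at z within ?U)" by (rule tendsto_within_subset[OF _ closure_subset])
    then have "(upper_ext f \<longlongrightarrow> B z) (at z within ?U)"
      by (rule Lim_transform_eventually) (auto simp: eventually_at_filter B(2))
    then have "Lim (at z within ?U) (upper_ext f) = B z"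
      by (rule tendsto_Lim[OF at_within_upper_nontrivial[OF z]])
    then show ?thesis using False by (simp add: closed_ext_def)
  qed (simp add: closed_ext_def B(2))
  have seq: "(\<lambda>n. upper_ext f (z + \<i> * of_real (1 / real (Suc n)))) \<longlonglongrightarrow> B z" if z: "Im z \<ge> 0" for z
  proof -
    have "z + \<i> * of_real (1 / real (Suc n)) \<in> ?U" for n using z by (auto intro: add_nonneg_pos)
    moreover from this have "(\<lambda>n. B (z + \<i> * of_real (1 / real (Suc n)))) \<longlonglongrightarrow> B z"
      using closure_subset[of ?U]
      by (intro continuous_on_tendsto_compose[OF Bc tendsto_add_imaginary cl[OF z]] always_eventually allI) blast
    ultimately show ?thesis using B(2) by simp
  qed
  have "dist (closed_ext f z) (closed_ext f w) \<le> C * dist z w powr a" if z: "Im z \<ge> 0" and w: "Im w \<ge> 0" for z w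
    unfolding eq[OF z] eq[OF w]
  proof (rule LIMSEQ_le_const2[OF tendsto_dist[OF seq[OF z] seq[OF w]]], intro exI allI impI)
    fix n
    let ?s = "\<i> * complex_of_real (1 / real (Suc n))"
    have "dist (upper_ext f (z + ?s)) (upper_ext f (w + ?s)) \<le> C * dist (z + ?s) (w + ?s) powr a"
      by (rule h) (use z w in \<open>auto intro: add_nonneg_pos\<close>)
    then show "dist (upper_ext f (z + ?s)) (upper_ext f (w + ?s)) \<le> C * dist z w powr a"
      by (simp add: dist_norm)
  qed
  with C a show ?thesis by blast
qed

lemma closed_ext_continuous:
  assumes f: "has_fourier f G" and G: "G \<in> hat_class0"
  shows "continuous_on {z. Im z \<ge> 0} (closed_ext f)"
proof -
  obtain C a where C: "C \<ge> 0" "0 < a" "a < 1"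
    and h: "\<And>z w. Im z \<ge> 0 \<Longrightarrow> Im w \<ge> 0 \<Longrightarrow> dist (closed_ext f z) (closed_ext f w) \<le> C * dist z w powr a"
    using closed_ext_hoelder[OF f G] by blast
  show ?thesis
    by (intro uniformly_continuous_imp_continuous uniformly_continuous_on_if_hoelder[OF h]) (use C in auto)
qed

lemma upper_ext_line:
  assumes f: "square_integrable f" and y: "y > 0"
  shows "upper_ext f (of_real x + \<i> * of_real y) = fourier (\<lambda>t. f t * expk (\<i> * of_real y) t) x"
proof -
  have "expk (of_real x + \<i> * of_real y) t = expk (\<i> * of_real y) t * exp (\<i> * of_real x * of_real t)" for t
    by (simp add: expk_def mult_exp_exp algebra_simps)
  then show ?thesis by (simp add: upper_ext_def fourier_def mult.assoc)
qed

text \<open>Abel damping of the half-line part of \<open>f\<close> amounts to evaluating the extension at height \<open>1 / (n + 1)\<close>.\<close>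

lemma has_fourier_closed_ext:
  assumes f: "has_fourier f G" and G: "G \<in> hat_class0"
  shows "has_fourier (plus_part f) (\<lambda>x. closed_ext f (of_real x))"
proof (rule has_fourier_abel_limit)
  have sq: "square_integrable f" using f by (simp add: has_fourier_iff)
  note [measurable] = square_integrableD[OF sq]
  have "plus_part f \<in> borel_measurable borel" unfolding plus_part_def[abs_def] by measurable
  then show "square_integrable (plus_part f)"
    by (rule square_integrable_bound[OF sq]) (auto simp: plus_part_def)
  fix x
  let ?z = "\<lambda>n. of_real x + \<i> * of_real (1 / real (Suc n))"
  have "abel n t * plus_part f t = f t * expk (\<i> * of_real (1 / real (Suc n))) t" for n t
    by (simp add: plus_part_def expk_def abel_def exp_of_real[symmetric])
  then have "fourier (\<lambda>t. abel n t * plus_part f t) x = closed_ext f (?z n)" for n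
    using upper_ext_line[OF sq, of "1 / real (Suc n)" x] by (simp add: closed_ext_upper)
  moreover have "(\<lambda>n. closed_ext f (?z n)) \<longlonglongrightarrow> closed_ext f (of_real x)"
    by (rule continuous_on_tendsto_compose[OF closed_ext_continuous[OF f G] tendsto_add_imaginary]) auto
  ultimately show "(\<lambda>n. fourier (\<lambda>t. abel n t * plus_part f t) x) \<longlonglongrightarrow> closed_ext f (of_real x)"
    by (simp only:)
qed

lemma closed_ext_line_hat_class0:
  assumes f: "has_fourier f G" and G: "G \<in> hat_class0" and y: "y \<ge> 0"
  shows "(\<lambda>x. closed_ext f (of_real x + \<i> * of_real y)) \<in> hat_class0"
proof -
  have sq: "square_integrable f" using f by (simp add: has_fourier_iff)
  note [measurable] = square_integrableD[OF sq]
  obtain C a where C: "C \<ge> 0" "0 < a" "a < 1"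
    and h: "\<And>z w. Im z \<ge> 0 \<Longrightarrow> Im w \<ge> 0 \<Longrightarrow> dist (closed_ext f z) (closed_ext f w) \<le> C * dist z w powr a"
    using closed_ext_hoelder[OF f G] by blast
  have "cmod (closed_ext f (of_real x + \<i> * of_real y) - closed_ext f (of_real x' + \<i> * of_real y)) \<le> C * \<bar>x - x'\<bar> powr a" for x x'
    using h[of "of_real x + \<i> * of_real y" "of_real x' + \<i> * of_real y"] y
    by (simp add: dist_norm flip: of_real_diff)
  moreover have "square_integrable (\<lambda>x. closed_ext f (of_real x + \<i> * of_real y))"
  proof (cases "y = 0")
    case True
    then show ?thesis using has_fourier_closed_ext[OF f G] by (simp add: has_fourier_iff)
  next
    case False
    then have y: "y > 0" using y by simp
    have i: "integrable lborel (\<lambda>t. f t * expk (\<i> * of_real y) t)"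
      by (rule square_integrable_mult_integrable[OF sq square_integrable_expk]) (use y in simp)
    have "square_integrable (\<lambda>t. f t * expk (\<i> * of_real y) t)"
      by (rule square_integrable_bound[OF sq])
         (use y in \<open>auto simp: norm_mult expk_def norm_exp_i_upper indicator_def mult_left_le\<close>)
    from square_integrable_fourier[OF i this] show ?thesis
      using y by (simp add: closed_ext_upper upper_ext_line[OF sq])
  qed
  ultimately show ?thesis using C unfolding hat_class0_def hoelder_continuous_def by (auto intro!: less_imp_le)
qed

text \<open>At large height this is the bound by the inverse square root of the height. In the remaining strip there are
  finitely many horizontal lines such that every point is close to one of them; on each line the function
  vanishes at infinity, and the Hoelder estimate covers the gaps.\<close>

lemma closed_ext_vanishes:
  assumes f: "has_fourier f G" and G: "G \<in> hat_class0" and e: "e > 0"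
  shows "\<exists>R. \<forall>z. Im z \<ge> 0 \<longrightarrow> cmod z \<ge> R \<longrightarrow> cmod (closed_ext f z) < e"
proof -
  have sq: "square_integrable f" using f by (simp add: has_fourier_iff)
  obtain C1 where C1: "C1 \<ge> 0" "\<And>z. Im z > 0 \<Longrightarrow> cmod (upper_ext f z) \<le> C1 / sqrt (Im z)"
    using norm_upper_ext_le[OF sq] by blast
  \<comment> \<open>above height \<open>Y\<close> the bound \<open>C1 / sqrt (Im z)\<close> is below \<open>e\<close>\<close>
  define Y where "Y = (C1 / e)\<^sup>2 + 1"
  have Y: "Y > 0" unfolding Y_def by (simp add: add_nonneg_pos)
  have high: "cmod (closed_ext f z) < e" if z: "Im z \<ge> Y" for z
  proof -
    have "C1 / e < sqrt (Im z)"
      by (rule real_less_rsqrt) (use z in \<open>simp add: Y_def\<close>)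
    then have "C1 / sqrt (Im z) < e" using e z Y by (simp add: field_simps)
    then show ?thesis using C1(2)[of z] z Y by (simp add: closed_ext_upper)
  qed
  obtain C a where C: "C \<ge> 0" "0 < a" "a < 1"
    and h: "\<And>z w. Im z \<ge> 0 \<Longrightarrow> Im w \<ge> 0 \<Longrightarrow> dist (closed_ext f z) (closed_ext f w) \<le> C * dist z w powr a"
    using closed_ext_hoelder[OF f G] by blast
  \<comment> \<open>the spacing of the lines, over which the function varies by less than \<open>e / 2\<close>\<close>
  define d where "d = (e / (2 * (C + 1))) powr (1 / a)"
  have d: "d > 0" unfolding d_def using e C by simp
  have da: "d powr a = e / (2 * (C + 1))" unfolding d_def using C e by (simp add: powr_powr)
  have Cd: "C * d powr a < e / 2" unfolding da using C e by (simp add: field_simps)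
  define N where "N = nat \<lceil>Y / d\<rceil>"
  have "\<forall>k. \<exists>X. \<forall>x. \<bar>x\<bar> \<ge> X \<longrightarrow> cmod (closed_ext f (of_real x + \<i> * of_real (real k * d))) < e / 2"
  proof
    fix k :: nat
    have "real k * d \<ge> 0" using d by simp
    from hat_class0_vanishes[OF closed_ext_line_hat_class0[OF f G this] half_gt_zero[OF e]]
    show "\<exists>X. \<forall>x. \<bar>x\<bar> \<ge> X \<longrightarrow> cmod (closed_ext f (of_real x + \<i> * of_real (real k * d))) < e / 2" .
  qed
  then obtain X where X: "\<And>k x. \<bar>x\<bar> \<ge> X k \<Longrightarrow> cmod (closed_ext f (of_real x + \<i> * of_real (real k * d))) < e / 2"
    by metis
  define R where "R = Y + (\<Sum>k\<le>N. \<bar>X k\<bar>)"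
  have "cmod (closed_ext f z) < e" if z: "Im z \<ge> 0" "cmod z \<ge> R" for z
  proof (cases "Im z \<ge> Y")
    case False
    define k where "k = nat \<lfloor>Im z / d\<rfloor>"
    have k: "real k = of_int \<lfloor>Im z / d\<rfloor>" unfolding k_def using z d by simp
    have k1: "real k * d \<le> Im z" "Im z < (real k + 1) * d"
    proof -
      have "real k \<le> Im z / d" unfolding k by simp
      then show "real k * d \<le> Im z" using d by (simp add: field_simps)
      have "Im z / d < real k + 1" unfolding k by linarith
      then show "Im z < (real k + 1) * d" using d by (simp add: field_simps)
    qed
    have "k \<le> N"
    proof -
      have "Im z / d \<le> Y / d" using False d by (intro divide_right_mono) auto
      then show ?thesis unfolding k_def N_def by (intro nat_mono) linarith
    qed
    then have "\<bar>X k\<bar> \<le> (\<Sum>k\<le>N. \<bar>X k\<bar>)" by (intro member_le_sum) auto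
    moreover have "cmod z \<le> \<bar>Re z\<bar> + \<bar>Im z\<bar>" by (rule cmod_le)
    ultimately have "\<bar>Re z\<bar> \<ge> X k" using z False unfolding R_def by linarith
    then have small: "cmod (closed_ext f (of_real (Re z) + \<i> * of_real (real k * d))) < e / 2" by (rule X)
    let ?w = "of_real (Re z) + \<i> * of_real (real k * d)"
    have "z - ?w = \<i> * of_real (Im z - real k * d)" by (simp add: complex_eq_iff)
    then have "dist z ?w = \<bar>Im z - real k * d\<bar>" unfolding dist_norm by (simp only: norm_mult norm_ii norm_of_real mult_1)
    then have "dist z ?w \<le> d" using k1 by (simp add: algebra_simps)
    have "dist (closed_ext f z) (closed_ext f ?w) \<le> C * dist z ?w powr a" by (rule h) (use z d in auto)
    also have "\<dots> \<le> C * d powr a" using \<open>dist z ?w \<le> d\<close> C by (intro mult_left_mono powr_mono2) auto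
    also note Cd
    finally have "cmod (closed_ext f z - closed_ext f ?w) < e / 2" by (simp add: dist_norm)
    then show ?thesis using small norm_triangle_sub[of "closed_ext f z" "closed_ext f ?w"] by linarith
  qed (rule high)
  then show ?thesis by blast
qed

section \<open>Splitting into boundary values from above and below\<close>

lemma closed_ext_line_continuous:
  assumes f: "has_fourier f G" and G: "G \<in> hat_class0"
  shows "continuous_on UNIV (\<lambda>x. closed_ext f (of_real x))"
  by (rule continuous_on_compose2[OF closed_ext_continuous[OF f G]]) (auto intro!: continuous_intros)

text \<open>The two half-line parts of \<open>f\<close> add up to \<open>f\<close> off the point 0, so their transforms add up to \<open>G\<close> almost
  everywhere, and everywhere by continuity.\<close>

lemma closed_ext_split:
  assumes f: "has_fourier f G" and G: "G \<in> hat_class0"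
  shows "G x = closed_ext f (of_real x) + closed_ext (\<lambda>t. f (- t)) (of_real (- x))"
proof -
  have [measurable]: "f \<in> borel_measurable borel" using f by (auto simp: has_fourier_iff dest: square_integrableD)
  let ?r = "\<lambda>t. f (- t)"
  have r: "has_fourier ?r (\<lambda>x. G (- x))" and Gr: "(\<lambda>x. G (- x)) \<in> hat_class0"
    by (rule has_fourier_reflect[OF f] hat_class0_reflect[OF G])+
  have cr: "continuous_on UNIV (\<lambda>x. closed_ext ?r (of_real (- x)))"
    by (rule continuous_on_compose2[OF closed_ext_line_continuous[OF r Gr]]) (auto intro!: continuous_intros)
  have sum: "has_fourier (\<lambda>t. plus_part f t + plus_part ?r (- t)) (\<lambda>x. closed_ext f (of_real x) + closed_ext ?r (of_real (- x)))"
    using has_fourier_add[OF has_fourier_closed_ext[OF f G] has_fourier_reflect[OF has_fourier_closed_ext[OF r Gr]]] by simp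
  have "has_fourier f (\<lambda>x. closed_ext f (of_real x) + closed_ext ?r (of_real (- x)))"
    by (rule has_fourier_cong_AE_left[OF sum])
       (use AE_nonzero in \<open>auto simp: plus_part_def elim!: eventually_mono\<close>)
  then have "AE x in lborel. G x = closed_ext f (of_real x) + closed_ext ?r (of_real (- x))"
    by (rule has_fourier_unique[OF f])
  then show ?thesis
    using G by (intro continuous_eq_if_AE_eq[of G] hoelder_continuous_on continuous_intros cr
        closed_ext_line_continuous[OF f G]) (auto simp: hat_class0_def)
qed

text \<open>Cauchy's theorem for a half-disc of radius \<open>R\<close> in the closed half-plane. Boundedness of \<open>H\<close> suffices,
  because the square in the denominator makes the integral over the arc of order \<open>1 / R\<close>.\<close>

lemma integral_cauchy2_upper_analytic:
  assumes c: "continuous_on {z. Im z \<ge> 0} H" and hol: "H holomorphic_on {z. Im z > 0}"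
    and M: "\<And>z. Im z \<ge> 0 \<Longrightarrow> cmod (H z) \<le> M" and w: "Im w < 0"
  shows "(LINT x|lborel. H (of_real x) * (1 / (of_real x - w)\<^sup>2)) = 0"
proof -
  define g where "g z = H z * (1 / (z - w)\<^sup>2)" for z
  have M0: "M \<ge> 0" using order_trans[OF norm_ge_zero M[of 0]] by simp
  have nz: "z - w \<noteq> 0" if "Im z \<ge> 0" for z using that w by auto
  have gc: "continuous_on {z. Im z \<ge> 0} g"
    unfolding g_def using nz by (intro continuous_intros c) auto
  have cH: "continuous_on UNIV (\<lambda>x. H (of_real x))"
    by (rule continuous_on_compose2[OF c]) (auto intro!: continuous_intros)
  have "integrable lborel (\<lambda>x. 1 / (of_real (0 + - 1 * x) - (- w))\<^sup>2)"
    by (rule lborel_integrable_real_affine[where f = "\<lambda>x. 1 / (of_real x - (- w))\<^sup>2"]) (use w integrable_cauchy2[of "- w"] in auto)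
  then have "integrable lborel (\<lambda>x. 1 / (of_real x - w)\<^sup>2)" by (simp add: power2_commute)
  from integrable_mult_bounded[OF this borel_measurable_continuous_onI[OF cH] M]
  have gi: "integrable lborel (\<lambda>x. g (of_real x))" by (simp add: g_def mult.commute)
  define I where "I R = (LINT x|lborel. cut R (\<lambda>x. g (of_real x)) x)" for R
  have bound: "cmod (I R) \<le> M * pi * R / (R - cmod w)\<^sup>2" if R: "R > cmod w" for R
  proof -
    have R0: "R > 0" using R norm_ge_zero[of w] by linarith
    let ?l = "linepath (of_real (- R)) (of_real R) :: real \<Rightarrow> complex"
    let ?p = "part_circlepath 0 R 0 pi"
    have seg: "closed_segment (complex_of_real (- R)) (of_real R) \<subseteq> {z. Im z \<ge> 0}"
      by (rule closed_segment_subset) (auto intro: convex_halfspace_Im_ge)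
    have arc: "path_image ?p \<subseteq> {z. Im z \<ge> 0}"
      using R0 by (auto simp: path_image_part_circlepath Im_exp sin_ge_zero intro!: mult_nonneg_nonneg)
    have cl: "(g has_contour_integral contour_integral ?l g) ?l"
      by (intro has_contour_integral_integral contour_integrable_continuous_linepath continuous_on_subset[OF gc seg])
    have cp: "(g has_contour_integral contour_integral ?p g) ?p"
      by (intro has_contour_integral_integral contour_integrable_continuous_part_circlepath continuous_on_subset[OF gc arc])
    have "(g has_contour_integral 0) (?l +++ ?p)"
    proof (rule Cauchy_theorem_convex[where S = "{z. Im z \<ge> 0}" and K = "{}"])
      have "g holomorphic_on {z. Im z > 0}"
        unfolding g_def using nz by (intro holomorphic_intros hol) auto
      then show "g field_differentiable at x" if "x \<in> interior {z. Im z \<ge> 0} - {}" for x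
      proof -
        have "interior {z. Im z \<ge> 0} = {z. Im z > 0}"
          using interior_halfspace_ge[of \<i> 0] by (simp add: inner_complex_def)
        then show ?thesis
          using that holomorphic_on_imp_differentiable_at[OF \<open>g holomorphic_on _\<close> open_halfspace_Im_gt] by simp
      qed
      show "path_image (?l +++ ?p) \<subseteq> {z. Im z \<ge> 0}"
        by (rule subset_path_image_join) (use seg arc in auto)
    qed (auto intro!: gc convex_halfspace_Im_ge simp: exp_Euler)
    then have "contour_integral ?l g + contour_integral ?p g = 0"
      using has_contour_integral_unique[OF has_contour_integral_join[OF cl cp]] by simp
    then have "cmod (contour_integral ?l g) = cmod (contour_integral ?p g)"
      by (simp add: add_eq_0_iff2)
    also have "\<dots> \<le> (M / (R - cmod w)\<^sup>2) * R * (pi - 0)"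
    proof (rule has_contour_integral_bound_part_circlepath[OF cp])
      fix z assume z: "z \<in> path_image ?p"
      have "cmod z = R" using in_path_image_part_circlepath[OF z] R0 by simp
      then have "R - cmod w \<le> cmod (z - w)" using norm_triangle_ineq2[of z w] by simp
      then have "(R - cmod w)\<^sup>2 \<le> (cmod (z - w))\<^sup>2" using R by (intro power_mono) auto
      moreover have "(R - cmod w)\<^sup>2 > 0" using R by simp
      moreover have "cmod (H z) \<le> M" using M z arc by auto
      ultimately show "cmod (g z) \<le> M / (R - cmod w)\<^sup>2"
        unfolding g_def norm_mult norm_divide norm_power using M0
        by (simp add: frac_le)
    qed (use R0 M0 in auto)
    also have "contour_integral ?l g = I R"
    proof -
      have "contour_integral ?l g = integral {-R..R} (\<lambda>x. g (of_real x))"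
        using R0 by (subst contour_integral_linepath_Reals_eq) auto
      also have "\<dots> = (LINT x:{-R..R}|lborel. g (of_real x))"
        by (rule set_borel_integral_eq_integral(2)[symmetric])
           (auto simp: set_integrable_def intro!: integrable_mult_indicator gi)
      finally show ?thesis by (simp add: I_def cut_def set_lebesgue_integral_def)
    qed
    finally show ?thesis by (simp add: mult_ac)
  qed
  have lim: "(\<lambda>n. I (real n)) \<longlonglongrightarrow> (LINT x|lborel. g (of_real x))"
    unfolding I_def
  proof (rule integral_dominated_convergence[where w = "\<lambda>x. cmod (g (of_real x))"])
    show "AE x in lborel. (\<lambda>n. cut (real n) (\<lambda>x. g (of_real x)) x) \<longlonglongrightarrow> g (of_real x)"
    proof (intro AE_I2 tendsto_eventually)
      fix x :: real
      show "\<forall>\<^sub>F n in sequentially. cut (real n) (\<lambda>x. g (of_real x)) x = g (of_real x)"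
        using eventually_ge_at_top[of "nat \<lceil>\<bar>x\<bar>\<rceil>"]
      proof eventually_elim
        case (elim n)
        then have "\<bar>x\<bar> \<le> real n" by linarith
        then have "x \<in> {- real n..real n}" by auto
        then show ?case by (simp add: cut_def)
      qed
    qed
  qed (use gi borel_measurable_integrable[OF gi] in \<open>auto simp: cut_def indicator_def\<close>)
  have "(\<lambda>n. I (real n)) \<longlonglongrightarrow> 0"
  proof (rule Lim_null_comparison)
    show "\<forall>\<^sub>F n in sequentially. norm (I (real n)) \<le> M * pi * real n / (real n - cmod w)\<^sup>2"
      using eventually_gt_at_top[of "nat \<lceil>cmod w\<rceil>"] by eventually_elim (rule bound, linarith)
    have "((\<lambda>x. M * pi * x / (x - cmod w)\<^sup>2) \<longlongrightarrow> 0) at_top"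
      by real_asymp
    then show "(\<lambda>n. M * pi * real n / (real n - cmod w)\<^sup>2) \<longlonglongrightarrow> 0"
      by (rule filterlim_compose[OF _ filterlim_real_sequentially])
  qed
  with lim have "(LINT x|lborel. g (of_real x)) = 0" by (rule LIMSEQ_unique)
  then show ?thesis by (simp add: g_def)
qed

text \<open>A boundary value from above has no spectrum on the negative half-line: the extension built from the reflected
  \<open>f\<close> has derivative 0 by Cauchy's theorem, and it vanishes at infinity.\<close>

lemma has_fourier_plus_part_if_upper_analytic:
  assumes c: "continuous_on {z. Im z \<ge> 0} H" and hol: "H holomorphic_on {z. Im z > 0}"
    and M: "\<And>z. Im z \<ge> 0 \<Longrightarrow> cmod (H z) \<le> M"
    and h: "(\<lambda>x. H (of_real x)) \<in> hat_class0" and f: "has_fourier f (\<lambda>x. H (of_real x))"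
  shows "has_fourier (plus_part f) (\<lambda>x. H (of_real x))"
proof -
  let ?r = "\<lambda>t. f (- t)"
  have r: "has_fourier ?r (\<lambda>x. H (of_real (- x)))" and hr: "(\<lambda>x. H (of_real (- x))) \<in> hat_class0"
    using has_fourier_reflect[OF f] hat_class0_reflect[OF h] by auto
  have sqr: "square_integrable ?r" using r by (simp add: has_fourier_iff)
  have "(upper_ext ?r has_field_derivative 0) (at z)" if z: "Im z > 0" for z
  proof -
    have "(LINT x|lborel. H (of_real (- x)) * (1 / (of_real x - z)\<^sup>2)) = (LINT x|lborel. H (of_real x) * (1 / (of_real x - (- z))\<^sup>2))"
      by (subst lborel_integral_real_affine[of "-1" _ 0]) (auto simp: power2_commute add.commute)
    also have "\<dots> = 0" by (rule integral_cauchy2_upper_analytic[OF c hol M]) (use z in auto)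
    finally show ?thesis using upper_ext_has_cauchy_derivative[OF r z] by simp
  qed
  then obtain k where k: "\<And>z. Im z > 0 \<Longrightarrow> upper_ext ?r z = k"
    using has_field_derivative_zero_constant[OF convex_halfspace_Im_gt[of 0], of "upper_ext ?r"]
    by (metis has_field_derivative_at_within mem_Collect_eq)
  have "k = 0"
  proof (rule ccontr)
    assume "k \<noteq> 0"
    obtain R where R: "\<And>z. Im z \<ge> 0 \<Longrightarrow> cmod z \<ge> R \<Longrightarrow> cmod (closed_ext ?r z) < cmod k"
      using closed_ext_vanishes[OF r hr, of "cmod k"] \<open>k \<noteq> 0\<close> by auto
    have "cmod (closed_ext ?r (\<i> * of_real (\<bar>R\<bar> + 1))) < cmod k"
      by (rule R) (auto simp: norm_mult simp del: of_real_add)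
    then show False by (subst (asm) closed_ext_upper) (auto simp: k)
  qed
  have r0: "closed_ext ?r (of_real x) = 0" for x
  proof -
    have "((upper_ext ?r) \<longlongrightarrow> 0) (at (of_real x) within {w. Im w > 0})"
      by (rule tendsto_eventually) (auto simp: eventually_at_filter k \<open>k = 0\<close>)
    from tendsto_Lim[OF at_within_upper_nontrivial this] show ?thesis
      by (simp add: closed_ext_def)
  qed
  have "H (of_real x) = closed_ext f (of_real x)" for x
    using closed_ext_split[OF f h, of x] r0[of "- x"] by simp
  then show ?thesis using has_fourier_closed_ext[OF f h] by simp
qed

section \<open>The exponential of a boundary value\<close>

lemma closed_ext_bounded:
  assumes f: "has_fourier f G" and G: "G \<in> hat_class0"
  shows "\<exists>M. \<forall>z. Im z \<ge> 0 \<longrightarrow> cmod (closed_ext f z) \<le> M"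
proof -
  obtain R where R: "\<And>z. Im z \<ge> 0 \<Longrightarrow> cmod z \<ge> R \<Longrightarrow> cmod (closed_ext f z) < 1"
    using closed_ext_vanishes[OF f G, of 1] by auto
  have "compact (cball 0 R \<inter> {z. Im z \<ge> 0})"
    by (intro compact_Int_closed compact_cball closed_halfspace_Im_ge)
  then have "compact (closed_ext f ` (cball 0 R \<inter> {z. Im z \<ge> 0}))"
    by (intro compact_continuous_image continuous_on_subset[OF closed_ext_continuous[OF f G]]) auto
  from compact_imp_bounded[OF this] obtain B where B: "\<forall>u\<in>closed_ext f ` (cball 0 R \<inter> {z. Im z \<ge> 0}). norm u \<le> B"
    unfolding bounded_iff by blast
  have "cmod (closed_ext f z) \<le> max B 1" if z: "Im z \<ge> 0" for z
  proof (cases "cmod z \<le> R")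
    case True
    then have "z \<in> cball 0 R \<inter> {z. Im z \<ge> 0}" using z by simp
    then show ?thesis using B by (meson imageI max.coboundedI1)
  next
    case False
    then show ?thesis using R[OF z] by simp
  qed
  then show ?thesis by blast
qed

lemma norm_exp_diff_le:
  assumes "cmod u \<le> M" "cmod v \<le> M"
  shows "cmod (exp u - exp v) \<le> exp M * cmod (u - v)"
proof (rule field_differentiable_bound[where S = "cball 0 M" and f' = exp])
  fix z :: complex assume "z \<in> cball 0 M"
  then have "Re z \<le> M" using complex_Re_le_cmod[of z] by simp
  then show "cmod (exp z) \<le> exp M" by simp
qed (use assms in \<open>auto intro!: derivative_eq_intros\<close>)

lemma hat_class0_exp_minus_1:
  assumes L: "L \<in> hat_class0" shows "(\<lambda>x. exp (L x) - 1) \<in> hat_class0"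
proof -
  obtain M where M: "M > 0" "\<And>x. cmod (L x) \<le> M" using hat_class0_bounded[OF L] by blast
  have sq: "square_integrable L" and "hoelder_continuous L" using L by (auto simp: hat_class0_def)
  from hoelder_continuousD[OF this(2)] obtain C a where
    C: "0 < a" "a \<le> 1" "\<And>x y. cmod (L x - L y) \<le> C * \<bar>x - y\<bar> powr a" by blast
  note [measurable] = square_integrableD[OF sq]
  have "cmod ((exp (L x) - 1) - (exp (L y) - 1)) \<le> (exp M * C) * \<bar>x - y\<bar> powr a" for x y
  proof -
    have "cmod (exp (L x) - exp (L y)) \<le> exp M * cmod (L x - L y)" by (intro norm_exp_diff_le M)
    also have "\<dots> \<le> exp M * (C * \<bar>x - y\<bar> powr a)" by (intro mult_left_mono C) auto
    finally show ?thesis by simp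
  qed
  moreover have "square_integrable (\<lambda>x. exp (L x) - 1)"
  proof (rule square_integrable_bound_scaled[OF sq])
    show "cmod (exp (L x) - 1) \<le> exp M * cmod (L x)" for x
      using norm_exp_diff_le[of "L x" M 0] M by (auto simp: less_imp_le)
  qed measurable
  ultimately show ?thesis using C unfolding hat_class0_def hoelder_continuous_def by blast
qed

section \<open>Factors in a half-plane\<close>

text \<open>The conditions on one of the two factors. Those on the other are the same after the
  reflection \<open>z \<mapsto> - z\<close>.\<close>

definition plus_factor :: "(complex \<Rightarrow> complex) \<Rightarrow> (real \<Rightarrow> complex) \<Rightarrow> bool" where
  "plus_factor P p \<longleftrightarrow> P holomorphic_on {z. Im z > 0} \<and>
     (\<forall>t. (P \<longlongrightarrow> p t) (at (complex_of_real t) within {z. Im z > 0})) \<and>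
     (\<lambda>t. p t - 1) \<in> hat_class_plus"

lemma hat_class_plus_uminus_iff:
  "(\<lambda>x. F (- x)) \<in> hat_class_plus \<longleftrightarrow> F \<in> hat_class_minus"
proof -
  \<comment> \<open>The sign compensates for the one in \<open>minus_part\<close>.\<close>
  have refl: "(\<lambda>t. - f (- t)) \<in> class0" if "f \<in> class0" for f
    using that has_fourier_uminus[OF has_fourier_reflect] hat_class0_uminus[OF hat_class0_reflect]
    unfolding class0_def by blast
  have eq: "(\<lambda>t. plus_part f (- t)) = minus_part (\<lambda>t. - f (- t))" for f
    by (auto simp: plus_part_def minus_part_def)
  have eq': "(\<lambda>t. minus_part f (- t)) = plus_part (\<lambda>t. - f (- t))" for f
    by (auto simp: plus_part_def minus_part_def)
  show ?thesis
  proof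
    assume "(\<lambda>x. F (- x)) \<in> hat_class_plus"
    then obtain f where f: "f \<in> class0" "has_fourier (plus_part f) (\<lambda>x. F (- x))"
      unfolding hat_class_plus_def class_plus_def by blast
    from has_fourier_reflect[OF f(2)] have "has_fourier (minus_part (\<lambda>t. - f (- t))) F" by (simp add: eq)
    then show "F \<in> hat_class_minus" using refl[OF f(1)] unfolding hat_class_minus_def class_minus_def by blast
  next
    assume "F \<in> hat_class_minus"
    then obtain f where f: "f \<in> class0" "has_fourier (minus_part f) F"
      unfolding hat_class_minus_def class_minus_def by blast
    from has_fourier_reflect[OF f(2)] have "has_fourier (plus_part (\<lambda>t. - f (- t))) (\<lambda>x. F (- x))" by (simp add: eq')
    then show "(\<lambda>x. F (- x)) \<in> hat_class_plus" using refl[OF f(1)] unfolding hat_class_plus_def class_plus_def by blast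
  qed
qed

lemma tendsto_uminus_within:
  fixes f :: "complex \<Rightarrow> complex"
  shows "((\<lambda>z. f (- z)) \<longlongrightarrow> l) (at (- a) within uminus ` S) \<longleftrightarrow> (f \<longlongrightarrow> l) (at a within S)"
proof -
  have [simp]: "dist (- x) (- a) = dist x a" for x by (simp add: dist_norm norm_minus_commute)
  show ?thesis unfolding Lim_within by simp
qed

lemma uminus_lower: "uminus ` {z. Im z < 0} = {z. Im z > 0}" "uminus ` {z. Im z > 0} = {z. Im z < 0}"
  by (auto simp: image_iff intro!: exI[of _ "- x" for x])

lemma RH_factorisation_iff_plus_factor:
  "RH_factorisation K P N \<longleftrightarrow>
    (\<exists>p n. plus_factor P p \<and> plus_factor (\<lambda>z. N (- z)) (\<lambda>t. n (- t)) \<and> (\<forall>t. K t = p t * n t))"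
proof -
  have hol: "(\<lambda>z. N (- z)) holomorphic_on {z. Im z > 0} \<longleftrightarrow> N holomorphic_on {z. Im z < 0}"
  proof
    assume "(\<lambda>z. N (- z)) holomorphic_on {z. Im z > 0}"
    then have "((\<lambda>z. N (- z)) \<circ> uminus) holomorphic_on {z. Im z < 0}"
      by (intro holomorphic_on_compose holomorphic_intros) (simp only: uminus_lower)
    then show "N holomorphic_on {z. Im z < 0}" by (simp add: comp_def)
  next
    assume "N holomorphic_on {z. Im z < 0}"
    then have "(N \<circ> uminus) holomorphic_on {z. Im z > 0}"
      by (intro holomorphic_on_compose holomorphic_intros) (simp only: uminus_lower)
    then show "(\<lambda>z. N (- z)) holomorphic_on {z. Im z > 0}" by (simp add: comp_def)
  qed
  have lim: "(\<forall>t. ((\<lambda>z. N (- z)) \<longlongrightarrow> n (- t)) (at (complex_of_real t) within {z. Im z > 0}))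
     \<longleftrightarrow> (\<forall>t. (N \<longlongrightarrow> n t) (at (complex_of_real t) within {z. Im z < 0}))" for n
  proof -
    have *: "((\<lambda>z. N (- z)) \<longlongrightarrow> n t) (at (complex_of_real (- t)) within {z. Im z > 0})
       \<longleftrightarrow> (N \<longlongrightarrow> n t) (at (complex_of_real t) within {z. Im z < 0})" for t
      using tendsto_uminus_within[of N "n t" "of_real t" "{z. Im z < 0}"] by (simp add: uminus_lower)
    show ?thesis
    proof (intro iffI allI)
      fix t
      assume "\<forall>t. ((\<lambda>z. N (- z)) \<longlongrightarrow> n (- t)) (at (complex_of_real t) within {z. Im z > 0})"
      from spec[OF this, of "- t"] show "(N \<longlongrightarrow> n t) (at (complex_of_real t) within {z. Im z < 0})"
        using *[of t] by simp
    next
      fix t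
      assume "\<forall>t. (N \<longlongrightarrow> n t) (at (complex_of_real t) within {z. Im z < 0})"
      from spec[OF this, of "- t"] show "((\<lambda>z. N (- z)) \<longlongrightarrow> n (- t)) (at (complex_of_real t) within {z. Im z > 0})"
        using *[of "- t"] by simp
    qed
  qed
  have cls: "(\<lambda>t. n (- t) - 1) \<in> hat_class_plus \<longleftrightarrow> (\<lambda>t. n t - 1) \<in> hat_class_minus" for n
    using hat_class_plus_uminus_iff[of "\<lambda>t. n t - 1"] by simp
  show ?thesis unfolding RH_factorisation_def plus_factor_def hol lim cls by blast
qed

lemma plus_factor_exp:
  assumes k: "has_fourier k L" and L: "L \<in> hat_class0"
  shows "plus_factor (factor_plus k) (\<lambda>t. exp (closed_ext k (of_real t)))"
  unfolding plus_factor_def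
proof (intro conjI allI)
  have sq: "square_integrable k" using k by (simp add: has_fourier_iff)
  note fp = factor_plus_eq[OF square_integrableD[OF sq]]
  have hol: "upper_ext k holomorphic_on {z. Im z > 0}" by (rule upper_ext_holomorphic[OF sq])
  then show "factor_plus k holomorphic_on {z. Im z > 0}"
    unfolding fp[abs_def] by (intro holomorphic_intros)
  note cont = closed_ext_continuous[OF k L]
  show "(factor_plus k \<longlongrightarrow> exp (closed_ext k (of_real t))) (at (complex_of_real t) within {z. Im z > 0})" for t
  proof -
    have "(closed_ext k \<longlongrightarrow> closed_ext k (of_real t)) (at (complex_of_real t) within {z. Im z \<ge> 0})"
      using cont by (simp add: continuous_on_def)
    then have "(closed_ext k \<longlongrightarrow> closed_ext k (of_real t)) (at (complex_of_real t) within {z. Im z > 0})"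
      by (rule tendsto_within_subset) auto
    then have "((\<lambda>z. exp (closed_ext k z)) \<longlongrightarrow> exp (closed_ext k (of_real t))) (at (complex_of_real t) within {z. Im z > 0})"
      by (intro tendsto_intros)
    then show ?thesis
      by (rule Lim_transform_eventually) (auto simp: eventually_at_filter closed_ext_upper fp)
  qed
  define H where "H z = exp (closed_ext k z) - 1" for z
  have b0: "(\<lambda>x. closed_ext k (of_real x)) \<in> hat_class0"
    using closed_ext_line_hat_class0[OF k L, of 0] by simp
  have h: "(\<lambda>x. H (of_real x)) \<in> hat_class0" unfolding H_def by (rule hat_class0_exp_minus_1[OF b0])
  obtain M where M: "\<And>z. Im z \<ge> 0 \<Longrightarrow> cmod (closed_ext k z) \<le> M" using closed_ext_bounded[OF k L] by blast
  have HM: "cmod (H z) \<le> exp M + 1" if "Im z \<ge> 0" for z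
  proof -
    have "cmod (H z) \<le> cmod (exp (closed_ext k z)) + 1" unfolding H_def using norm_triangle_ineq4[of "exp (closed_ext k z)" 1] by simp
    moreover have "Re (closed_ext k z) \<le> M" using M[OF that] complex_Re_le_cmod[of "closed_ext k z"] by linarith
    then have "exp (Re (closed_ext k z)) \<le> exp M" by simp
    ultimately show ?thesis by (simp only: norm_exp_eq_Re)
  qed
  obtain g where "has_fourier (\<lambda>x. H (of_real x)) g"
    using has_fourier_exists h by (auto simp: hat_class0_def)
  from fourier_inversion[OF h this] have f: "has_fourier (\<lambda>t. g (- t)) (\<lambda>x. H (of_real x))" .
  have "has_fourier (plus_part (\<lambda>t. g (- t))) (\<lambda>x. H (of_real x))"
  proof (rule has_fourier_plus_part_if_upper_analytic[OF _ _ HM h f])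
    show "continuous_on {z. Im z \<ge> 0} H" unfolding H_def by (intro continuous_intros cont)
    have "(\<lambda>z. exp (upper_ext k z) - 1) holomorphic_on {z. Im z > 0}" by (intro holomorphic_intros hol)
    then show "H holomorphic_on {z. Im z > 0}"
      by (rule holomorphic_transform) (simp add: H_def closed_ext_upper)
  qed
  moreover have "(\<lambda>t. g (- t)) \<in> class0" using f h unfolding class0_def by blast
  ultimately show "(\<lambda>t. exp (closed_ext k (of_real t)) - 1) \<in> hat_class_plus"
    unfolding hat_class_plus_def class_plus_def H_def by blast
qed

lemma factor_minus_eq: "factor_minus k z = factor_plus (\<lambda>t. k (- t)) (- z)"
proof -
  have "(LINT t:{..0}|lborel. k t * exp (\<i> * z * of_real t)) = (LINT t:{0..}|lborel. k (- t) * exp (\<i> * (- z) * of_real t))"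
    unfolding set_lebesgue_integral_def
    by (subst lborel_integral_real_affine[of "-1" _ 0]) (auto simp: indicator_def intro!: Bochner_Integration.integral_cong)
  then show ?thesis by (simp add: factor_minus_def factor_plus_def)
qed

text \<open>The exponential of the splitting of \<open>L\<close>.\<close>

theorem RH_factorisation_exists:
  assumes k: "has_fourier k L" and L: "L \<in> hat_class0"
  shows "RH_factorisation (\<lambda>t. exp (L t)) (factor_plus k) (factor_minus k)"
  unfolding RH_factorisation_iff_plus_factor
proof (intro exI conjI allI)
  let ?r = "\<lambda>t. k (- t)"
  show "plus_factor (factor_plus k) (\<lambda>t. exp (closed_ext k (of_real t)))" by (rule plus_factor_exp[OF k L])
  show "plus_factor (\<lambda>z. factor_minus k (- z)) (\<lambda>t. (\<lambda>t. exp (closed_ext ?r (of_real (- t)))) (- t))"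
    using plus_factor_exp[OF has_fourier_reflect[OF k] hat_class0_reflect[OF L]] by (simp add: factor_minus_eq)
  show "exp (L t) = exp (closed_ext k (of_real t)) * exp (closed_ext ?r (of_real (- t)))" for t
    unfolding closed_ext_split[OF k L] exp_add ..
qed

section \<open>Uniqueness of the factorisation\<close>

text \<open>Limits are only assumed along the open half-plane. That they depend continuously on the boundary point, and
  are approached along the line as well, follows by passing to the limit in an estimate that holds in a half-disc.\<close>

lemma continuous_on_boundary_extension:
  fixes P :: "complex \<Rightarrow> complex"
  assumes P: "continuous_on {z. Im z > 0} P"
    and lim: "\<And>t. (P \<longlongrightarrow> p t) (at (complex_of_real t) within {z. Im z > 0})"
  shows "continuous_on {z. Im z \<ge> 0} (\<lambda>z. if Im z > 0 then P z else p (Re z))"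
    (is "continuous_on _ ?Q")
  unfolding continuous_on_eq_continuous_within
proof
  fix z assume z: "z \<in> {z. Im z \<ge> 0}"
  show "continuous (at z within {z. Im z \<ge> 0}) ?Q"
  proof (cases "Im z > 0")
    case True
    have Pz: "isCont P z" using P True by (simp add: continuous_on_eq_continuous_at open_halfspace_Im_gt)
    have "\<forall>\<^sub>F w in nhds z. P w = ?Q w"
      by (rule eventually_mono[OF eventually_nhds_in_open[OF open_halfspace_Im_gt[of 0]]]) (use True in auto)
    from isCont_cong[OF this] Pz have "isCont ?Q z" by (rule iffD1)
    then show ?thesis by (rule continuous_at_imp_continuous_within)
  next
    case False
    define t where "t = Re z"
    have zt: "z = of_real t" using z False by (simp add: t_def complex_eq_iff)
    show ?thesis
      unfolding continuous_within_eps_delta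
    proof (intro allI impI)
      fix e :: real assume e: "e > 0"
      from lim[of t, unfolded Lim_within, rule_format, OF half_gt_zero[OF e]]
      obtain d where d: "d > 0"
        and P_near: "\<forall>w\<in>{z. Im z > 0}. 0 < dist w (of_real t) \<and> dist w (of_real t) < d \<longrightarrow> dist (P w) (p t) < e / 2"
        by blast
      have close: "dist (P w) (p t) < e / 2" if "Im w > 0" "dist w (of_real t) < d" for w
      proof -
        have "w \<noteq> of_real t" using that(1) by auto
        then show ?thesis using P_near that by simp
      qed
      have "dist (?Q w) (?Q z) < e" if w: "Im w \<ge> 0" "dist w z < d" for w
      proof (cases "Im w > 0")
        case True
        then show ?thesis using close[OF True] w zt e by (simp add: less_le_trans)
      next
        case False
        define s where "s = Re w"
        have ws: "w = of_real s" using w False by (simp add: s_def complex_eq_iff)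
        have "dist (p s) (p t) \<le> e / 2"
        proof (rule tendsto_upperbound)
          show "((\<lambda>u. dist (P u) (p t)) \<longlongrightarrow> dist (p s) (p t)) (at (complex_of_real s) within {z. Im z > 0})"
            by (intro tendsto_dist lim tendsto_const)
          have "\<forall>\<^sub>F u in at (complex_of_real s) within {z. Im z > 0}. dist u (of_real t) < d"
            using w(2) unfolding ws zt
            by (intro order_tendstoD(2)[OF tendsto_dist[OF tendsto_ident_at tendsto_const]])
          moreover have "\<forall>\<^sub>F u in at (complex_of_real s) within {z. Im z > 0}. Im u > 0"
            by (simp add: eventually_at_filter)
          ultimately show "\<forall>\<^sub>F u in at (complex_of_real s) within {z. Im z > 0}. dist (P u) (p t) \<le> e / 2"
            by eventually_elim (use close in \<open>auto intro: less_imp_le\<close>)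
          show "at (complex_of_real s) within {z. Im z > 0} \<noteq> bot"
            by (rule at_within_upper_nontrivial) simp
        qed
        then show ?thesis using e by (simp add: ws zt)
      qed
      with d show "\<exists>d>0. \<forall>x'\<in>{z. Im z \<ge> 0}. dist x' z < d \<longrightarrow> dist (?Q x') (?Q z) < e" by blast
    qed
  qed
qed

text \<open>Extended by 0 to the lower half-plane, \<open>F\<close> becomes an entire function that vanishes on an open set.\<close>

lemma zero_if_boundary_zero:
  assumes c: "continuous_on {z. Im z \<ge> 0} F" and hol: "F holomorphic_on {z. Im z > 0}"
    and zero: "\<And>t. F (complex_of_real t) = 0" and z: "Im z > 0"
  shows "F z = 0"
proof -
  define D where "D z = (if Im z \<ge> 0 then F z else 0)" for z
  have real: "Im z = 0 \<Longrightarrow> F z = 0" for z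
    using zero[of "Re z"] by (metis complex_is_Real_iff of_real_Re)
  have "continuous_on ({z. Im z \<ge> 0} \<union> {z. Im z \<le> 0}) D"
    unfolding D_def
    by (rule continuous_on_cases[OF closed_halfspace_Im_ge closed_halfspace_Im_le c]) (auto simp: real)
  moreover have "{z. Im z \<ge> 0} \<union> {z. Im z \<le> 0} = UNIV" by auto
  ultimately have Dc: "continuous_on UNIV D" by simp
  have "D holomorphic_on UNIV"
  proof (rule holomorphic_on_paste_across_line[of UNIV \<i> D 0])
    have "(\<lambda>z. 0) holomorphic_on {z. Im z < 0}" by (rule holomorphic_on_const)
    then show "D holomorphic_on UNIV \<inter> {z. \<i> \<bullet> z < 0}"
      by (rule holomorphic_transform[where g = D, THEN holomorphic_on_subset]) (auto simp: D_def inner_complex_def)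
    show "D holomorphic_on UNIV \<inter> {z. 0 < \<i> \<bullet> z}"
      by (rule holomorphic_transform[where g = D, THEN holomorphic_on_subset, OF hol]) (auto simp: D_def inner_complex_def)
  qed (use Dc in auto)
  then have "D z = 0"
    by (rule analytic_continuation_open[of "{z. Im z < 0}" UNIV D "\<lambda>_. 0", rotated 5])
       (auto simp: D_def open_halfspace_Im_lt intro: exI[of _ "- \<i>"])
  then show ?thesis using z by (simp add: D_def)
qed

text \<open>The behaviour at infinity inside the half-plane is forced by the boundary values: those of \<open>P - 1\<close> are the ones
  of an extension \<open>closed_ext g\<close>, two analytic functions with the same boundary values coincide, and
  \<open>closed_ext g\<close> vanishes at infinity.\<close>

lemma plus_factor_tendsto_1:
  assumes "plus_factor P p"
  defines "B \<equiv> \<lambda>z. if Im z > 0 then P z else p (Re z)"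
  shows "continuous_on {z. Im z \<ge> 0} B"
    and "e > 0 \<Longrightarrow> \<exists>R. \<forall>z. Im z \<ge> 0 \<longrightarrow> cmod z \<ge> R \<longrightarrow> cmod (B z - 1) < e"
proof -
  have hol: "P holomorphic_on {z. Im z > 0}"
    and lim: "\<And>t. (P \<longlongrightarrow> p t) (at (complex_of_real t) within {z. Im z > 0})"
    and cls: "(\<lambda>t. p t - 1) \<in> hat_class_plus" using assms(1) by (auto simp: plus_factor_def)
  show Bc: "continuous_on {z. Im z \<ge> 0} B"
    unfolding B_def by (intro continuous_on_boundary_extension lim holomorphic_on_imp_continuous_on hol)
  obtain g G where g: "has_fourier (plus_part g) (\<lambda>t. p t - 1)" and G: "has_fourier g G" "G \<in> hat_class0"
    using cls unfolding hat_class_plus_def class_plus_def class0_def by blast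
  have sq: "square_integrable g" using G by (simp add: has_fourier_iff)
  have pc: "continuous_on UNIV (\<lambda>t. p t)"
  proof -
    have "continuous_on UNIV (\<lambda>t. B (complex_of_real t))"
      by (rule continuous_on_compose2[OF Bc]) (auto intro!: continuous_intros)
    then show ?thesis by (simp add: B_def)
  qed
  have p: "p t - 1 = closed_ext g (of_real t)" for t
  proof (rule continuous_eq_if_AE_eq[of "\<lambda>t. p t - 1"])
    show "continuous_on UNIV (\<lambda>t. p t - 1)" by (intro continuous_intros pc)
    show "continuous_on UNIV (\<lambda>t. closed_ext g (of_real t))" by (rule closed_ext_line_continuous[OF G])
    show "AE t in lborel. p t - 1 = closed_ext g (of_real t)"
      by (rule has_fourier_unique[OF g has_fourier_closed_ext[OF G]])
  qed
  have up: "B z - 1 - closed_ext g z = 0" if "Im z > 0" for z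
  proof (rule zero_if_boundary_zero[OF _ _ _ that, of "\<lambda>z. B z - 1 - closed_ext g z"])
    show "continuous_on {z. Im z \<ge> 0} (\<lambda>z. B z - 1 - closed_ext g z)"
      by (intro continuous_intros Bc closed_ext_continuous[OF G])
    have "(\<lambda>z. P z - 1 - upper_ext g z) holomorphic_on {z. Im z > 0}"
      by (intro holomorphic_intros hol upper_ext_holomorphic sq)
    then show "(\<lambda>z. B z - 1 - closed_ext g z) holomorphic_on {z. Im z > 0}"
      by (rule holomorphic_transform) (simp add: B_def closed_ext_upper)
    show "B (of_real t) - 1 - closed_ext g (of_real t) = 0" for t
      using p[of t] by (simp add: B_def)
  qed
  have "B z - 1 = closed_ext g z" if "Im z \<ge> 0" for z
  proof (cases "Im z > 0")
    case False
    then have "z = of_real (Re z)" using that by (simp add: complex_eq_iff)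
    then show ?thesis using p[of "Re z"] False by (simp add: B_def)
  qed (use up in simp)
  then show "\<exists>R. \<forall>z. Im z \<ge> 0 \<longrightarrow> cmod z \<ge> R \<longrightarrow> cmod (B z - 1) < e" if "e > 0"
    using closed_ext_vanishes[OF G that] by simp
qed

lemma norm_divide_minus_1_less:
  assumes "cmod (a - 1) < d" "cmod (b - 1) < d" "d \<le> 1 / 2" "4 * d \<le> e"
  shows "cmod (a / b - 1) < e"
proof -
  have b: "cmod b > 1 / 2" using norm_triangle_ineq2[of 1 b] assms by (simp add: norm_minus_commute)
  then have b0: "b \<noteq> 0" by auto
  have "cmod (a - b) < 2 * d"
    using norm_triangle_ineq4[of "a - 1" "b - 1"] assms by simp
  then have "cmod (a - b) < 4 * d * (1 / 2)" by simp
  also have "\<dots> \<le> e * cmod b"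
  proof (rule mult_mono)
    show "0 \<le> e" using assms norm_ge_zero[of "a - 1"] by linarith
  qed (use assms b in auto)
  finally have "cmod (a - b) / cmod b < e" using b by (subst pos_divide_less_eq) auto
  moreover have "a / b - 1 = (a - b) / b" using b0 by (simp add: field_simps)
  ultimately show ?thesis by (simp add: norm_divide)
qed

text \<open>On the line \<open>p / q = m / n\<close>, as \<open>p n = q m = K\<close>. The quotient \<open>P / Q\<close> above the line and \<open>M / N\<close> below it
  therefore form a single entire function.\<close>

theorem RH_factorisation_unique:
  assumes P: "RH_factorisation K P N" and Q: "RH_factorisation K Q M"
    and K: "\<And>t. K t \<noteq> 0"
    and Q0: "\<And>z. Im z > 0 \<Longrightarrow> Q z \<noteq> 0" and N0: "\<And>z. Im z < 0 \<Longrightarrow> N z \<noteq> 0"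
  shows "(\<forall>z. Im z > 0 \<longrightarrow> P z = Q z) \<and> (\<forall>z. Im z < 0 \<longrightarrow> N z = M z)"
proof -
  obtain p n where p: "plus_factor P p" and n: "plus_factor (\<lambda>z. N (- z)) (\<lambda>t. n (- t))" and pn: "\<And>t. K t = p t * n t"
    using P unfolding RH_factorisation_iff_plus_factor by blast
  obtain q m where q: "plus_factor Q q" and m: "plus_factor (\<lambda>z. M (- z)) (\<lambda>t. m (- t))" and qm: "\<And>t. K t = q t * m t"
    using Q unfolding RH_factorisation_iff_plus_factor by blast
  define A where "A z = (if Im z > 0 then P z else p (Re z)) / (if Im z > 0 then Q z else q (Re z))" for z
  define B where "B z = (if Im z > 0 then M (- z) else m (- Re z)) / (if Im z > 0 then N (- z) else n (- Re z))" for z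
  have nz: "q t \<noteq> 0" "n t \<noteq> 0" for t using pn[of t] qm[of t] K[of t] by auto
  have Ac: "continuous_on {z. Im z \<ge> 0} A"
    unfolding A_def using Q0 nz by (intro continuous_on_divide plus_factor_tendsto_1(1) p q) auto
  have Bc: "continuous_on {z. Im z \<ge> 0} B"
    unfolding B_def using N0 nz
    by (intro continuous_on_divide plus_factor_tendsto_1(1)[OF m] plus_factor_tendsto_1(1)[OF n]) auto
  have AB: "A (of_real t) = B (of_real (- t))" for t
    using pn[of t] qm[of t] nz[of t] by (simp add: A_def B_def field_simps)
  define T where "T z = (if Im z \<ge> 0 then A z else B (- z))" for z
  have "continuous_on ({z. Im z \<ge> 0} \<union> {z. Im z \<le> 0}) T"
    unfolding T_def
  proof (rule continuous_on_cases[OF closed_halfspace_Im_ge closed_halfspace_Im_le Ac])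
    show "continuous_on {z. Im z \<le> 0} (\<lambda>z. B (- z))"
      by (rule continuous_on_compose2[OF Bc]) (auto intro!: continuous_intros)
    show "\<forall>z. z \<in> {z. 0 \<le> Im z} \<and> \<not> 0 \<le> Im z \<or> z \<in> {z. Im z \<le> 0} \<and> 0 \<le> Im z \<longrightarrow> A z = B (- z)"
    proof (intro allI impI)
      fix z :: complex assume "z \<in> {z. 0 \<le> Im z} \<and> \<not> 0 \<le> Im z \<or> z \<in> {z. Im z \<le> 0} \<and> 0 \<le> Im z"
      then have "z = of_real (Re z)" by (auto simp: complex_eq_iff)
      then show "A z = B (- z)" using AB[of "Re z"] by (metis of_real_minus)
    qed
  qed
  moreover have "{z. Im z \<ge> 0} \<union> {z. Im z \<le> 0} = UNIV" by auto
  ultimately have Tc: "continuous_on UNIV T" by simp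
  have Thol: "T holomorphic_on UNIV"
  proof (rule holomorphic_on_paste_across_line[of UNIV \<i> T 0])
    have "(\<lambda>z. P z / Q z) holomorphic_on {z. Im z > 0}"
      using p q Q0 by (intro holomorphic_intros) (auto simp: plus_factor_def)
    then show "T holomorphic_on UNIV \<inter> {z. 0 < \<i> \<bullet> z}"
      by (rule holomorphic_transform[where g = T, THEN holomorphic_on_subset]) (auto simp: T_def A_def inner_complex_def)
    have "(\<lambda>z. M z / N z) holomorphic_on {z. Im z < 0}"
      using P Q N0 by (intro holomorphic_intros) (auto simp: RH_factorisation_def)
    then show "T holomorphic_on UNIV \<inter> {z. \<i> \<bullet> z < 0}"
      by (rule holomorphic_transform[where g = T, THEN holomorphic_on_subset]) (auto simp: T_def B_def inner_complex_def)
  qed (use Tc in auto)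
  have "(T \<longlongrightarrow> 1) at_infinity"
    unfolding Lim_at_infinity
  proof (intro allI impI)
    fix e :: real assume e: "e > 0"
    \<comment> \<open>if numerator and denominator are within \<open>d\<close> of 1, the quotient is within \<open>4 d\<close> of 1\<close>
    define d where "d = min (1 / 2) (e / 4)"
    have d: "d > 0" "d \<le> 1 / 2" "4 * d \<le> e" using e by (auto simp: d_def)
    obtain R1 where R1: "\<And>z. Im z \<ge> 0 \<Longrightarrow> cmod z \<ge> R1 \<Longrightarrow> cmod ((if Im z > 0 then P z else p (Re z)) - 1) < d"
      using plus_factor_tendsto_1(2)[OF p d(1)] by blast
    obtain R2 where R2: "\<And>z. Im z \<ge> 0 \<Longrightarrow> cmod z \<ge> R2 \<Longrightarrow> cmod ((if Im z > 0 then Q z else q (Re z)) - 1) < d"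
      using plus_factor_tendsto_1(2)[OF q d(1)] by blast
    obtain R3 where R3: "\<And>z. Im z \<ge> 0 \<Longrightarrow> cmod z \<ge> R3 \<Longrightarrow> cmod ((if Im z > 0 then M (- z) else m (- Re z)) - 1) < d"
      using plus_factor_tendsto_1(2)[OF m d(1)] by blast
    obtain R4 where R4: "\<And>z. Im z \<ge> 0 \<Longrightarrow> cmod z \<ge> R4 \<Longrightarrow> cmod ((if Im z > 0 then N (- z) else n (- Re z)) - 1) < d"
      using plus_factor_tendsto_1(2)[OF n d(1)] by blast
    have "dist (T z) 1 < e" if z: "cmod z \<ge> max (max R1 R2) (max R3 R4)" for z
    proof (cases "Im z \<ge> 0")
      case True
      then show ?thesis using z
        unfolding T_def A_def dist_norm by (simp only: if_True) (intro norm_divide_minus_1_less[OF R1 R2 d(2,3)]; simp)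
    next
      case False
      then have "cmod (B (- z) - 1) < e" using z
        unfolding B_def by (intro norm_divide_minus_1_less[OF R3 R4 d(2,3)]; simp)
      then show ?thesis using False by (simp add: T_def dist_norm)
    qed
    then show "\<exists>b. \<forall>x. norm x \<ge> b \<longrightarrow> dist (T x) 1 < e" by blast
  qed
  with Thol have T1: "T z = 1" for z by (rule Liouville_weak)
  show ?thesis
  proof (intro conjI allI impI)
    show "P z = Q z" if "Im z > 0" for z
      using T1[of z] that Q0[OF that] by (simp add: T_def A_def)
    show "N z = M z" if "Im z < 0" for z
      using T1[of z] that N0[OF that] by (simp add: T_def B_def)
  qed
qed

section \<open>The continuous logarithm on the line\<close>

lemma norm_le_exp_minus_1:
  assumes "cmod w \<le> 1 / 4" shows "cmod w \<le> 2 * cmod (exp w - 1)"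
proof -
  have "exp (cmod w) \<le> exp (1 / 2)" using assms by simp
  also have "exp (1 / 2) \<le> (2::real)" by (rule exp_half_le2)
  finally have "exp (cmod w) * (cmod w)\<^sup>2 \<le> 2 * (cmod w * (1 / 4))"
    unfolding power2_eq_square using assms by (intro mult_mono) auto
  with norm_exp_remainder[of w] have "cmod (exp w - 1 - w) \<le> cmod w / 2" by simp
  moreover have "cmod w \<le> cmod (exp w - 1) + cmod (exp w - 1 - w)"
    using norm_triangle_ineq4[of "exp w - 1" "exp w - 1 - w"] by simp
  ultimately show ?thesis by simp
qed

lemma eventually_outside:
  assumes "\<forall>\<^sub>F x in at_top. P x" "\<forall>\<^sub>F x in at_bot. P x"
  shows "\<exists>X. \<forall>x::real. \<bar>x\<bar> \<ge> X \<longrightarrow> P x"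
proof -
  obtain A B where A: "\<And>x. x \<ge> A \<Longrightarrow> P x" and B: "\<And>x. x \<le> B \<Longrightarrow> P x"
    using assms by (auto simp: eventually_at_top_linorder eventually_at_bot_linorder)
  have "P x" if "\<bar>x\<bar> \<ge> \<bar>A\<bar> + \<bar>B\<bar>" for x
    using A[of x] B[of x] that by (cases "x \<ge> 0") auto
  then show ?thesis by blast
qed

text \<open>Where \<open>L\<close> is small it is comparable to \<open>K - 1 = exp L - 1\<close>, which yields square integrability. For nearby points
  \<open>L x - L y\<close> is small and is comparable to \<open>K x / K y - 1\<close>, where \<open>K\<close> is bounded away from 0; for distant points
  boundedness of \<open>L\<close> is enough.\<close>

lemma logarithm_in_hat_class0:
  assumes K0: "\<And>t. K t \<noteq> 0" and K: "(\<lambda>t. K t - 1) \<in> hat_class0"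
    and c: "continuous_on UNIV L" and eL: "\<And>t. exp (L t) = K t"
    and top: "(L \<longlongrightarrow> 0) at_top" and bot: "(L \<longlongrightarrow> 0) at_bot"
  shows "L \<in> hat_class0"
proof -
  have sqK: "square_integrable (\<lambda>t. K t - 1)" and hK: "hoelder_continuous (\<lambda>t. K t - 1)"
    using K by (auto simp: hat_class0_def)
  have cK: "continuous_on UNIV K"
    using continuous_on_add[OF hoelder_continuous_on[OF hK] continuous_on_const[of _ 1]] by simp
  obtain C a where C: "C \<ge> 0" "0 < a" "a \<le> 1" and "\<And>x y. cmod ((K x - 1) - (K y - 1)) \<le> C * \<bar>x - y\<bar> powr a"
    using hoelder_continuousD[OF hK] by blast
  then have KC: "\<And>x y. cmod (K x - K y) \<le> C * \<bar>x - y\<bar> powr a" by simp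
  \<comment> \<open>Differences of two values below 1/8 meet the bound 1/4 under which \<open>norm_le_exp_minus_1\<close> applies.\<close>
  have "\<exists>X. \<forall>x. \<bar>x\<bar> \<ge> X \<longrightarrow> cmod (L x) < 1 / 8"
    by (rule eventually_outside) (use tendstoD[OF top, of "1/8"] tendstoD[OF bot, of "1/8"] in auto)
  then obtain X where X: "\<And>x. \<bar>x\<bar> \<ge> X \<Longrightarrow> cmod (L x) < 1 / 8" by blast
  obtain B where B: "B > 0" "\<And>x. cmod (L x) \<le> B"
    using bounded_if_tendsto_at_infinity[OF c, of X "1/8"] X by (auto simp: less_imp_le)
  have inv: "cmod (1 / K x) \<le> exp B" for x
  proof -
    have "1 / K x = exp (- L x)" by (simp add: eL exp_minus divide_inverse)
    moreover have "- Re (L x) \<le> B" using B(2)[of x] abs_Re_le_cmod[of "L x"] by linarith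
    ultimately show ?thesis by simp
  qed
  have "uniformly_continuous_on {-X-1..X+1} L"
    by (intro compact_uniformly_continuous continuous_on_subset[OF c]) auto
  then obtain d0 where d0: "d0 > 0" "\<And>x y. x \<in> {-X-1..X+1} \<Longrightarrow> y \<in> {-X-1..X+1} \<Longrightarrow> dist y x < d0 \<Longrightarrow> dist (L y) (L x) < 1 / 4"
    unfolding uniformly_continuous_on_def by (metis zero_less_divide_1_iff zero_less_numeral)
  define d where "d = min (d0 / 2) 1"
  have d: "d > 0" using d0 by (simp add: d_def)
  have near: "cmod (L x - L y) \<le> 1 / 4" if xy: "\<bar>x - y\<bar> \<le> d" for x y
  proof (cases "x \<in> {-X-1..X+1} \<and> y \<in> {-X-1..X+1}")
    case True
    have "dist x y < d0" using xy d0(1) by (auto simp: d_def dist_real_def min_def split: if_splits)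
    then show ?thesis using d0(2)[of y x] True by (simp add: dist_norm less_imp_le)
  next
    case False
    have "\<bar>x - y\<bar> \<le> 1" using xy by (simp add: d_def)
    then have "\<bar>x\<bar> \<ge> X" "\<bar>y\<bar> \<ge> X" using False by auto
    from X[OF this(1)] X[OF this(2)] show ?thesis using norm_triangle_ineq4[of "L x" "L y"] by linarith
  qed
  let ?C = "2 * exp B * C + 2 * B * d powr (- a)"
  have "cmod (L x - L y) \<le> ?C * \<bar>x - y\<bar> powr a" for x y
  proof (cases "\<bar>x - y\<bar> \<le> d")
    case True
    have "cmod (L x - L y) \<le> 2 * cmod (exp (L x - L y) - 1)" by (intro norm_le_exp_minus_1 near True)
    also have "exp (L x - L y) - 1 = (K x - K y) * (1 / K y)"
      using K0[of y] by (simp add: exp_diff eL field_simps)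
    also have "2 * cmod ((K x - K y) * (1 / K y)) \<le> 2 * ((C * \<bar>x - y\<bar> powr a) * exp B)"
      unfolding norm_mult[of "K x - K y"] using C by (intro mult_left_mono mult_mono KC inv) auto
    also have "\<dots> = (2 * exp B * C) * \<bar>x - y\<bar> powr a" by simp
    also have "\<dots> \<le> ?C * \<bar>x - y\<bar> powr a" using B by (intro mult_right_mono) auto
    finally show ?thesis .
  next
    case False
    have "cmod (L x - L y) \<le> 2 * B" using norm_triangle_ineq4[of "L x" "L y"] B(2)[of x] B(2)[of y] by linarith
    also have "\<dots> = 2 * B * d powr (- a) * d powr a" using d by (simp add: powr_minus)
    also have "\<dots> \<le> 2 * B * d powr (- a) * \<bar>x - y\<bar> powr a"
      using False d B C by (intro mult_left_mono powr_mono2) auto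
    also have "\<dots> \<le> ?C * \<bar>x - y\<bar> powr a" using C by (intro mult_right_mono) auto
    finally show ?thesis .
  qed
  then have "hoelder_continuous L" unfolding hoelder_continuous_def using C by blast
  moreover have "square_integrable L"
  proof (rule square_integrable_bound)
    have "square_integrable (\<lambda>x. complex_of_real (2 * cmod (K x - 1)))"
      by (rule square_integrable_bound_scaled[OF sqK, of _ 2])
         (use square_integrableD[OF sqK] in \<open>auto simp: norm_mult\<close>)
    then show "square_integrable (\<lambda>x. complex_of_real (2 * cmod (K x - 1)) + of_real B * indicator {-X..X} x)"
      by (intro square_integrable_add square_integrable_scale square_integrable_indicator)
    show "L \<in> borel_measurable borel" by (rule borel_measurable_continuous_onI[OF c])
    fix x
    show "cmod (L x) \<le> cmod (complex_of_real (2 * cmod (K x - 1)) + of_real B * indicator {-X..X} x)"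
    proof (cases "x \<in> {-X..X}")
      case True
      have "cmod (complex_of_real (2 * cmod (K x - 1)) + of_real B) = 2 * cmod (K x - 1) + B"
        using B(1) unfolding of_real_add[symmetric] norm_of_real by simp
      then show ?thesis using True B(2)[of x] norm_ge_zero[of "K x - 1"] by (simp add: add_increasing)
    next
      case False
      then have "\<bar>x\<bar> \<ge> X" by auto
      from X[OF this] norm_le_exp_minus_1[of "L x"] show ?thesis using False by (simp add: eL norm_mult)
    qed
  qed
  ultimately show ?thesis by (simp add: hat_class0_def)
qed

text \<open>Two continuous logarithms differ by a continuous function with values in \<open>2 \<pi> \<i> \<int>\<close>, hence by a
  constant, which the limit at infinity determines.\<close>

lemma ln_line_eq:
  assumes c: "continuous_on UNIV L" and eL: "\<And>t. exp (L t) = K t" and top: "(L \<longlongrightarrow> 0) at_top"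
  shows "ln_line K = L"
  unfolding ln_line_def
proof (rule the_equality)
  fix M assume M: "continuous_on UNIV M \<and> (\<forall>t. exp (M t) = K t) \<and> (M \<longlongrightarrow> 0) at_top"
  have int: "\<exists>n::int. M t - L t = of_real (2 * pi * of_int n) * \<i>" for t
  proof -
    have "exp (M t) = exp (L t)" using M eL by simp
    then obtain n :: int where "M t = L t + (of_int (2 * n) * pi) * \<i>" by (auto simp: exp_eq)
    then have "M t - L t = of_real (2 * pi * of_int n) * \<i>" by simp
    then show ?thesis ..
  qed
  have "(\<lambda>t. M t - L t) constant_on UNIV"
  proof (rule continuous_discrete_range_constant)
    show "continuous_on UNIV (\<lambda>t. M t - L t)" using M c by (intro continuous_intros) auto
    fix x :: real
    have "2 * pi \<le> norm ((M y - L y) - (M x - L x))" if ne: "M y - L y \<noteq> M x - L x" for y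
    proof -
      obtain n k :: int where nk: "M y - L y = of_real (2 * pi * of_int n) * \<i>" "M x - L x = of_real (2 * pi * of_int k) * \<i>"
        using int by meson
      with ne have "n \<noteq> k" by auto
      then have "1 \<le> \<bar>n - k\<bar>" by linarith
      then have "1 \<le> \<bar>real_of_int n - real_of_int k\<bar>" by (metis of_int_abs of_int_diff of_int_1_le_iff)
      then have "2 * pi * 1 \<le> 2 * pi * \<bar>real_of_int n - real_of_int k\<bar>" by (intro mult_left_mono) auto
      moreover have "(M y - L y) - (M x - L x) = of_real (2 * pi * (of_int n - of_int k)) * \<i>"
        unfolding nk by (simp add: algebra_simps)
      then have "norm ((M y - L y) - (M x - L x)) = 2 * pi * \<bar>real_of_int n - real_of_int k\<bar>"
        by (simp only: norm_mult norm_of_real norm_ii abs_mult) simp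
      ultimately show ?thesis by simp
    qed
    then show "\<exists>e>0. \<forall>y. y \<in> UNIV \<and> M y - L y \<noteq> M x - L x \<longrightarrow> e \<le> norm (M y - L y - (M x - L x))"
      by (intro exI[of _ "2 * pi"]) auto
  qed simp
  then obtain k where k: "\<And>t. M t - L t = k" unfolding constant_on_def by auto
  have "((\<lambda>t. M t - L t) \<longlongrightarrow> 0 - 0) at_top" using M top by (intro tendsto_intros) auto
  then have "((\<lambda>t::real. k) \<longlongrightarrow> 0) at_top" by (simp add: k)
  then have "k = 0" by (simp add: tendsto_const_iff)
  then show "M = L" using k by (intro ext) simp
qed (use assms in auto)

text \<open>The logarithm is read off from a continuous argument \<open>\<theta>\<close>. As \<open>K\<close> tends to 1, the limit \<open>a\<close> of \<open>\<theta>\<close> is a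
  multiple of \<open>2 \<pi>\<close> and can be subtracted; since the index is 0, this makes the logarithm vanish at both ends.\<close>

lemma ln_line_in_hat_class0:
  assumes K0: "\<And>t. K t \<noteq> 0" and K: "(\<lambda>t. K t - 1) \<in> hat_class0" and ind: "has_index K 0"
  shows "ln_line K \<in> hat_class0" and "exp (ln_line K t) = K t"
proof -
  obtain \<theta> a b where \<theta>: "continuous_on UNIV \<theta>" and pol: "\<And>t. K t = rcis (cmod (K t)) (\<theta> t)"
    and at: "(\<theta> \<longlongrightarrow> a) at_top" and bt: "(\<theta> \<longlongrightarrow> b) at_bot" and "0 = (a - b) / (2 * pi)"
    using ind unfolding has_index_def by blast
  then have ab: "b = a" by simp
  have hK: "hoelder_continuous (\<lambda>t. K t - 1)" using K by (auto simp: hat_class0_def)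
  have cK: "continuous_on UNIV K"
    using continuous_on_add[OF hoelder_continuous_on[OF hK] continuous_on_const[of _ 1]] by simp
  note lim = hat_class0_tendsto_0[OF K, THEN LIM_zero_cancel]
  have "cis a = 1"
  proof (rule tendsto_unique[OF trivial_limit_at_top_linorder])
    show "((\<lambda>t. cis (\<theta> t)) \<longlongrightarrow> cis a) at_top" by (intro tendsto_cis at)
    have "((\<lambda>t. K t / of_real (cmod (K t))) \<longlongrightarrow> 1 / of_real (cmod 1)) at_top"
      by (intro tendsto_intros lim) auto
    moreover have "K t / of_real (cmod (K t)) = cis (\<theta> t)" for t
      using pol[of t] K0[of t] by (simp add: rcis_def divide_eq_eq mult.commute)
    ultimately show "((\<lambda>t. cis (\<theta> t)) \<longlongrightarrow> 1) at_top" by simp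
  qed
  define L where "L t = of_real (ln (cmod (K t))) + \<i> * of_real (\<theta> t - a)" for t
  have eL: "exp (L t) = K t" for t
  proof -
    have "exp (L t) = of_real (cmod (K t)) * cis (\<theta> t - a)"
      using K0[of t] by (simp add: L_def exp_add exp_of_real cis_conv_exp)
    also have "cis (\<theta> t - a) = cis (\<theta> t)" using \<open>cis a = 1\<close> by (simp flip: cis_divide)
    finally show ?thesis using pol[of t] by (simp add: rcis_def)
  qed
  have cL: "continuous_on UNIV L"
    unfolding L_def using K0 by (intro continuous_intros cK \<theta>) auto
  have tL: "(L \<longlongrightarrow> 0) F" if "(K \<longlongrightarrow> 1) F" "(\<theta> \<longlongrightarrow> a) F" for F
  proof -
    have "(L \<longlongrightarrow> of_real (ln (cmod 1)) + \<i> * of_real (a - a)) F"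
      unfolding L_def using that by (intro tendsto_intros) auto
    then show ?thesis by simp
  qed
  have "ln_line K = L" by (rule ln_line_eq[OF cL eL tL[OF lim(1) at]])
  moreover have "L \<in> hat_class0"
    by (rule logarithm_in_hat_class0[OF K0 K cL eL tL[OF lim(1) at] tL[OF lim(2) bt[unfolded ab]]])
  ultimately show "ln_line K \<in> hat_class0" "exp (ln_line K t) = K t" using eL by auto
qed

theorem theorem6p6:
  fixes K :: "real \<Rightarrow> complex"
  assumes "\<And>t. K t \<noteq> 0"
    and "(\<lambda>t. K t - 1) \<in> hat_class0"
    and "has_index K 0"
  shows "(\<exists>\<kappa>. has_inverse_fourier (ln_line K) \<kappa>) \<and>
    (\<forall>\<kappa>. has_inverse_fourier (ln_line K) \<kappa> \<longrightarrow>
       RH_factorisation K (factor_plus \<kappa>) (factor_minus \<kappa>) \<and>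
       (\<forall>Kp Km. RH_factorisation K Kp Km \<and>
          (\<forall>z. Im z > 0 \<longrightarrow> Kp z \<noteq> 0) \<and> (\<forall>z. Im z < 0 \<longrightarrow> Km z \<noteq> 0) \<longrightarrow>
          (\<forall>z. Im z > 0 \<longrightarrow> Kp z = factor_plus \<kappa> z) \<and>
          (\<forall>z. Im z < 0 \<longrightarrow> Km z = factor_minus \<kappa> z)))"
proof (intro conjI allI impI)
  note L = ln_line_in_hat_class0[OF assms]
  have "square_integrable (ln_line K)" using L(1) by (simp add: hat_class0_def)
  from has_fourier_exists[OF this] obtain g where "has_fourier (ln_line K) g" by blast
  then show "\<exists>\<kappa>. has_inverse_fourier (ln_line K) \<kappa>"
    unfolding has_inverse_fourier_iff by (intro exI[of _ "\<lambda>t. g (- t)"]) simp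
  fix \<kappa> assume "has_inverse_fourier (ln_line K) \<kappa>"
  from fourier_inversion[OF L(1) this[unfolded has_inverse_fourier_iff]]
  have \<kappa>: "has_fourier \<kappa> (ln_line K)" by simp
  show RH: "RH_factorisation K (factor_plus \<kappa>) (factor_minus \<kappa>)"
    using RH_factorisation_exists[OF \<kappa> L(1)] by (simp add: L(2))
  fix Kp Km
  assume A: "RH_factorisation K Kp Km \<and> (\<forall>z. Im z > 0 \<longrightarrow> Kp z \<noteq> 0) \<and> (\<forall>z. Im z < 0 \<longrightarrow> Km z \<noteq> 0)"
  have "(\<forall>z. Im z > 0 \<longrightarrow> Kp z = factor_plus \<kappa> z) \<and> (\<forall>z. Im z < 0 \<longrightarrow> Km z = factor_minus \<kappa> z)"
    by (rule RH_factorisation_unique[OF _ RH assms(1)]) (use A in \<open>auto simp: factor_plus_def\<close>)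
  then show "Im z > 0 \<Longrightarrow> Kp z = factor_plus \<kappa> z" "Im z < 0 \<Longrightarrow> Km z = factor_minus \<kappa> z" for z
    by auto
qed

end
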